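(* Let $n\in\mathbb{N}$ and let $d$ be an integer satisfying $0\le d\le n-1$. Then $\mathbf{DI}_n^d=\mathbf{DI}_n$.
   Context: $\omega_d:=\frac{d+1}{n-d}$. $\mathbb{R}^n$ has its standard basis $\mathbf{e}_1,\dots,\mathbf{e}_n$; $\wedge^{k}\mathbb{R}^{n}$ has the basis $\{\mathbf{e}_{i_1}\wedge\cdots\wedge\mathbf{e}_{i_k}:1\le i_1<\dots<i_k\le n\}$, $\wedge^k\mathbb{Z}^n$ is the integer span of this basis (with $\wedge^0\mathbb{Z}^n=\mathbb{Z}$), and $\|\cdot\|$ is the maximum norm of coordinates in this basis. For $\varepsilon\in(0,1)$, $\mathbf{DI}_n^d(\varepsilon)$ is the set of $\mathbf{x}\in\mathbb{R}^n$ such that for all sufficiently large $N>N_0(\mathbf{x},\varepsilon)$ there exist $\mathbf{Z}\in\wedge^d\mathbb{Z}^n\setminus\{0\}$ and $\mathbf{Y}\in\wedge^{d+1}\mathbb{Z}^n$ with $\|\mathbf{Z}\|\le N$ and $\|\mathbf{x}\wedge\mathbf{Z}+\mathbf{Y}\|\le\varepsilon N^{-\omega_d}$. Then $\mathbf{DI}_n^d:=\bigcup_{\varepsilon\in(0,1)}\mathbf{DI}_n^d(\varepsilon)$. $\mathbf{DI}_n$ is the classical set of Dirichlet improvable points: $\mathbf{x}\in\mathbf{DI}_n$ if and only if there exists $\varepsilon\in(0,1)$ such that for all sufficiently large $N>N_0(\mathbf{x},\varepsilon)$ there exists $q\in\mathbb{Z}$ with $\max_{1\le i\le n}\langle qx_i\rangle<\varepsilon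 N^{-1/n}$ and $1\le q\le N$, where $\langle\cdot\rangle$ denotes distance to the nearest integer. (By a theorem of Davenport and Schmidt, the same set results from the dual condition: there is $\varepsilon\in(0,1)$ such that for all sufficiently large $N$ there is $\mathbf{q}\in\mathbb{Z}^n\setminus\{0\}$ with $\langle\mathbf{q}\cdot\mathbf{x}\rangle\le\varepsilon N^{-n}$ and $\|\mathbf{q}\|\le N$.) *)

theory Defs
  imports "HOL-Analysis.Analysis"
begin

(* The exterior algebra of R^n, for n = CARD('n), is modelled by its coordinates: the
   coordinate A $ {i1 < ... < ik} of A :: real ^ ('n set) belongs to the basis element
   e_i1 \<and> ... \<and> e_ik, i.e. "axis I 1" is the wedge of the e_i, i : I, in increasing order
   of i (lemma foldr_wedge_axis). The linear order on the index type 'n is the order of the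
   standard basis. The maximum norm of coordinates is the library's infnorm. *)

(* Sign of the permutation sorting "I increasing, then J increasing": parity of inversions. *)
definition wedge_sign :: "'n::{finite,linorder} set \<Rightarrow> 'n set \<Rightarrow> real" where
  "wedge_sign I J = (- 1) ^ card {(i, j). i \<in> I \<and> j \<in> J \<and> j < i}"

definition wedge :: "real ^ ('n::{finite,linorder} set) \<Rightarrow> real ^ ('n set) \<Rightarrow> real ^ ('n set)"
    (infixr "\<and>\<^sub>E" 75) where
  "A \<and>\<^sub>E B = (\<chi> S. \<Sum>I\<in>Pow S. wedge_sign I (S - I) * (A $ I) * (B $ (S - I)))"

definition ext_vec :: "real ^ ('n::{finite,linorder}) \<Rightarrow> real ^ ('n set)" where
  "ext_vec x = (\<Sum>i\<in>UNIV. (x $ i) *\<^sub>R axis {i} 1)"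

definition ext_power :: "nat \<Rightarrow> (real ^ ('n::{finite,linorder} set)) set" where
  "ext_power k = span ((\<lambda>I. axis I 1) ` {I. card I = k})"

definition int_ext_power :: "nat \<Rightarrow> (real ^ ('n::{finite,linorder} set)) set" where
  "int_ext_power k = {A \<in> ext_power k. \<forall>I. A $ I \<in> \<int>}"

(* Used below with n = CARD('n); the subtraction takes place in the reals. *)
definition omega :: "nat \<Rightarrow> nat \<Rightarrow> real" where
  "omega n d = (real d + 1) / (real n - real d)"

definition DI_ext_eps :: "nat \<Rightarrow> real \<Rightarrow> (real ^ ('n::{finite,linorder})) set" where
  "DI_ext_eps d \<epsilon> = {x. \<exists>N0::real. \<forall>N>N0.
      \<exists>Z \<in> int_ext_power d - {0}. \<exists>Y \<in> int_ext_power (d + 1).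
        infnorm Z \<le> N \<and> infnorm (ext_vec x \<and>\<^sub>E Z + Y) \<le> \<epsilon> * N powr (- omega CARD('n) d)}"

definition DI_ext :: "nat \<Rightarrow> (real ^ ('n::{finite,linorder})) set" where
  "DI_ext d = (\<Union>\<epsilon>\<in>{0<..<1}. DI_ext_eps d \<epsilon>)"

(* infdist y \<int> is the distance from y to the nearest integer. *)
definition DI :: "(real ^ ('n::finite)) set" where
  "DI = {x. \<exists>\<epsilon>\<in>{0<..<1}. \<exists>N0::real. \<forall>N>N0.
      \<exists>q::int. (MAX i. infdist (of_int q * x $ i) \<int>) < \<epsilon> * N powr (- (1 / real CARD('n)))
        \<and> 1 \<le> q \<and> of_int q \<le> N}"


(* The lemmas below check that the coordinate model is the exterior algebra. *)

lemma wedge_axis: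
  "(axis I 1 :: real ^ ('n::{finite,linorder} set)) \<and>\<^sub>E axis J 1 =
    (if I \<inter> J = {} then wedge_sign I J *\<^sub>R axis (I \<union> J) 1 else 0)"
proof (rule vec_eq_iff[THEN iffD2], rule allI)
  fix S :: "'n set"
  have "(axis I 1 \<and>\<^sub>E axis J 1 :: real ^ ('n set)) $ S
      = (\<Sum>K\<in>Pow S. if K = I then (if S - I = J then wedge_sign I J else 0) else 0)"
    unfolding wedge_def vec_lambda_beta by (intro sum.cong) (auto simp: axis_def)
  also have "\<dots> = (if I \<subseteq> S \<and> S - I = J then wedge_sign I J else 0)"
    by (auto simp: sum.delta)
  also have "\<dots> = (if I \<inter> J = {} then wedge_sign I J *\<^sub>R axis (I \<union> J) 1 else 0 :: real ^ ('n set)) $ S"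
    by (auto simp: axis_def)
  finally show "(axis I 1 \<and>\<^sub>E axis J 1 :: real ^ ('n set)) $ S =
    (if I \<inter> J = {} then wedge_sign I J *\<^sub>R axis (I \<union> J) 1 else 0 :: real ^ ('n set)) $ S" .
qed

lemma bilinear_wedge: "bilinear (\<and>\<^sub>E)"
  unfolding bilinear_def
  by (auto intro!: linearI
      simp: wedge_def vec_eq_iff algebra_simps sum.distrib sum_distrib_left)

lemma ext_vec_axis: "ext_vec (axis i 1) = axis {i} 1" for i :: "'n::{finite,linorder}"
proof -
  have "ext_vec (axis i 1) = (\<Sum>j\<in>UNIV. if j = i then axis {i} 1 else 0)"
    unfolding ext_vec_def by (intro sum.cong) (auto simp: axis_def)
  thus ?thesis by simp
qed

lemma foldr_wedge_axis:
  "sorted_wrt (<) is \<Longrightarrow>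
    foldr (\<lambda>i A. ext_vec (axis i 1) \<and>\<^sub>E A) is (axis {} 1) = axis (set is) 1"
proof (induction "is")
  case (Cons i "is")
  have "{(a, b). a \<in> {i} \<and> b \<in> set is \<and> b < a} = {}" using Cons.prems by auto
  hence "wedge_sign {i} (set is) = 1" unfolding wedge_sign_def by (simp only: card.empty power_0)
  moreover have "i \<notin> set is" using Cons.prems by auto
  ultimately show ?case using Cons by (simp add: ext_vec_axis wedge_axis)
qed auto

lemma wedge_self: "ext_vec x \<and>\<^sub>E ext_vec x = 0"
proof -
  define e where "e i j = (axis {i} 1 :: real ^ ('a set)) \<and>\<^sub>E axis {j} 1" for i j :: 'a
  have anti: "e j i = - e i j" for i j
  proof (cases i j rule: linorder_cases)
    case less
    have 1: "{(a, b). a = i \<and> b = j \<and> b < a} = {}" "{(a, b). a = j \<and> b = i \<and> b < a} = {(j, i)}"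
      using less by auto
    show ?thesis using less by (simp add: e_def wedge_axis wedge_sign_def 1 insert_commute)
  next
    case greater
    have 1: "{(a, b). a = j \<and> b = i \<and> b < a} = {}" "{(a, b). a = i \<and> b = j \<and> b < a} = {(i, j)}"
      using greater by auto
    show ?thesis using greater by (simp add: e_def wedge_axis wedge_sign_def 1 insert_commute)
  qed (simp add: e_def wedge_axis)
  have ex: "ext_vec x \<and>\<^sub>E ext_vec x = (\<Sum>(i, j)\<in>UNIV. (x $ i * x $ j) *\<^sub>R e i j)"
    unfolding ext_vec_def bilinear_sum[OF bilinear_wedge] UNIV_Times_UNIV e_def
    by (intro sum.cong) (auto simp: bilinear_lmul[OF bilinear_wedge] bilinear_rmul[OF bilinear_wedge] ac_simps)
  also have "\<dots> = (\<Sum>(i, j)\<in>UNIV. (x $ j * x $ i) *\<^sub>R e j i)"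
    by (rule sum.reindex_bij_witness[where i=prod.swap and j=prod.swap]) auto
  also have "\<dots> = - (\<Sum>(i, j)\<in>UNIV. (x $ i * x $ j) *\<^sub>R e i j)"
  proof -
    have "(case p of (i, j) \<Rightarrow> (x $ j * x $ i) *\<^sub>R e j i)
        = - (case p of (i, j) \<Rightarrow> (x $ i * x $ j) *\<^sub>R e i j)" for p
      using anti[of "snd p" "fst p"] by (simp add: case_prod_unfold mult.commute)
    thus ?thesis by (subst sum_negf[symmetric]) (rule sum.cong[OF refl])
  qed
  finally have "ext_vec x \<and>\<^sub>E ext_vec x = - (ext_vec x \<and>\<^sub>E ext_vec x)"
    unfolding ex[symmetric] .
  thus ?thesis by (simp add: vec_eq_iff)
qed

lemma wedge_sign_assoc:
  assumes "I \<inter> J = {}" "J \<inter> K = {}" "I \<inter> K = {}"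
  shows "wedge_sign (I \<union> J) K * wedge_sign I J = wedge_sign I (J \<union> K) * wedge_sign J K"
proof -
  let ?V = "\<lambda>I J. {(i, j). i \<in> I \<and> j \<in> J \<and> j < i}"
  have "?V (I \<union> J) K = ?V I K \<union> ?V J K" "?V I (J \<union> K) = ?V I J \<union> ?V I K" by auto
  moreover have "?V I K \<inter> ?V J K = {}" "?V I J \<inter> ?V I K = {}" using assms by auto
  ultimately have "card (?V (I \<union> J) K) = card (?V I K) + card (?V J K)"
    "card (?V I (J \<union> K)) = card (?V I J) + card (?V I K)"
    by (simp_all add: card_Un_disjoint)
  thus ?thesis by (simp add: wedge_sign_def power_add)
qed

lemma ext_expand: "A = (\<Sum>I\<in>UNIV. (A $ I) *\<^sub>R axis I 1)" for A :: "real ^ ('n::{finite,linorder} set)"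
  using basis_expansion[of A] by (simp add: scalar_mult_eq_scaleR)

lemma wedge_assoc: "(A \<and>\<^sub>E B) \<and>\<^sub>E C = A \<and>\<^sub>E (B \<and>\<^sub>E C)"
proof -
  note bl = bilinear_wedge
  have ax: "(axis I 1 \<and>\<^sub>E axis J 1) \<and>\<^sub>E axis K 1 =
      (axis I 1 \<and>\<^sub>E (axis J 1 \<and>\<^sub>E axis K 1) :: real ^ ('a set))" for I J K
    using wedge_sign_assoc[of I J K]
    by (auto simp: wedge_axis bilinear_lmul[OF bl] bilinear_rmul[OF bl] bilinear_lzero[OF bl]
        bilinear_rzero[OF bl] Int_Un_distrib Int_Un_distrib2 Un_assoc ac_simps)
  have l: "linear (\<lambda>A. A \<and>\<^sub>E B)" "linear (\<lambda>B. A \<and>\<^sub>E B)" for A B :: "real ^ ('a set)"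
    using bl by (auto simp: bilinear_def)
  note ls = linear_sum[OF l(1)] linear_sum[OF l(2)] linear_scale[OF l(1)] linear_scale[OF l(2)]
  have 1: "(axis I 1 \<and>\<^sub>E axis J 1) \<and>\<^sub>E C = axis I 1 \<and>\<^sub>E (axis J 1 \<and>\<^sub>E C)" for I J
    by (subst (1 2) ext_expand[of C]) (simp add: ls ax)
  have 2: "(axis I 1 \<and>\<^sub>E B) \<and>\<^sub>E C = axis I 1 \<and>\<^sub>E (B \<and>\<^sub>E C)" for I
    by (subst (1 2) ext_expand[of B]) (simp add: ls 1)
  show ?thesis
    by (subst (1 2) ext_expand[of A]) (simp add: ls 2)
qed

lemma ext_power_iff: "A \<in> ext_power k \<longleftrightarrow> (\<forall>I. card I \<noteq> k \<longrightarrow> A $ I = 0)"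
proof
  have "subspace {A :: real ^ ('a set). \<forall>I. card I \<noteq> k \<longrightarrow> A $ I = 0}"
    by (auto simp: subspace_def)
  hence "ext_power k \<subseteq> {A :: real ^ ('a set). \<forall>I. card I \<noteq> k \<longrightarrow> A $ I = 0}"
    unfolding ext_power_def by (intro span_minimal) (auto simp: axis_def)
  thus "A \<in> ext_power k \<Longrightarrow> \<forall>I. card I \<noteq> k \<longrightarrow> A $ I = 0" by auto
next
  assume *: "\<forall>I. card I \<noteq> k \<longrightarrow> A $ I = 0"
  have "(A $ I) *\<^sub>R axis I 1 \<in> ext_power k" for I
    using * by (cases "card I = k") (auto simp: ext_power_def intro: span_base span_scale span_zero)
  hence "(\<Sum>I\<in>UNIV. (A $ I) *\<^sub>R axis I 1) \<in> ext_power k"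
    unfolding ext_power_def by (intro span_sum) auto
  thus "A \<in> ext_power k" by (simp add: ext_expand[symmetric])
qed

end

theory Submission
  imports Defs "HOL-Library.Option_ord" "HOL-Computational_Algebra.Primes"
begin

text \<open>
  Let \<open>m = n + 1\<close>. The point \<open>x\<close> fails to be improvable in degree \<open>d\<close> iff, along some sequence
  \<open>S \<rightarrow> \<infinity>\<close>, the \<open>(d + 1)\<close>-st exterior powers of the unimodular lattices
  \<open>L\<^sub>S = {(q / S, S\<^sup>1\<^sup>/\<^sup>n (q x + y))}\<close> in \<open>\<real>\<^sup>m\<close> have no nonzero vector of maximum norm below \<open>1 - o(1)\<close>;
  the case \<open>d = 0\<close> is the classical one. So it suffices to compare the lattices \<open>L\<^sub>S\<close> with their
  \<open>k\<close>-th exterior powers for \<open>1 \<le> k \<le> n\<close>. By Minkowski's argument a limit (along an ultrafilter) of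
  unimodular lattices without short vectors tiles space by unit cubes, and by the theorem of Hajos it
  is triangular: for some order of the coordinates it has a basis that is unitriangular.

  If \<open>L\<^sub>S\<close> has no short vectors and \<open>w\<close> is a short vector of the \<open>k\<close>-th exterior power, the map
  \<open>v \<mapsto> v \<and> w\<close> sends standard basis vectors to short vectors; descending through the triangular basis
  it vanishes, provided the \<open>(k + 1)\<close>-st power has no short vectors. The top power is \<open>\<int>\<close>.

  Conversely, if the \<open>k\<close>-th power has no short vectors but \<open>L\<^sub>S\<close> has a short vector \<open>v\<close>, choose \<open>f\<close> of
  norm at most about 1 in the dual lattice. The integral operator \<open>W \<mapsto> v \<and> (f \<rfloor> W)\<close> has single
  products \<open>v\<^sub>i f\<^sub>j\<close> as off-diagonal matrix entries, and the triangular basis of the \<open>k\<close>-th power forces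
  it to vanish.

  The theorem of Hajos is reduced to rational lattices by a rational-valued additive functional
  applied to the coordinates. There it follows from a bound for irredundant covers of an abelian
  group by cosets: the index of the intersection has fewer prime factors than the cover has members.
\<close>

section \<open>Covers of abelian groups by cosets\<close>

text \<open>The norm threshold is exactly 1 in every degree, so a comparison of lattices that loses
  a constant factor proves nothing. What helps is rigidity at the extremal threshold: along a flag
  of coordinates, a limit vector with coordinates below 1 is forced to be integral, hence zero, one
  coordinate after the other. Each direction uses only the flag of the power that is assumed to have
  no short vectors. For the converse this dictates the operator: multiplication by \<open>v\<close>
  alone leaves degree \<open>k\<close>, and contraction with \<open>f\<close> comes back to it. Two
  \<open>k\<close>-sets that it relates differ by one exchange, so off-diagonal entries involve no
  sum and no binomial factor; the diagonal entries are sums and need an argument of their own.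
  Limits show only that the operators tend to zero; that they vanish for eventually all lattices
  comes from discreteness, followed by a normalization. An ultrafilter makes all bounded sequences
  converge at once, and makes the negation of an eventual property eventual.\<close>

definition add_subgroup :: "'a::real_vector set \<Rightarrow> bool" where
  "add_subgroup X \<longleftrightarrow> 0 \<in> X \<and> (\<forall>x\<in>X. \<forall>y\<in>X. x - y \<in> X)"

lemma add_subgroupD:
  assumes "add_subgroup X"
  shows "0 \<in> X" "x \<in> X \<Longrightarrow> y \<in> X \<Longrightarrow> x - y \<in> X"
    "x \<in> X \<Longrightarrow> - x \<in> X" "x \<in> X \<Longrightarrow> y \<in> X \<Longrightarrow> x + y \<in> X"
proof -
  show 0: "0 \<in> X" and d: "x \<in> X \<Longrightarrow> y \<in> X \<Longrightarrow> x - y \<in> X" for x y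
    using assms by (auto simp: add_subgroup_def)
  show m: "x \<in> X \<Longrightarrow> - x \<in> X" for x using d[OF 0] by force
  show "x \<in> X \<Longrightarrow> y \<in> X \<Longrightarrow> x + y \<in> X" using d[OF _ m] by force
qed

lemma add_subgroup_of_int:
  assumes "add_subgroup X" "x \<in> X"
  shows "of_int k *\<^sub>R x \<in> X"
proof -
  have n: "real n *\<^sub>R x \<in> X" for n
    by (induction n) (use assms in \<open>auto simp: add_subgroupD scaleR_add_left\<close>)
  show ?thesis
  proof (cases k)
    case (nonneg n) thus ?thesis using n[of n] by simp
  next
    case (neg n)
    have "of_int k *\<^sub>R x = - (real (Suc n) *\<^sub>R x)" by (simp only: neg of_int_minus of_int_of_nat_eq scaleR_minus_left)
    thus ?thesis using add_subgroupD(3)[OF assms(1) n[of "Suc n"]] by metis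
  qed
qed

text \<open>Sets of translates instead of a quotient group, so that indices in one vector space can
  be compared without changing types.\<close>

definition cosets :: "'a::real_vector set \<Rightarrow> 'a set \<Rightarrow> 'a set set" where
  "cosets X Y = (\<lambda>x. (+) x ` Y) ` X"

lemma coset_eq_iff:
  assumes "add_subgroup Y"
  shows "(+) x ` Y = (+) y ` Y \<longleftrightarrow> x - y \<in> Y"
proof
  assume "(+) x ` Y = (+) y ` Y"
  hence "x + 0 \<in> (+) y ` Y" using add_subgroupD(1)[OF assms] by blast
  thus "x - y \<in> Y" by auto
next
  assume *: "x - y \<in> Y"
  have "(+) a ` Y \<subseteq> (+) b ` Y" if "a - b \<in> Y" for a b
  proof
    fix z assume "z \<in> (+) a ` Y"
    then obtain u where "u \<in> Y" "z = a + u" by auto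
    hence "z = b + ((a - b) + u)" "(a - b) + u \<in> Y" using that add_subgroupD(4)[OF assms] by auto
    thus "z \<in> (+) b ` Y" by blast
  qed
  moreover have "y - x \<in> Y" using add_subgroupD(3)[OF assms *] by simp
  ultimately show "(+) x ` Y = (+) y ` Y" using * by blast
qed

text \<open>An invariant \<open>h\<close> that separates exactly the cosets of \<open>Y\<close>
  labels them; later computations of an index count such labels.\<close>

lemma cosets_bij_image:
  assumes "add_subgroup Y" "\<And>x y. x \<in> X \<Longrightarrow> y \<in> X \<Longrightarrow> h x = h y \<longleftrightarrow> x - y \<in> Y"
  obtains g where "bij_betw g (h ` X) (cosets X Y)"
proof
  let ?g = "\<lambda>v. (+) (SOME x. x \<in> X \<and> h x = v) ` Y"
  have s: "(SOME x'. x' \<in> X \<and> h x' = h x) \<in> X \<and> h (SOME x'. x' \<in> X \<and> h x' = h x) = h x" if "x \<in> X" for x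
    by (rule someI[of "\<lambda>x'. x' \<in> X \<and> h x' = h x" x]) (use that in simp)
  have g: "?g (h x) = (+) x ` Y" if "x \<in> X" for x
    unfolding coset_eq_iff[OF assms(1)]
    using s[OF that] assms(2)[of "SOME x'. x' \<in> X \<and> h x' = h x" x] that by blast
  show "bij_betw ?g (h ` X) (cosets X Y)"
  proof (rule bij_betw_imageI)
    show "inj_on ?g (h ` X)"
    proof (rule inj_onI, elim imageE)
      fix v w x y assume "?g v = ?g w" "v = h x" "x \<in> X" "w = h y" "y \<in> X"
      hence "(+) x ` Y = (+) y ` Y" using g by metis
      thus "v = w" using coset_eq_iff[OF assms(1)] assms(2) \<open>v = h x\<close> \<open>w = h y\<close> \<open>x \<in> X\<close> \<open>y \<in> X\<close> by simp
    qed
    show "?g ` h ` X = cosets X Y"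
      unfolding cosets_def image_image by (rule image_cong) (use g in auto)
  qed
qed

lemma finite_cosets_iff:
  assumes "add_subgroup Y" "\<And>x y. x \<in> X \<Longrightarrow> y \<in> X \<Longrightarrow> h x = h y \<longleftrightarrow> x - y \<in> Y"
  shows "finite (cosets X Y) \<longleftrightarrow> finite (h ` X)"
  using cosets_bij_image[OF assms] bij_betw_finite by metis

lemma card_cosets:
  assumes "add_subgroup Y" "\<And>x y. x \<in> X \<Longrightarrow> y \<in> X \<Longrightarrow> h x = h y \<longleftrightarrow> x - y \<in> Y"
  shows "card (cosets X Y) = card (h ` X)"
  using cosets_bij_image[OF assms] bij_betw_same_card by metis

lemma finite_cosets_mono:
  assumes "add_subgroup Y" "add_subgroup Z" "finite (cosets X Z)" "X' \<subseteq> X" "Z \<subseteq> Y"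
  shows "finite (cosets X' Y)"
proof -
  have "finite (cosets X' Z)" using assms(3,4) unfolding cosets_def by (meson finite_subset image_mono)
  moreover have "cosets X' Y = (\<lambda>A. (+) (SOME x. A = (+) x ` Z) ` Y) ` cosets X' Z"
    unfolding cosets_def image_image
  proof (rule image_cong)
    fix x assume "x \<in> X'"
    have "(+) x ` Z = (+) (SOME x'. (+) x ` Z = (+) x' ` Z) ` Z" by (rule someI) simp
    hence "x - (SOME x'. (+) x ` Z = (+) x' ` Z) \<in> Y" using assms(2,5) coset_eq_iff by blast
    thus "(+) x ` Y = (+) (SOME x'. (+) x ` Z = (+) x' ` Z) ` Y" using assms(1) coset_eq_iff by blast
  qed simp
  ultimately show ?thesis by simp
qed

text \<open>The tower law for indices. With a representative \<open>r x\<close> for each coset of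
  \<open>Y\<close>, a coset of \<open>Z\<close> is coded by its coset of \<open>Y\<close> and the
  coset of the remainder \<open>x - r x\<close>.\<close>

lemma card_cosets_mult:
  assumes "add_subgroup X" "add_subgroup Y" "add_subgroup Z" "Z \<subseteq> Y" "Y \<subseteq> X"
  shows "card (cosets X Z) = card (cosets X Y) * card (cosets Y Z)"
proof -
  define r where "r x = (SOME x'. x' \<in> X \<and> x - x' \<in> Y)" for x
  have r: "r x \<in> X \<and> x - r x \<in> Y" if "x \<in> X" for x
    unfolding r_def by (rule someI[of _ x]) (use that assms in \<open>auto simp: add_subgroupD\<close>)
  have req: "r x = r y" if "x - y \<in> Y" for x y
  proof -
    have "x - x' \<in> Y \<longleftrightarrow> y - x' \<in> Y" for x'
      using add_subgroupD(4)[OF assms(2), of "x - y" "y - x'"] add_subgroupD(2)[OF assms(2), of "x - x'" "x - y"] that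
      by auto
    thus ?thesis unfolding r_def by simp
  qed
  define h where "h x = ((+) x ` Y, (+) (x - r x) ` Z)" for x
  have "h x = h y \<longleftrightarrow> x - y \<in> Z" if "x \<in> X" "y \<in> X" for x y
  proof
    assume "h x = h y"
    hence "x - y \<in> Y" "(x - r x) - (y - r y) \<in> Z"
      unfolding h_def using coset_eq_iff assms(2,3) by blast+
    thus "x - y \<in> Z" using req[of x y] by simp
  next
    assume *: "x - y \<in> Z"
    hence "x - y \<in> Y" using assms by auto
    thus "h x = h y" unfolding h_def prod.inject coset_eq_iff[OF assms(2)] coset_eq_iff[OF assms(3)]
      using req[of x y] * by simp
  qed
  hence "card (cosets X Z) = card (h ` X)" by (rule card_cosets[OF assms(3)])
  also have "h ` X = cosets X Y \<times> cosets Y Z"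
  proof (intro equalityI subsetI)
    fix v assume "v \<in> h ` X"
    thus "v \<in> cosets X Y \<times> cosets Y Z" using r by (auto simp: h_def cosets_def)
  next
    fix v assume "v \<in> cosets X Y \<times> cosets Y Z"
    then obtain x y where v: "x \<in> X" "y \<in> Y" "v = ((+) x ` Y, (+) y ` Z)" by (auto simp: cosets_def)
    let ?w = "r x + y"
    have w: "?w \<in> X" using v r[of x] assms add_subgroupD(4)[OF assms(1)] by blast
    have xw: "x - ?w \<in> Y" using add_subgroupD(2)[OF assms(2), of "x - r x" y] r v by (simp add: algebra_simps)
    have "r ?w = r x" using req[OF xw] by simp
    hence "h ?w = v" unfolding h_def v(3) using coset_eq_iff[OF assms(2), of x ?w] xw by simp
    thus "v \<in> h ` X" using w by blast
  qed
  finally show ?thesis by (simp add: card_cartesian_product)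
qed

text \<open>The number of prime factors of the index, with multiplicity. An infinite index has
  \<open>card\<close> 0 and gets the value 0, which is why additivity carries a finiteness
  assumption.\<close>

definition omega_index :: "'a::real_vector set \<Rightarrow> 'a set \<Rightarrow> nat" where
  "omega_index X Y = size (prime_factorization (card (cosets X Y)))"

lemma omega_index_add:
  assumes "add_subgroup X" "add_subgroup Y" "add_subgroup Z" "Z \<subseteq> Y" "Y \<subseteq> X" "finite (cosets X Z)"
  shows "omega_index X Z = omega_index X Y + omega_index Y Z"
proof -
  have "cosets X Z \<noteq> {}" using add_subgroupD(1)[OF assms(1)] by (auto simp: cosets_def)
  hence "card (cosets X Z) \<noteq> 0" using assms(6) by auto
  hence "card (cosets X Y) \<noteq> 0" "card (cosets Y Z) \<noteq> 0"
    using card_cosets_mult[OF assms(1-5)] by auto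
  thus ?thesis unfolding omega_index_def card_cosets_mult[OF assms(1-5)]
    by (simp add: prime_factorization_mult)
qed

lemma omega_index_self: "add_subgroup X \<Longrightarrow> omega_index X X = 0"
proof -
  assume X: "add_subgroup X"
  have "card (cosets X X) = card ((\<lambda>_. ()) ` X)"
    by (rule card_cosets[OF X]) (use X in \<open>auto simp: add_subgroupD\<close>)
  also have "(\<lambda>_. ()) ` X = {()}" using add_subgroupD(1)[OF X] by auto
  finally show ?thesis by (simp add: omega_index_def)
qed

text \<open>The functionals are regarded modulo \<int>, as characters of \<open>X\<close>; this is
  their common kernel.\<close>

definition int_kernel :: "'a set \<Rightarrow> 'b set \<Rightarrow> ('b \<Rightarrow> 'a \<Rightarrow> real) \<Rightarrow> 'a set" where
  "int_kernel X J l = {x \<in> X. \<forall>j\<in>J. l j x \<in> \<int>}"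

lemma add_subgroup_int_kernel:
  assumes "add_subgroup X" "\<And>j. j \<in> J \<Longrightarrow> Modules.additive (l j)"
  shows "add_subgroup (int_kernel X J l)"
  using assms by (auto simp: add_subgroup_def int_kernel_def Modules.additive.diff Modules.additive.zero)

lemma floor_mod_eq_iff:
  fixes N :: nat and a b :: real
  assumes N: "N > 0" and a: "real N * a \<in> \<int>" and b: "real N * b \<in> \<int>"
  shows "\<lfloor>real N * a\<rfloor> mod int N = \<lfloor>real N * b\<rfloor> mod int N \<longleftrightarrow> a - b \<in> \<int>"
proof -
  obtain k l where kl: "real N * a = of_int k" "real N * b = of_int l" using a b by (auto elim!: Ints_cases)
  have d: "real N * (a - b) = of_int (k - l)" using kl by (simp add: algebra_simps)
  have "\<lfloor>real N * a\<rfloor> mod int N = \<lfloor>real N * b\<rfloor> mod int N \<longleftrightarrow> int N dvd k - l"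
    unfolding kl by (simp add: mod_eq_dvd_iff)
  also have "\<dots> \<longleftrightarrow> a - b \<in> \<int>"
  proof
    assume "int N dvd k - l"
    then obtain c where "k - l = int N * c" by auto
    hence "real N * (a - b) = real N * of_int c" using d by simp
    thus "a - b \<in> \<int>" using N by simp
  next
    assume "a - b \<in> \<int>"
    then obtain c where "a - b = of_int c" by (auto elim: Ints_cases)
    hence "of_int (int N * c) = (of_int (k - l) :: real)" using d by simp
    hence "int N * c = k - l" by (simp only: of_int_eq_iff)
    thus "int N dvd k - l" by (metis dvd_triv_left)
  qed
  finally show ?thesis .
qed

lemma additive_of_int_scale:
  fixes f :: "'a::real_vector \<Rightarrow> real"
  assumes "Modules.additive f" shows "f (of_int k *\<^sub>R z) = of_int k * f z"
proof -
  have pos: "f (real n *\<^sub>R z) = real n * f z" for n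
    by (induction n) (auto simp: Modules.additive.zero[OF assms] Modules.additive.add[OF assms] algebra_simps)
  show ?thesis
  proof (cases k)
    case (nonneg n) thus ?thesis using pos[of n] by simp
  next
    case (neg n)
    have "f (of_int k *\<^sub>R z) = f (- (real (Suc n) *\<^sub>R z))"
      by (simp only: neg of_int_minus of_int_of_nat_eq scaleR_minus_left)
    thus ?thesis using pos[of "Suc n"] by (simp add: neg Modules.additive.minus[OF assms] del: of_nat_Suc)
  qed
qed

text \<open>Clearing denominators and reducing modulo \<open>N j\<close> embeds the quotient into a
  finite product of cyclic groups.\<close>

lemma finite_cosets_int_kernel:
  fixes N :: "'b \<Rightarrow> nat"
  assumes X: "add_subgroup X" and J: "finite J" and l: "\<And>j. j \<in> J \<Longrightarrow> Modules.additive (l j)"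
    and N: "\<And>j. j \<in> J \<Longrightarrow> N j > 0" "\<And>j x. j \<in> J \<Longrightarrow> x \<in> X \<Longrightarrow> real (N j) * l j x \<in> \<int>"
  shows "finite (cosets X (int_kernel X J l))"
proof -
  define h where "h x = (\<lambda>j\<in>J. \<lfloor>real (N j) * l j x\<rfloor> mod int (N j))" for x
  have key: "\<lfloor>real (N j) * l j x\<rfloor> mod int (N j) = \<lfloor>real (N j) * l j y\<rfloor> mod int (N j) \<longleftrightarrow> l j (x - y) \<in> \<int>"
    if j: "j \<in> J" and xy: "x \<in> X" "y \<in> X" for j x y
    using floor_mod_eq_iff[OF N(1)[OF j] N(2)[OF j xy(1)] N(2)[OF j xy(2)]]
    by (simp add: Modules.additive.diff[OF l[OF j]])
  have "h x = h y \<longleftrightarrow> x - y \<in> int_kernel X J l" if "x \<in> X" "y \<in> X" for x y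
  proof -
    have "h x = h y \<longleftrightarrow> (\<forall>j\<in>J. l j (x - y) \<in> \<int>)"
      unfolding h_def using key[OF _ that] by (auto simp: fun_eq_iff restrict_def)
    thus ?thesis using that add_subgroupD(2)[OF X] by (auto simp: int_kernel_def)
  qed
  hence "finite (cosets X (int_kernel X J l)) \<longleftrightarrow> finite (h ` X)"
    by (intro finite_cosets_iff add_subgroup_int_kernel X l) auto
  moreover have "h ` X \<subseteq> (\<Pi>\<^sub>E j\<in>J. {0..<int (N j)})"
    using N(1) by (auto simp: h_def)
  hence "finite (h ` X)" by (rule finite_subset) (use J in \<open>auto intro: finite_PiE\<close>)
  ultimately show ?thesis by simp
qed

text \<open>Modulo \<int>, a nonzero element of a cyclic group of prime order generates it, so some
  multiple of \<open>a\<close> cancels \<open>b\<close>; Bezout provides it.\<close>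

lemma Ints_div_prime_cases:
  fixes a b :: real and p :: nat
  assumes p: "prime p" and a: "real p * a \<in> \<int>" "a \<notin> \<int>" and b: "real p * b \<in> \<int>"
  obtains k :: int where "b + of_int k * a \<in> \<int>"
proof -
  obtain m n where mn: "real p * a = of_int m" "real p * b = of_int n" using a(1) b by (auto elim!: Ints_cases)
  have p0: "real p > 0" using p prime_gt_0_nat by simp
  have "\<not> int p dvd m"
  proof
    assume "int p dvd m"
    then obtain c where "m = int p * c" by auto
    hence "real p * a = real p * of_int c" using mn by simp
    hence "a = of_int c" using p0 by simp
    thus False using a by simp
  qed
  hence "coprime (int p) m" using p by (simp add: prime_imp_coprime)
  then obtain u v where uv: "u * int p + v * m = 1"
    using bezout_int[of "int p" m] by (auto simp: coprime_iff_gcd_eq_1)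
  have "b + of_int (- n * v) * a = of_int (n * u)"
  proof -
    have uv': "of_int u * real p + of_int v * of_int m = 1"
      using uv by (metis of_int_1 of_int_add of_int_mult of_int_of_nat_eq)
    have "real p * (b + of_int (- n * v) * a) = of_int n - of_int n * of_int v * (real p * a)"
      using mn(2) by (simp add: algebra_simps)
    also have "\<dots> = of_int n * (1 - of_int v * of_int m)" unfolding mn by (simp add: algebra_simps)
    also have "1 - of_int v * of_int m = of_int u * real p" using uv' by linarith
    finally have "real p * (b + of_int (- n * v) * a) = real p * of_int (n * u)" by simp
    thus ?thesis using p0 by simp
  qed
  hence "b + of_int (- n * v) * a \<in> \<int>" by simp
  thus ?thesis by (rule that)
qed

text \<open>Modulo \<int> the functional maps \<open>Y\<close> into a group of prime order
  \<open>q\<close>, so the kernel has index 1 or \<open>q\<close>.\<close>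

lemma omega_index_prime_step:
  fixes f :: "'a::real_vector \<Rightarrow> real" and q :: nat
  assumes Y: "add_subgroup Y" and f: "Modules.additive f" and q: "prime q" and fY: "\<And>y. y \<in> Y \<Longrightarrow> real q * f y \<in> \<int>"
  shows "omega_index Y {y \<in> Y. f y \<in> \<int>} \<le> 1"
proof (cases "\<exists>y\<in>Y. f y \<notin> \<int>")
  case False
  hence "{y \<in> Y. f y \<in> \<int>} = Y" by auto
  thus ?thesis using omega_index_self[OF Y] by simp
next
  case True
  then obtain y0 where y0: "y0 \<in> Y" "f y0 \<notin> \<int>" by auto
  have q0: "q > 0" using q prime_gt_0_nat by simp
  have sub: "add_subgroup {y \<in> Y. f y \<in> \<int>}"
    using Y by (auto simp: add_subgroup_def Modules.additive.diff[OF f] Modules.additive.zero[OF f])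
  define h where "h y = \<lfloor>real q * f y\<rfloor> mod int q" for y
  have hh: "h x = h y \<longleftrightarrow> x - y \<in> {y \<in> Y. f y \<in> \<int>}" if xy: "x \<in> Y" "y \<in> Y" for x y
    using floor_mod_eq_iff[OF q0 fY[OF xy(1)] fY[OF xy(2)]] xy add_subgroupD(2)[OF Y]
    by (simp add: h_def Modules.additive.diff[OF f])
  have "h ` Y = {0..<int q}"
  proof (intro equalityI subsetI)
    fix v assume "v \<in> {0..<int q}"
    have "real q * (- of_int v / real q) \<in> \<int>" using q0 by simp
    then obtain k where k: "- of_int v / real q + of_int k * f y0 \<in> \<int>"
      using Ints_div_prime_cases[OF q fY[OF y0(1)] y0(2)] by blast
    let ?y = "of_int k *\<^sub>R y0"
    have y: "?y \<in> Y" by (rule add_subgroup_of_int[OF Y y0(1)])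
    have fy: "f ?y = of_int k * f y0" by (rule additive_of_int_scale[OF f])
    obtain c where c: "- of_int v / real q + of_int k * f y0 = of_int c" using k by (auto elim: Ints_cases)
    have "f ?y = of_int c + of_int v / real q" using c fy by simp
    hence "real q * f ?y = of_int (int q * c + v)" using q0 by (simp add: field_simps)
    hence "h ?y = (int q * c + v) mod int q" unfolding h_def by (metis floor_of_int)
    also have "\<dots> = v" using \<open>v \<in> {0..<int q}\<close> by simp
    finally show "v \<in> h ` Y" using y by blast
  qed (use q0 in \<open>auto simp: h_def\<close>)
  hence "card (cosets Y {y \<in> Y. f y \<in> \<int>}) = q" using card_cosets[OF sub hh] by simp
  thus ?thesis unfolding omega_index_def using q by (simp add: prime_factorization_prime)
qed

section \<open>Irredundant covers by residue classes\<close>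

lemma Ints_add_cancel: "(b::real) \<in> \<int> \<Longrightarrow> a + b \<in> \<int> \<longleftrightarrow> a \<in> \<int>"
  using Ints_diff[of "a + b" b] Ints_add[of a b] by auto

lemma irredundant_subcover:
  assumes "finite J" "X \<subseteq> (\<Union>j\<in>J. W j)"
  obtains J' where "J' \<subseteq> J" "X \<subseteq> (\<Union>j\<in>J'. W j)" "\<forall>j\<in>J'. \<not> X \<subseteq> (\<Union>i\<in>J' - {j}. W i)"
proof -
  let ?P = "\<lambda>J'. J' \<subseteq> J \<and> X \<subseteq> (\<Union>j\<in>J'. W j)"
  obtain J' where J': "?P J'" "\<And>K. ?P K \<Longrightarrow> card J' \<le> card K"
    using ex_has_least_nat[of ?P J card] assms(2) by blast
  have "\<not> X \<subseteq> (\<Union>i\<in>J' - {j}. W i)" if "j \<in> J'" for j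
  proof
    assume "X \<subseteq> (\<Union>i\<in>J' - {j}. W i)"
    hence "card J' \<le> card (J' - {j})" using J' by blast
    moreover have "finite J'" using J'(1) assms(1) finite_subset by blast
    ultimately show False using that card_Diff1_less by (metis not_less)
  qed
  with J'(1) show ?thesis by (intro that[of J']) auto
qed

text \<open>The pullback along \<open>f\<close> of a coset of the subgroup of order \<open>p\<close>
  of \<real>/\<int> with the class of \<open>c\<close> removed. In a rational tiling, a piece
  centred at 0 expresses that a coordinate is divisible by some number but not by \<open>p\<close>
  times that number.\<close>

definition cover_piece :: "nat \<Rightarrow> real \<Rightarrow> ('a \<Rightarrow> real) \<Rightarrow> 'a set" where
  "cover_piece p c f = {x. real p * (f x - c) \<in> \<int> \<and> f x - c \<notin> \<int>}"

text \<open>For \<open>p = 2\<close> a single class survives the removal, so a plain residue class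
  is also a piece, with its centre shifted by 1/2.\<close>

lemma cover_piece_single: "cover_piece 2 (c + 1/2) f = {x. f x - c \<in> \<int>}"
proof -
  have "2 * (t - 1/2) \<in> \<int> \<and> t - 1/2 \<notin> \<int> \<longleftrightarrow> t \<in> \<int>" for t :: real
  proof
    assume a: "2 * (t - 1/2) \<in> \<int> \<and> t - 1/2 \<notin> \<int>"
    obtain k where k: "2 * (t - 1/2) = of_int k" using conjunct1[OF a] by (rule Ints_cases)
    show "t \<in> \<int>"
    proof (cases "even k")
      case True
      then obtain m where "k = 2 * m" by auto
      hence "t - 1/2 = of_int m" using k by simp
      thus ?thesis using a by simp
    next
      case False
      then obtain m where "k = 2 * m + 1" by (auto elim: oddE)
      hence "t = of_int (m + 1)" using k by simp
      thus ?thesis by (metis Ints_of_int)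
    qed
  next
    assume "t \<in> \<int>"
    then obtain m where m: "t = of_int m" by (auto elim: Ints_cases)
    have "2 * (t - 1/2) = of_int (2 * m - 1)" unfolding m by simp
    moreover have "t - 1/2 \<notin> \<int>"
    proof
      assume "t - 1/2 \<in> \<int>"
      then obtain j where "t - 1/2 = of_int j" by (auto elim: Ints_cases)
      hence "(of_int (2 * m - 1) :: real) = of_int (2 * j)" using m by simp
      hence "2 * m - 1 = 2 * j" by (simp only: of_int_eq_iff)
      thus False by presburger
    qed
    ultimately show "2 * (t - 1/2) \<in> \<int> \<and> t - 1/2 \<notin> \<int>" by (metis Ints_of_int)
  qed
  from this[of "f _ - c"] show ?thesis unfolding cover_piece_def by (auto simp: algebra_simps)
qed

lemma additive_mult: "Modules.additive f \<Longrightarrow> Modules.additive (\<lambda>x. (c::real) * f x)"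
  by (auto simp: Modules.additive_def algebra_simps)

text \<open>Multiplying the functional by \<open>q\<close> enlarges a piece to a piece of the same kind;
  for \<open>q = p\<close> it becomes a single residue class, which is a piece for the prime 2.\<close>

lemma cover_piece_power:
  assumes "prime p" "prime q"
  obtains p' c' where "prime p'" "cover_piece p c f \<subseteq> cover_piece p' c' (\<lambda>x. real q * f x)"
proof (cases "q = p")
  case True
  have "cover_piece p c f \<subseteq> cover_piece 2 (real q * c + 1/2) (\<lambda>x. real q * f x)"
    unfolding cover_piece_single using True by (auto simp: cover_piece_def algebra_simps)
  thus ?thesis using that two_is_prime_nat by blast
next
  case False
  hence cop: "coprime (int q) (int p)" using assms by (simp add: primes_coprime)
  then obtain u v where uv: "u * int q + v * int p = 1"
    using bezout_int[of "int q" "int p"] by (auto simp: coprime_iff_gcd_eq_1)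
  have "cover_piece p c f \<subseteq> cover_piece p (real q * c) (\<lambda>x. real q * f x)"
  proof
    fix x assume "x \<in> cover_piece p c f"
    hence x: "real p * (f x - c) \<in> \<int>" "f x - c \<notin> \<int>" by (auto simp: cover_piece_def)
    let ?t = "f x - c"
    have "real p * (real q * f x - real q * c) = real q * (real p * ?t)" by (simp add: algebra_simps)
    hence 1: "real p * (real q * f x - real q * c) \<in> \<int>" using x(1) by (metis Ints_mult Ints_of_nat)
    have "real q * f x - real q * c \<notin> \<int>"
    proof
      assume a: "real q * f x - real q * c \<in> \<int>"
      have uv': "of_int u * real q + of_int v * real p = 1"
        using uv by (metis of_int_1 of_int_add of_int_mult of_int_of_nat_eq)
      have "?t = (of_int u * real q + of_int v * real p) * ?t" unfolding uv' by simp
      also have "\<dots> = of_int u * (real q * f x - real q * c) + of_int v * (real p * ?t)"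
        by (simp add: algebra_simps)
      finally have e: "?t = of_int u * (real q * f x - real q * c) + of_int v * (real p * ?t)" .
      have "of_int u * (real q * f x - real q * c) + of_int v * (real p * ?t) \<in> \<int>"
        by (intro Ints_add Ints_mult a x(1) Ints_of_int)
      thus False using x(2) e by metis
    qed
    thus "x \<in> cover_piece p (real q * c) (\<lambda>x. real q * f x)" using 1 by (simp add: cover_piece_def)
  qed
  thus ?thesis using that assms by blast
qed

text \<open>A point \<open>x0\<close> covered by piece \<open>j\<close> alone can be moved by
  multiples of \<open>y\<close> without entering another piece, since the other functionals do not
  change modulo \<int>. So these translates all stay in piece \<open>j\<close>; if
  \<open>l j y\<close> were not an integer, one of them would reach the class that the piece
  omits.\<close>

lemma irredundant_kernel:
  assumes X: "add_subgroup X" and l: "\<And>j. j \<in> J \<Longrightarrow> Modules.additive (l j)" and p: "prime (p j)"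
    and j: "j \<in> J" and cov: "X \<subseteq> (\<Union>j\<in>J. cover_piece (p j) (c j) (l j))"
    and irr: "\<not> X \<subseteq> (\<Union>i\<in>J - {j}. cover_piece (p i) (c i) (l i))"
    and y: "y \<in> int_kernel X (J - {j}) l"
  shows "l j y \<in> \<int>"
proof (rule ccontr)
  assume ny: "l j y \<notin> \<int>"
  obtain x0 where x0: "x0 \<in> X" "\<And>i. i \<in> J - {j} \<Longrightarrow> x0 \<notin> cover_piece (p i) (c i) (l i)"
    using irr by blast
  have *: "x0 + of_int k *\<^sub>R y \<in> cover_piece (p j) (c j) (l j)" for k
  proof -
    have "x0 + of_int k *\<^sub>R y \<in> X"
      using add_subgroupD(4)[OF X x0(1) add_subgroup_of_int[OF X]] y by (simp add: int_kernel_def)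
    moreover have "x0 + of_int k *\<^sub>R y \<notin> cover_piece (p i) (c i) (l i)" if i: "i \<in> J - {j}" for i
    proof -
      have "l i y \<in> \<int>" using y i by (auto simp: int_kernel_def)
      hence ky: "of_int k * l i y \<in> \<int>" by simp
      have e: "l i (x0 + of_int k *\<^sub>R y) - c i = (l i x0 - c i) + of_int k * l i y"
        using l[of i] i by (simp add: Modules.additive.add additive_of_int_scale)
      have "real (p i) * (l i (x0 + of_int k *\<^sub>R y) - c i) = real (p i) * (l i x0 - c i) + real (p i) * (of_int k * l i y)"
        unfolding e by (simp add: algebra_simps)
      moreover have "real (p i) * (of_int k * l i y) \<in> \<int>" by (rule Ints_mult[OF Ints_of_nat ky])
      ultimately have "real (p i) * (l i (x0 + of_int k *\<^sub>R y) - c i) \<in> \<int> \<longleftrightarrow> real (p i) * (l i x0 - c i) \<in> \<int>"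
        by (simp only: Ints_add_cancel)
      moreover have "l i (x0 + of_int k *\<^sub>R y) - c i \<in> \<int> \<longleftrightarrow> l i x0 - c i \<in> \<int>"
        unfolding e using ky by (rule Ints_add_cancel)
      ultimately show ?thesis using x0(2)[OF i] by (simp add: cover_piece_def)
    qed
    ultimately show ?thesis using cov by blast
  qed
  have e: "l j (x0 + of_int k *\<^sub>R y) - c j = (l j x0 - c j) + of_int k * l j y" for k
    using l[OF j] by (simp add: Modules.additive.add additive_of_int_scale)
  have b: "real (p j) * (l j x0 - c j) \<in> \<int>" using *[of 0] by (simp add: cover_piece_def)
  have "real (p j) * (l j x0 - c j) + real (p j) * l j y \<in> \<int>"
    using *[of 1] e[of 1] by (simp add: cover_piece_def algebra_simps)
  hence a: "real (p j) * l j y \<in> \<int>" using b by (metis Ints_diff add_diff_cancel_left')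
  obtain k where "(l j x0 - c j) + of_int k * l j y \<in> \<int>"
    using Ints_div_prime_cases[OF p a ny b] by blast
  thus False using *[of k] e[of k] by (simp add: cover_piece_def)
qed

lemma cover_piece_shift:
  assumes "l x \<in> \<int>" "Modules.additive l"
  shows "a + x \<in> cover_piece p c l \<longleftrightarrow> a \<in> cover_piece p c l"
proof -
  have e: "l (a + x) - c = (l a - c) + l x"
    using assms(2) by (simp add: Modules.additive.add)
  have "real p * (l (a + x) - c) = real p * (l a - c) + real p * l x"
    unfolding e by (simp add: algebra_simps)
  moreover have "real p * l x \<in> \<int>" using assms(1) by (intro Ints_mult) auto
  ultimately have "real p * (l (a + x) - c) \<in> \<int> \<longleftrightarrow> real p * (l a - c) \<in> \<int>"
    by (simp only: Ints_add_cancel)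
  moreover have "l (a + x) - c \<in> \<int> \<longleftrightarrow> l a - c \<in> \<int>"
    unfolding e using assms(1) by (rule Ints_add_cancel)
  ultimately show ?thesis by (simp add: cover_piece_def)
qed

text \<open>The key step of Hajos's theorem: an irredundant cover by \<open>s\<close> pieces factors through a
  quotient whose order has fewer than \<open>s\<close> prime factors. A functional that is lowered to a multiple
  either keeps the cover irredundant, or leaves a smaller subcover; in the second case one passes
  to a coset that misses the pieces used so far.\<close>

theorem irredundant_cover_index:
  fixes X :: "'a::real_vector set" and N :: "'b \<Rightarrow> nat"
  assumes "add_subgroup X" "finite J" "\<And>j. j \<in> J \<Longrightarrow> Modules.additive (l j)" "\<And>j. j \<in> J \<Longrightarrow> prime (p j)"
    "\<And>j. j \<in> J \<Longrightarrow> N j > 0" "\<And>j x. j \<in> J \<Longrightarrow> x \<in> X \<Longrightarrow> real (N j) * l j x \<in> \<int>"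
    "X \<subseteq> (\<Union>j\<in>J. cover_piece (p j) (c j) (l j))"
    "\<And>j. j \<in> J \<Longrightarrow> \<not> X \<subseteq> (\<Union>i\<in>J - {j}. cover_piece (p i) (c i) (l i))"
  shows "omega_index X (int_kernel X J l) + 1 \<le> card J"
  using assms
proof (induction "sum N J" arbitrary: X J l N p c rule: less_induct)
  case less
  note X = less.prems(1) and J = less.prems(2) and l = less.prems(3) and p = less.prems(4)
    and N = less.prems(5,6) and cov = less.prems(7) and irr = less.prems(8)
  have "J \<noteq> {}" using cov add_subgroupD(1)[OF X] by auto
  then obtain j where j: "j \<in> J" by auto
  \<comment> \<open>By irredundancy the functional \<open>j\<close> imposes no further condition;
    for a single piece this is already the bound.\<close>
  have kerJ: "int_kernel X (J - {j}) l = int_kernel X J l"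
  proof
    show "int_kernel X (J - {j}) l \<subseteq> int_kernel X J l"
    proof
      fix y assume y: "y \<in> int_kernel X (J - {j}) l"
      have "l j y \<in> \<int>" by (rule irredundant_kernel[OF X l p[OF j] j cov irr[OF j] y])
      thus "y \<in> int_kernel X J l" using y by (auto simp: int_kernel_def)
    qed
  qed (auto simp: int_kernel_def)
  have subX: "add_subgroup (int_kernel X I l)" if "I \<subseteq> J" for I
    by (rule add_subgroup_int_kernel[OF X]) (use that l in auto)
  have finX: "finite (cosets X (int_kernel X I l))" if "I \<subseteq> J" for I
    by (rule finite_cosets_int_kernel[OF X finite_subset[OF that J], where N=N]) (use that l N in auto)
  show ?case
  proof (cases "J = {j}")
    case True
    hence "int_kernel X J l = X" using kerJ by (auto simp: int_kernel_def)
    thus ?thesis using omega_index_self[OF X] True by simp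
  next
    case False
    then obtain i where i: "i \<in> J" "i \<noteq> j" using j by auto
    \<comment> \<open>A functional that is integral on \<open>X\<close> would make piece
      \<open>j\<close> all of \<open>X\<close> and the other pieces redundant. So \<open>N j\<close>
      has a prime factor that can be divided out.\<close>
    have "N j \<noteq> 1"
    proof
      assume N1: "N j = 1"
      obtain x0 where "x0 \<in> X" "x0 \<notin> (\<Union>i\<in>J - {j}. cover_piece (p i) (c i) (l i))" using irr[OF j] by blast
      hence x0: "x0 \<in> X" "x0 \<in> cover_piece (p j) (c j) (l j)" using cov by blast+
      have "x \<in> cover_piece (p j) (c j) (l j)" if x: "x \<in> X" for x
      proof -
        have "l j (x - x0) \<in> \<int>" using N(2)[OF j, of "x - x0"] N1 add_subgroupD(2)[OF X x x0(1)] by simp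
        from cover_piece_shift[of "l j" "x - x0" x0, OF this l[OF j]] show ?thesis using x0(2) by simp
      qed
      hence "X \<subseteq> (\<Union>i'\<in>J - {i}. cover_piece (p i') (c i') (l i'))" using i j by blast
      thus False using irr[OF i(1)] by blast
    qed
    then obtain q where q: "prime q" "q dvd N j" using prime_factor_nat by blast
    obtain p' c' where pc: "prime p'" "cover_piece (p j) (c j) (l j) \<subseteq> cover_piece p' c' (\<lambda>x. real q * l j x)"
      using cover_piece_power[OF p[OF j] q(1)] by blast
    define l' where "l' = l(j := \<lambda>x. real q * l j x)"
    define N' where "N' = N(j := N j div q)"
    define pp where "pp = p(j := p')"
    define cc where "cc = c(j := c')"
    have N'j: "N j div q > 0" "N j div q < N j"
    proof -
      show "N j div q > 0" using q N(1)[OF j] by (metis dvd_div_eq_0_iff gr0I less_numeral_extra(3))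
      show "N j div q < N j" using q(1) N(1)[OF j] prime_gt_1_nat by (intro div_less_dividend) auto
    qed
    have cov': "X \<subseteq> (\<Union>j\<in>J. cover_piece (pp j) (cc j) (l' j))"
    proof
      fix x assume "x \<in> X"
      then obtain i where "i \<in> J" "x \<in> cover_piece (p i) (c i) (l i)" using cov by blast
      thus "x \<in> (\<Union>j\<in>J. cover_piece (pp j) (cc j) (l' j))"
        using pc(2) by (cases "i = j") (auto simp: pp_def cc_def l'_def)
    qed
    obtain J' where J': "J' \<subseteq> J"
      "X \<subseteq> (\<Union>j\<in>J'. cover_piece (pp j) (cc j) (l' j))"
      "\<forall>j\<in>J'. \<not> X \<subseteq> (\<Union>i\<in>J' - {j}. cover_piece (pp i) (cc i) (l' i))"
      by (rule irredundant_subcover[OF J cov'])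
    \<comment> \<open>Only piece \<open>j\<close> was enlarged, so a subcover without it would
      contradict the irredundancy of the original cover.\<close>
    have jJ': "j \<in> J'"
    proof (rule ccontr)
      assume nj: "j \<notin> J'"
      have "X \<subseteq> (\<Union>i\<in>J - {j}. cover_piece (p i) (c i) (l i))"
      proof
        fix x assume "x \<in> X"
        then obtain i where "i \<in> J'" "x \<in> cover_piece (pp i) (cc i) (l' i)" using J'(2) by blast
        moreover from this nj have "i \<noteq> j" by auto
        ultimately show "x \<in> (\<Union>i\<in>J - {j}. cover_piece (p i) (c i) (l i))"
          using J'(1) by (auto simp: pp_def cc_def l'_def)
      qed
      thus False using irr[OF j] by blast
    qed
    have "sum N' J' \<le> sum N' J" by (rule sum_mono2) (use J J' in auto)
    also have "\<dots> < sum N J"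
      by (rule sum_strict_mono_ex1[OF J]) (use j N'j in \<open>auto simp: N'_def\<close>)
    finally have "sum N' J' < sum N J" .
    moreover have l': "Modules.additive (l' i)" if "i \<in> J'" for i
      using that J'(1) l[of i] additive_mult[OF l[OF j]] by (cases "i = j") (auto simp: l'_def)
    moreover have "prime (pp i)" "N' i > 0" if "i \<in> J'" for i
      using that J'(1) p[of i] pc(1) N(1)[of i] N'j by (auto simp: pp_def N'_def)
    moreover have N'l': "real (N' i) * l' i x \<in> \<int>" if "i \<in> J'" "x \<in> X" for i x
    proof (cases "i = j")
      case True
      have "real (N' j) * l' j x = real (N j div q * q) * l j x" by (simp add: N'_def l'_def)
      thus ?thesis using True N(2)[OF j that(2)] q(2) by simp
    next
      case False thus ?thesis using N(2)[of i x] that J'(1) by (auto simp: N'_def l'_def)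
    qed
    ultimately have IH1: "omega_index X (int_kernel X J' l') + 1 \<le> card J'"
      by (intro less.hyps[where N=N' and p=pp and c=cc] X finite_subset[OF J'(1) J] J'(2) J'(3)[rule_format])
    show ?thesis
    proof (cases "J' = J")
      case True
      \<comment> \<open>On the kernel of the other functionals \<open>l j\<close> is integral
        anyway, so weakening it to a multiple loses nothing.\<close>
      have "int_kernel X J l' = int_kernel X J l"
      proof
        have "int_kernel X J l' \<subseteq> int_kernel X (J - {j}) l" by (auto simp: int_kernel_def l'_def)
        thus "int_kernel X J l' \<subseteq> int_kernel X J l" using kerJ by simp
        show "int_kernel X J l \<subseteq> int_kernel X J l'" by (auto simp: int_kernel_def l'_def)
      qed
      thus ?thesis using IH1 True by simp
    next
      case J'J: False
      have subX': "add_subgroup (int_kernel X J' l')"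
        by (rule add_subgroup_int_kernel[OF X]) (use l' in auto)
      have step: "int_kernel X J' l = {y \<in> int_kernel X J' l'. l j y \<in> \<int>}"
        using jJ' by (auto simp: int_kernel_def l'_def)
      \<comment> \<open>Undoing the multiplication by \<open>q\<close> costs at most one prime
        factor, just the 1 that the induction hypothesis leaves over.\<close>
      have "omega_index (int_kernel X J' l') (int_kernel X J' l) \<le> 1"
        unfolding step
        by (rule omega_index_prime_step[OF subX' l[OF j] q(1)]) (use jJ' in \<open>auto simp: int_kernel_def l'_def\<close>)
      moreover have "omega_index X (int_kernel X J' l) =
          omega_index X (int_kernel X J' l') + omega_index (int_kernel X J' l') (int_kernel X J' l)"
        by (rule omega_index_add[OF X subX' subX[OF J'(1)] _ _ finX[OF J'(1)]])
          (use step in \<open>simp_all add: int_kernel_def\<close>, blast+)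
      ultimately have omJ': "omega_index X (int_kernel X J' l) \<le> card J'" using IH1 by simp
      \<comment> \<open>Proper subfamilies that satisfy the bound without the extra 1.
        \<open>J'\<close> is one of them; a largest one is taken and extended by pieces that cover a
        coset of its kernel.\<close>
      define P where "P I \<longleftrightarrow> I \<subseteq> J \<and> I \<noteq> J \<and> I \<noteq> {} \<and> omega_index X (int_kernel X I l) \<le> card I" for I
      have "P J'" unfolding P_def using J'(1) J'J jJ' omJ' by (intro conjI) (assumption | blast)+
      moreover have "\<forall>I. P I \<longrightarrow> card I < card J" unfolding P_def using psubset_card_mono[OF J] by blast
      ultimately obtain I where I: "P I" "\<And>I'. P I' \<Longrightarrow> card I' \<le> card I"
        using ex_has_greatest_nat[of P J' card "card J"] by metis
      have IJ: "I \<subseteq> J" "I \<noteq> J" "I \<noteq> {}" "omega_index X (int_kernel X I l) \<le> card I" using I(1) by (auto simp: P_def)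
      have finI: "finite I" by (rule finite_subset[OF IJ(1) J])
      obtain j' where j': "j' \<in> J" "j' \<notin> I" using IJ by auto
      hence "(\<Union>i\<in>I. cover_piece (p i) (c i) (l i)) \<subseteq> (\<Union>i\<in>J - {j'}. cover_piece (p i) (c i) (l i))"
        using IJ(1) by (intro UN_mono) auto
      hence "\<not> X \<subseteq> (\<Union>i\<in>I. cover_piece (p i) (c i) (l i))" using irr[OF j'(1)] by (meson subset_trans)
      then obtain x0 where "x0 \<in> X" "x0 \<notin> (\<Union>i\<in>I. cover_piece (p i) (c i) (l i))" by (meson subsetI)
      hence x0: "x0 \<in> X" "\<And>i. i \<in> I \<Longrightarrow> x0 \<notin> cover_piece (p i) (c i) (l i)" by (meson UN_I)+
      \<comment> \<open>On the coset \<open>x0 + ?K\<close> the functionals in \<open>I\<close> are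
        constant modulo \<int> and \<open>x0\<close> avoids their pieces, so the pieces outside
        \<open>I\<close> must cover it. Moving the coset back to \<open>?K\<close> changes the
        centres to \<open>c2\<close>.\<close>
      let ?K = "int_kernel X I l"
      define c2 where "c2 i = c i - l i x0" for i
      have covK: "?K \<subseteq> (\<Union>i\<in>J - I. cover_piece (p i) (c2 i) (l i))"
      proof
        fix y assume y: "y \<in> ?K"
        hence "y \<in> X" by (simp add: int_kernel_def)
        hence "x0 + y \<in> (\<Union>j\<in>J. cover_piece (p j) (c j) (l j))" by (rule subsetD[OF cov add_subgroupD(4)[OF X x0(1)]])
        then obtain i where i: "i \<in> J" "x0 + y \<in> cover_piece (p i) (c i) (l i)" by (rule UN_E)
        have "i \<notin> I"
        proof
          assume iI: "i \<in> I"
          hence "l i y \<in> \<int>" using y by (auto simp: int_kernel_def)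
          from cover_piece_shift[OF this l[OF i(1)]] show False using i(2) x0(2)[OF iI] by simp
        qed
        moreover have "y \<in> cover_piece (p i) (c2 i) (l i)"
        proof -
          have "l i (x0 + y) - c i = l i y - c2 i"
            unfolding Modules.additive.add[OF l[OF i(1)]] c2_def by simp
          thus ?thesis using i(2) by (simp add: cover_piece_def)
        qed
        ultimately show "y \<in> (\<Union>i\<in>J - I. cover_piece (p i) (c2 i) (l i))" using i(1) by blast
      qed
      obtain J2 where J2: "J2 \<subseteq> J - I"
        "?K \<subseteq> (\<Union>j\<in>J2. cover_piece (p j) (c2 j) (l j))"
        "\<forall>j\<in>J2. \<not> ?K \<subseteq> (\<Union>i\<in>J2 - {j}. cover_piece (p i) (c2 i) (l i))"
        by (rule irredundant_subcover[OF finite_Diff[OF J] covK])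
      have finJ2: "finite J2" by (rule finite_subset[OF J2(1) finite_Diff[OF J]])
      have "J2 \<noteq> {}" using J2(2) add_subgroupD(1)[OF subX[OF IJ(1)]] by auto
      have "0 < sum N I" by (rule sum_pos[OF finI IJ(3)]) (rule N(1)[OF subsetD[OF IJ(1)]])
      moreover have "sum N (J2 \<union> I) = sum N J2 + sum N I"
        by (rule sum.union_disjoint[OF finJ2 finI]) (use J2(1) in blast)
      ultimately have "sum N J2 < sum N (J2 \<union> I)" by simp
      also have "\<dots> \<le> sum N J" by (rule sum_mono2[OF J]) (use J2(1) IJ(1) in auto)
      finally have lt: "sum N J2 < sum N J" .
      have J2J: "i \<in> J" if "i \<in> J2" for i using J2(1) that by blast
      have KX: "x \<in> X" if "x \<in> ?K" for x using that by (simp add: int_kernel_def)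
      have "omega_index ?K (int_kernel ?K J2 l) + 1 \<le> card J2"
        by (rule less.hyps[OF lt subX[OF IJ(1)] finJ2 l[OF J2J] p[OF J2J] N(1)[OF J2J] N(2)[OF J2J KX] J2(2) J2(3)[rule_format]])
      moreover have KK: "int_kernel ?K J2 l = int_kernel X (I \<union> J2) l" by (auto simp: int_kernel_def)
      moreover have IJ2: "I \<union> J2 \<subseteq> J" using IJ(1) J2(1) by blast
      have "omega_index X (int_kernel X (I \<union> J2) l) = omega_index X ?K + omega_index ?K (int_kernel X (I \<union> J2) l)"
        by (rule omega_index_add[OF X subX[OF IJ(1)] subX[OF IJ2] _ _ finX[OF IJ2]]) (auto simp: int_kernel_def)
      moreover have cIJ: "card (I \<union> J2) = card I + card J2"
        by (rule card_Un_disjoint[OF finI finJ2]) (use J2(1) in blast)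
      \<comment> \<open>The 1 gained for \<open>J2\<close> turns the weak bound for \<open>I\<close>
        into the strict one for the union.\<close>
      ultimately have om: "omega_index X (int_kernel X (I \<union> J2) l) + 1 \<le> card (I \<union> J2)" using IJ(4) by simp
      show ?thesis
      proof (cases "I \<union> J2 = J")
        case True thus ?thesis using om by simp
      next
        \<comment> \<open>Otherwise the union is a larger proper subfamily with property
          \<open>P\<close>, against the choice of \<open>I\<close>.\<close>
        case False
        hence "P (I \<union> J2)" unfolding P_def using om IJ2 IJ(3) by simp
        hence "card (I \<union> J2) \<le> card I" by (rule I(2))
        moreover have "card J2 > 0" using \<open>J2 \<noteq> {}\<close> finJ2 by (simp add: card_gt_0_iff)
        ultimately show ?thesis using cIJ by simp
      qed
    qed
  qed
qed

section \<open>Consequences of the index bound for pairs of subgroups\<close>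

lemma cover_index:
  fixes X :: "'a::real_vector set" and N :: "'b \<Rightarrow> nat"
  assumes X: "add_subgroup X" and J: "finite J"
    and l: "\<And>j. j \<in> J \<Longrightarrow> Modules.additive (l j)" and p: "\<And>j. j \<in> J \<Longrightarrow> prime (p j)"
    and N: "\<And>j. j \<in> J \<Longrightarrow> N j > 0" "\<And>j x. j \<in> J \<Longrightarrow> x \<in> X \<Longrightarrow> real (N j) * l j x \<in> \<int>"
    and cov: "X \<subseteq> (\<Union>j\<in>J. cover_piece (p j) (c j) (l j))"
  obtains I where "I \<subseteq> J" "X \<subseteq> (\<Union>j\<in>I. cover_piece (p j) (c j) (l j))"
    "omega_index X (int_kernel X I l) + 1 \<le> card I"
proof -
  obtain I where I: "I \<subseteq> J" "X \<subseteq> (\<Union>j\<in>I. cover_piece (p j) (c j) (l j))"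
    "\<forall>j\<in>I. \<not> X \<subseteq> (\<Union>i\<in>I - {j}. cover_piece (p i) (c i) (l i))"
    by (rule irredundant_subcover[OF J cov])
  have IJ: "i \<in> J" if "i \<in> I" for i using I(1) that by blast
  have "omega_index X (int_kernel X I l) + 1 \<le> card I"
    by (rule irredundant_cover_index[OF X finite_subset[OF I(1) J] l[OF IJ] p[OF IJ] N(1)[OF IJ] N(2)[OF IJ]
          I(2) I(3)[rule_format]])
  thus ?thesis by (rule that[OF I(1,2)])
qed

text \<open>The class where \<open>f\<close> is integral enters as a piece for the prime 2 with
  index \<open>None\<close>. Pieces centred at 0 miss the origin, so this class belongs to every
  subcover; leaving it out of the count removes the 1 from the bound.\<close>

lemma cover_index_class:
  fixes X :: "'a::real_vector set" and N :: "'b \<Rightarrow> nat"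
  assumes X: "add_subgroup X" and B: "finite B"
    and l: "\<And>j. j \<in> B \<Longrightarrow> Modules.additive (l j)" and p: "\<And>j. j \<in> B \<Longrightarrow> prime (p j)"
    and N: "\<And>j. j \<in> B \<Longrightarrow> N j > 0" "\<And>j x. j \<in> B \<Longrightarrow> x \<in> X \<Longrightarrow> real (N j) * l j x \<in> \<int>"
    and f: "Modules.additive f" "M > 0" "\<And>x. x \<in> X \<Longrightarrow> real M * f x \<in> \<int>"
    and cov: "X \<subseteq> {x. f x \<in> \<int>} \<union> (\<Union>j\<in>B. cover_piece (p j) 0 (l j))"
  obtains R where "R \<subseteq> B" "X \<subseteq> {x. f x \<in> \<int>} \<union> (\<Union>j\<in>R. cover_piece (p j) 0 (l j))"
    "omega_index X {x \<in> X. f x \<in> \<int> \<and> (\<forall>i\<in>R. l i x \<in> \<int>)} \<le> card R"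
proof -
  define l' where "l' = case_option f l"
  define p' where "p' = case_option 2 p"
  define c' where "c' = case_option (0 + 1/2) (\<lambda>_::'b. 0 :: real)"
  define N' where "N' = case_option M N"
  let ?J = "insert None (Some ` B)"
  have piece: "cover_piece (p' None) (c' None) (l' None) = {x. f x \<in> \<int>}"
    "cover_piece (p' (Some i)) (c' (Some i)) (l' (Some i)) = cover_piece (p i) 0 (l i)" for i
    unfolding l'_def p'_def c'_def option.case cover_piece_single by simp_all
  have un: "(\<Union>j\<in>insert None (Some ` R). cover_piece (p' j) (c' j) (l' j)) =
      {x. f x \<in> \<int>} \<union> (\<Union>j\<in>R. cover_piece (p j) 0 (l j))" for R
    by (simp add: piece)
  have J: "finite ?J" using B by simp
  have cov': "X \<subseteq> (\<Union>j\<in>?J. cover_piece (p' j) (c' j) (l' j))" unfolding un by (rule cov)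
  obtain I where I: "I \<subseteq> ?J" "X \<subseteq> (\<Union>j\<in>I. cover_piece (p' j) (c' j) (l' j))"
    "omega_index X (int_kernel X I l') + 1 \<le> card I"
  proof (rule cover_index[OF X J, where l=l' and p=p' and N=N' and c=c'])
    show "Modules.additive (l' j)" if "j \<in> ?J" for j using that f l by (auto simp: l'_def)
    show "prime (p' j)" if "j \<in> ?J" for j using that p by (auto simp: p'_def)
    show "N' j > 0" if "j \<in> ?J" for j using that f N by (auto simp: N'_def)
    show "real (N' j) * l' j x \<in> \<int>" if "j \<in> ?J" "x \<in> X" for j x using that f N by (auto simp: N'_def l'_def)
  qed (use cov' in auto)
  define R where "R = {i. Some i \<in> I}"
  have RB: "R \<subseteq> B" using I(1) by (auto simp: R_def)
  have "None \<in> I"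
  proof (rule ccontr)
    assume "None \<notin> I"
    hence "I = Some ` R" unfolding R_def using I(1) by auto
    hence "0 \<in> (\<Union>j\<in>R. cover_piece (p j) 0 (l j))" using I(2) add_subgroupD(1)[OF X] by (auto simp: piece)
    then obtain j where "j \<in> R" "0 \<in> cover_piece (p j) 0 (l j)" by blast
    thus False using l[of j] RB by (auto simp: cover_piece_def Modules.additive.zero)
  qed
  have I': "I = insert None (Some ` R)"
  proof
    show "I \<subseteq> insert None (Some ` R)" unfolding R_def using I(1) by auto
  qed (use \<open>None \<in> I\<close> in \<open>auto simp: R_def\<close>)
  have "card I = card R + 1" unfolding I' using finite_subset[OF RB B]
    by (simp add: card_image)
  moreover have "int_kernel X I l' = {x \<in> X. f x \<in> \<int> \<and> (\<forall>i\<in>R. l i x \<in> \<int>)}"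
    unfolding I' int_kernel_def by (simp add: l'_def)
  ultimately have "omega_index X {x \<in> X. f x \<in> \<int> \<and> (\<forall>i\<in>R. l i x \<in> \<int>)} \<le> card R" using I(3) by simp
  thus ?thesis by (rule that[OF RB I(2)[unfolded I' un]])
qed

text \<open>The piece of one functional \<open>b\<close> is supplemented by the class where
  \<open>l b\<close> is integral; it contains \<open>Q\<close>, so all of \<open>Y\<close> is
  covered. The functionals \<open>R\<close> that this cover uses pay for the index of their joint
  kernel with \<open>b\<close>. On that kernel their pieces and that of \<open>b\<close> are empty,
  so only the rest of \<open>B\<close> is left for the induction.\<close>

lemma omega_index_le_card:
  fixes Y :: "'a::real_vector set" and N :: "'b \<Rightarrow> nat"
  assumes "add_subgroup Y" "add_subgroup Q" "Q \<subseteq> Y" "finite (cosets Y Q)" "finite B"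
    "\<And>j. j \<in> B \<Longrightarrow> Modules.additive (l j)" "\<And>j. j \<in> B \<Longrightarrow> prime (p j)"
    "\<And>j. j \<in> B \<Longrightarrow> N j > 0" "\<And>j x. j \<in> B \<Longrightarrow> x \<in> Y \<Longrightarrow> real (N j) * l j x \<in> \<int>"
    "\<And>j x. j \<in> B \<Longrightarrow> x \<in> Q \<Longrightarrow> l j x \<in> \<int>"
    "Y - Q \<subseteq> (\<Union>j\<in>B. cover_piece (p j) 0 (l j))"
  shows "omega_index Y Q \<le> card B"
  using assms
proof (induction "card B" arbitrary: Y B rule: less_induct)
  case less
  note Y = less.prems(1) and Q = less.prems(2,3) and fin = less.prems(4) and B = less.prems(5)
    and l = less.prems(6) and p = less.prems(7) and N = less.prems(8,9) and lQ = less.prems(10)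
    and cov = less.prems(11)
  show ?case
  proof (cases "Y = Q")
    case True thus ?thesis using omega_index_self[OF Y] by simp
  next
    case False
    then obtain y where "y \<in> Y - Q" using Q(2) by auto
    then obtain b where b: "b \<in> B" "y \<in> cover_piece (p b) 0 (l b)" using cov by blast
    have cov': "Y \<subseteq> {x. l b x \<in> \<int>} \<union> (\<Union>j\<in>B. cover_piece (p j) 0 (l j))" using cov lQ[OF b(1)] by blast
    obtain R where R: "R \<subseteq> B" "omega_index Y {x \<in> Y. l b x \<in> \<int> \<and> (\<forall>i\<in>R. l i x \<in> \<int>)} \<le> card R"
      by (rule cover_index_class[OF Y B l p N l[OF b(1)] N(1)[OF b(1)] N(2)[OF b(1)] cov'])
    let ?Y = "{x \<in> Y. l b x \<in> \<int> \<and> (\<forall>i\<in>R. l i x \<in> \<int>)}"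
    let ?B = "B - R - {b}"
    have Y': "?Y = int_kernel Y (insert b R) l" by (auto simp: int_kernel_def)
    have subY': "add_subgroup ?Y" unfolding Y' by (rule add_subgroup_int_kernel[OF Y]) (use l b R in auto)
    have QY': "Q \<subseteq> ?Y" using Q(2) lQ R(1) b(1) by blast
    have Q': "add_subgroup Q" by (rule Q)
    have "?Y - Q \<subseteq> (\<Union>j\<in>?B. cover_piece (p j) 0 (l j))"
    proof
      fix x assume x: "x \<in> ?Y - Q"
      then obtain i where i: "i \<in> B" "x \<in> cover_piece (p i) 0 (l i)" using cov by blast
      hence "l i x \<notin> \<int>" by (simp add: cover_piece_def)
      hence "i \<in> ?B" using x i(1) by auto
      thus "x \<in> (\<Union>j\<in>?B. cover_piece (p j) 0 (l j))" using i(2) by blast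
    qed
    moreover have "card ?B < card B" by (rule psubset_card_mono[OF B]) (use b in auto)
    moreover have "finite (cosets ?Y Q)" by (rule finite_cosets_mono[OF Q' Q' fin]) auto
    ultimately have IH: "omega_index ?Y Q \<le> card ?B"
      by (intro less.hyps subY' Q' QY') (use B l p N lQ in auto)
    have "omega_index Y Q = omega_index Y ?Y + omega_index ?Y Q"
      by (rule omega_index_add[OF Y subY' Q' QY' _ fin]) auto
    also have "\<dots> \<le> card R + card ?B" using IH R(2) by simp
    also have "\<dots> = card (R \<union> ?B)"
      by (rule card_Un_disjoint[symmetric]) (use B R finite_subset in auto)
    also have "\<dots> \<le> card B" by (rule card_mono[OF B]) (use R in auto)
    finally show ?thesis .
  qed
qed

text \<open>The equality case of \<open>omega_index_le_card\<close>. The piece of some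
  \<open>a\<close> is traded for the larger class where \<open>?f\<close> is integral, which
  contains \<open>Q\<close> too. If no other piece is needed, \<open>a\<close> is the answer;
  otherwise equality passes to the pieces \<open>R\<close> that are needed, with the kernel
  \<open>?Y\<close> in the place of \<open>Q\<close>.\<close>

theorem hajos_subgroups:
  fixes X :: "'a::real_vector set" and N :: "'b \<Rightarrow> nat"
  assumes "add_subgroup X" "add_subgroup Q" "Q \<subseteq> X" "finite (cosets X Q)" "finite B" "B \<noteq> {}"
    "\<And>j. j \<in> B \<Longrightarrow> Modules.additive (l j)" "\<And>j. j \<in> B \<Longrightarrow> prime (p j)"
    "\<And>j. j \<in> B \<Longrightarrow> N j > 0" "\<And>j x. j \<in> B \<Longrightarrow> x \<in> X \<Longrightarrow> real (N j) * l j x \<in> \<int>"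
    "\<And>j x. j \<in> B \<Longrightarrow> x \<in> Q \<Longrightarrow> l j x \<in> \<int>"
    "X - Q \<subseteq> (\<Union>j\<in>B. cover_piece (p j) 0 (l j))" "card B \<le> omega_index X Q"
  shows "\<exists>b\<in>B. \<forall>x\<in>X. real (p b) * l b x \<in> \<int>"
  using assms
proof (induction "card B" arbitrary: Q B rule: less_induct)
  case less
  note X = less.prems(1) and Q = less.prems(2,3) and fin = less.prems(4) and B = less.prems(5)
    and l = less.prems(7) and p = less.prems(8) and N = less.prems(9,10) and lQ = less.prems(11)
    and cov = less.prems(12) and om = less.prems(13)
  obtain a where a: "a \<in> B" using less.prems(6) by auto
  let ?f = "\<lambda>x. real (p a) * l a x"
  have f: "Modules.additive ?f" by (rule additive_mult[OF l[OF a]])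
  have Nf: "real (N a) * ?f x \<in> \<int>" if "x \<in> X" for x
  proof -
    have "real (N a) * ?f x = real (p a) * (real (N a) * l a x)" by (simp add: algebra_simps)
    thus ?thesis using N(2)[OF a that] by (metis Ints_mult Ints_of_nat)
  qed
  have cov': "X \<subseteq> {x. ?f x \<in> \<int>} \<union> (\<Union>j\<in>B - {a}. cover_piece (p j) 0 (l j))"
  proof
    fix x assume x: "x \<in> X"
    show "x \<in> {x. ?f x \<in> \<int>} \<union> (\<Union>j\<in>B - {a}. cover_piece (p j) 0 (l j))"
    proof (cases "x \<in> Q")
      case True
      have "?f x \<in> \<int>" using lQ[OF a True] by (intro Ints_mult) auto
      thus ?thesis by simp
    next
      case False
      then obtain i where i: "i \<in> B" "x \<in> cover_piece (p i) 0 (l i)" using x cov by blast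
      thus ?thesis by (cases "i = a") (auto simp: cover_piece_def)
    qed
  qed
  have Ba: "i \<in> B" if "i \<in> B - {a}" for i using that by simp
  obtain R where R: "R \<subseteq> B - {a}" "X \<subseteq> {x. ?f x \<in> \<int>} \<union> (\<Union>j\<in>R. cover_piece (p j) 0 (l j))"
    "omega_index X {x \<in> X. ?f x \<in> \<int> \<and> (\<forall>i\<in>R. l i x \<in> \<int>)} \<le> card R"
    by (rule cover_index_class[OF X finite_Diff[OF B] l[OF Ba] p[OF Ba] N(1)[OF Ba] N(2)[OF Ba] f N(1)[OF a] Nf cov'])
  have RB: "R \<subseteq> B" "a \<notin> R" using R(1) by auto
  have finR: "finite R" by (rule finite_subset[OF RB(1) B])
  show ?case
  proof (cases "R = {}")
    case True
    hence "\<forall>x\<in>X. ?f x \<in> \<int>" using R(2) by auto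
    thus ?thesis using a by blast
  next
    case Rne: False
    let ?Y = "{x \<in> X. ?f x \<in> \<int> \<and> (\<forall>i\<in>R. l i x \<in> \<int>)}"
    have Y': "?Y = int_kernel {x \<in> X. ?f x \<in> \<int>} R l" by (auto simp: int_kernel_def)
    have "{x \<in> X. ?f x \<in> \<int>} = int_kernel X {()} (\<lambda>_. ?f)" by (auto simp: int_kernel_def)
    hence "add_subgroup {x \<in> X. ?f x \<in> \<int>}" using add_subgroup_int_kernel[OF X, of "{()}" "\<lambda>_. ?f"] f by simp
    hence subY: "add_subgroup ?Y" unfolding Y' by (rule add_subgroup_int_kernel) (use l RB in auto)
    have fQ: "?f x \<in> \<int>" if "x \<in> Q" for x using lQ[OF a that] by (intro Ints_mult) auto
    have QY: "Q \<subseteq> ?Y" using Q(2) lQ RB(1) fQ by blast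
    have YX: "?Y \<subseteq> X" by blast
    have Q': "add_subgroup Q" by (rule Q)
    have finYQ: "finite (cosets ?Y Q)" by (rule finite_cosets_mono[OF Q' Q' fin YX]) simp
    have finXY: "finite (cosets X ?Y)" by (rule finite_cosets_mono[OF subY Q' fin _ QY]) simp
    have sum1: "omega_index X Q = omega_index X ?Y + omega_index ?Y Q"
      by (rule omega_index_add[OF X subY Q' QY YX fin])
    have cBR: "card (B - R) = card B - card R" "card R \<le> card B"
      using card_Diff_subset[OF finR RB(1)] card_mono[OF B RB(1)] by auto
    have covY: "?Y - Q \<subseteq> (\<Union>j\<in>B - R. cover_piece (p j) 0 (l j))"
    proof
      fix x assume x: "x \<in> ?Y - Q"
      then obtain i where i: "i \<in> B" "x \<in> cover_piece (p i) 0 (l i)" using cov by blast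
      hence "l i x \<notin> \<int>" by (simp add: cover_piece_def)
      hence "i \<in> B - R" using x i(1) by auto
      thus "x \<in> (\<Union>j\<in>B - R. cover_piece (p j) 0 (l j))" using i(2) by blast
    qed
    have "omega_index ?Y Q \<le> card (B - R)"
      by (rule omega_index_le_card[OF subY Q' QY finYQ finite_Diff[OF B], where N=N and l=l and p=p])
        (use l p N lQ covY in auto)
    hence omXY: "card R \<le> omega_index X ?Y" and omYQ: "card B - card R \<le> omega_index ?Y Q"
      using sum1 om R(3) cBR by auto
    \<comment> \<open>For a point \<open>x\<close> missed by \<open>R\<close>, the coset
      \<open>x + ?Y\<close> avoids \<open>Q\<close> and must be covered by the pieces in
      \<open>B - R\<close> alone. A cover of a whole coset saves 1 in the index bound, which
      \<open>omYQ\<close> rules out.\<close>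
    have "X - ?Y \<subseteq> (\<Union>j\<in>R. cover_piece (p j) 0 (l j))"
    proof (rule subsetI, rule ccontr)
      fix x assume x: "x \<in> X - ?Y" and nx: "x \<notin> (\<Union>j\<in>R. cover_piece (p j) 0 (l j))"
      have covx: "?Y \<subseteq> (\<Union>j\<in>B - R. cover_piece (p j) (- l j x) (l j))"
      proof
        fix y assume y: "y \<in> ?Y"
        have "x + y \<notin> Q"
        proof
          assume "x + y \<in> Q"
          hence "(x + y) - y \<in> ?Y" using QY y by (intro add_subgroupD(2)[OF subY]) auto
          thus False using x by simp
        qed
        moreover have "x + y \<in> X" using x y by (intro add_subgroupD(4)[OF X]) auto
        ultimately obtain i where i: "i \<in> B" "x + y \<in> cover_piece (p i) 0 (l i)" using cov by blast
        have "i \<notin> R"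
        proof
          assume iR: "i \<in> R"
          hence "l i y \<in> \<int>" using y by blast
          from cover_piece_shift[OF this l[OF i(1)]] i(2) nx iR show False by blast
        qed
        moreover have "y \<in> cover_piece (p i) (- l i x) (l i)"
        proof -
          have "l i (x + y) - 0 = l i y - (- l i x)" unfolding Modules.additive.add[OF l[OF i(1)]] by simp
          thus ?thesis using i(2) by (simp add: cover_piece_def)
        qed
        ultimately show "y \<in> (\<Union>j\<in>B - R. cover_piece (p j) (- l j x) (l j))" using i(1) by blast
      qed
      have BR: "i \<in> B" if "i \<in> B - R" for i using that by simp
      obtain J where J: "J \<subseteq> B - R" "omega_index ?Y (int_kernel ?Y J l) + 1 \<le> card J"
        by (rule cover_index[OF subY finite_Diff[OF B] l[OF BR] p[OF BR] N(1)[OF BR] N(2)[OF BR subsetD[OF YX]] covx])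
      let ?Z = "int_kernel ?Y J l"
      have finJ: "finite J" by (rule finite_subset[OF J(1) finite_Diff[OF B]])
      have subZ: "add_subgroup ?Z" by (rule add_subgroup_int_kernel[OF subY]) (use l J(1) in auto)
      have QZ: "Q \<subseteq> ?Z" unfolding int_kernel_def using QY lQ J(1) by blast
      have ZY: "?Z \<subseteq> ?Y" by (auto simp: int_kernel_def)
      have covZ: "?Z - Q \<subseteq> (\<Union>j\<in>B - R - J. cover_piece (p j) 0 (l j))"
      proof
        fix x assume x: "x \<in> ?Z - Q"
        then obtain i where i: "i \<in> B - R" "x \<in> cover_piece (p i) 0 (l i)" using covY ZY by blast
        hence "l i x \<notin> \<int>" by (simp add: cover_piece_def)
        hence "i \<in> B - R - J" using x i(1) by (auto simp: int_kernel_def)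
        thus "x \<in> (\<Union>j\<in>B - R - J. cover_piece (p j) 0 (l j))" using i(2) by blast
      qed
      have finZQ: "finite (cosets ?Z Q)" by (rule finite_cosets_mono[OF Q' Q' finYQ ZY]) simp
      have "omega_index ?Z Q \<le> card (B - R - J)"
        by (rule omega_index_le_card[OF subZ Q' QZ finZQ, where N=N and l=l and p=p])
          (use l p N lQ covZ B in \<open>auto simp: int_kernel_def\<close>)
      also have "\<dots> = card (B - R) - card J" by (rule card_Diff_subset[OF finJ J(1)])
      finally have "omega_index ?Z Q \<le> card B - card R - card J" unfolding cBR(1) .
      moreover have "card J \<le> card B - card R" using card_mono[OF finite_Diff[OF B] J(1)] unfolding cBR(1) .
      moreover have "omega_index ?Y Q = omega_index ?Y ?Z + omega_index ?Z Q"
        by (rule omega_index_add[OF subY subZ Q' QZ ZY finYQ])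
      ultimately show False using omYQ J(2) by linarith
    qed
    note covR = this
    have lt: "card R < card B" by (rule psubset_card_mono[OF B]) (use RB a in auto)
    have RB': "i \<in> B" if "i \<in> R" for i using that RB(1) by blast
    have lY: "l i x \<in> \<int>" if "i \<in> R" "x \<in> ?Y" for i x using that by blast
    have "\<exists>b\<in>R. \<forall>x\<in>X. real (p b) * l b x \<in> \<int>"
      by (rule less.hyps[OF lt X subY YX finXY finR Rne l[OF RB'] p[OF RB'] N(1)[OF RB'] N(2)[OF RB'] lY covR omXY])
    thus ?thesis using RB(1) by blast
  qed
qed

section \<open>Cube tilings and the theorem of Hajos\<close>

text \<open>The tiles are indexed by a set; the relation \<open>R\<close> records which indices name the same tile,
  so that tiles that are moved onto each other are not identified.\<close>

definition cube_tiling :: "'i set \<Rightarrow> 'a set \<Rightarrow> ('a \<Rightarrow> 'i \<Rightarrow> real) \<Rightarrow> ('a \<Rightarrow> 'a \<Rightarrow> bool) \<Rightarrow> bool" where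
  "cube_tiling I A h R \<longleftrightarrow>
    (\<forall>p. \<exists>a\<in>A. \<forall>i\<in>I. h a i \<le> p i \<and> p i < h a i + 1) \<and>
    (\<forall>a\<in>A. \<forall>b\<in>A. (\<forall>i\<in>I. \<bar>h a i - h b i\<bar> < 1) \<longrightarrow> R a b) \<and>
    (\<forall>a\<in>A. \<forall>b\<in>A. R a b \<longrightarrow> (\<forall>i\<in>I. h a i = h b i))"

lemma cube_tilingD:
  assumes "cube_tiling I A h R"
  shows "\<exists>a\<in>A. \<forall>i\<in>I. h a i \<le> p i \<and> p i < h a i + 1"
    "a \<in> A \<Longrightarrow> b \<in> A \<Longrightarrow> (\<And>i. i \<in> I \<Longrightarrow> \<bar>h a i - h b i\<bar> < 1) \<Longrightarrow> R a b"
    "a \<in> A \<Longrightarrow> b \<in> A \<Longrightarrow> R a b \<Longrightarrow> i \<in> I \<Longrightarrow> h a i = h b i"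
proof -
  note T = assms[unfolded cube_tiling_def]
  show "\<exists>a\<in>A. \<forall>i\<in>I. h a i \<le> p i \<and> p i < h a i + 1" using conjunct1[OF T] by (rule spec)
  show "R a b" if "a \<in> A" "b \<in> A" "\<And>i. i \<in> I \<Longrightarrow> \<bar>h a i - h b i\<bar> < 1"
    using conjunct1[OF conjunct2[OF T]] that by blast
  show "h a i = h b i" if "a \<in> A" "b \<in> A" "R a b" "i \<in> I"
    using conjunct2[OF conjunct2[OF T]] that by blast
qed

text \<open>The point \<open>p\<close> takes the larger corner in each coordinate, so the line
  through it parallel to axis \<open>i\<close> meets both tiles. The tiles along a line are stacked
  without gaps or overlaps, so their corners differ by integers.\<close>

lemma cube_tiling_line:
  assumes T: "cube_tiling I A h R" and i: "i \<in> I" and ab: "a \<in> A" "b \<in> A"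
    and close: "\<And>c. c \<in> I - {i} \<Longrightarrow> \<bar>h a c - h b c\<bar> < 1"
  shows "h a i - h b i \<in> \<int>"
proof -
  define p where "p c = max (h a c) (h b c)" for c
  define cov where "cov d \<longleftrightarrow> (\<forall>c\<in>I - {i}. h d c \<le> p c \<and> p c < h d c + 1)" for d
  have cov: "cov a" "cov b" using close unfolding cov_def p_def by fastforce+
  have close_cov: "\<bar>h d c - h e c\<bar> < 1" if "cov d" "cov e" "c \<in> I - {i}" for d e c
  proof -
    have "h d c \<le> p c \<and> p c < h d c + 1" "h e c \<le> p c \<and> p c < h e c + 1" using that unfolding cov_def by auto
    thus ?thesis by linarith
  qed
  have eq: "h d i = h e i" if "d \<in> A" "e \<in> A" "cov d" "cov e" "\<bar>h d i - h e i\<bar> < 1" for d e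
  proof -
    have "\<bar>h d c - h e c\<bar> < 1" if "c \<in> I" for c
      using close_cov[OF \<open>cov d\<close> \<open>cov e\<close>, of c] \<open>\<bar>h d i - h e i\<bar> < 1\<close> that by (cases "c = i") auto
    hence "R d e" using cube_tilingD(2)[OF T that(1,2)] by blast
    thus ?thesis using cube_tilingD(3)[OF T that(1,2) _ i] by blast
  qed
  \<comment> \<open>The point of the line at which tile \<open>d\<close> ends lies in another tile,
    and that one must start exactly there.\<close>
  have succ: "\<exists>d'\<in>A. cov d' \<and> h d' i = h d i + 1" if d: "d \<in> A" "cov d" for d
  proof -
    obtain d' where d': "d' \<in> A" "\<forall>c\<in>I. h d' c \<le> (p(i := h d i + 1)) c \<and> (p(i := h d i + 1)) c < h d' c + 1"
      using cube_tilingD(1)[OF T, of "p(i := h d i + 1)"] by blast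
    have c': "cov d'" unfolding cov_def
    proof
      fix c assume c: "c \<in> I - {i}"
      hence "c \<in> I" "c \<noteq> i" by auto
      thus "h d' c \<le> p c \<and> p c < h d' c + 1" using d'(2)[rule_format, of c] by simp
    qed
    have di: "h d' i \<le> h d i + 1" "h d i + 1 < h d' i + 1" using d'(2) i by auto
    have "\<not> \<bar>h d' i - h d i\<bar> < 1" using eq[OF d'(1) d(1) c' d(2)] di by auto
    hence "h d' i = h d i + 1" using di by linarith
    thus ?thesis using d'(1) c' by blast
  qed
  have iter: "\<exists>d'\<in>A. cov d' \<and> h d' i = h d i + real n" if d: "d \<in> A" "cov d" for d n
  proof (induction n)
    case (Suc n)
    then obtain d' where "d' \<in> A" "cov d'" "h d' i = h d i + real n" by blast
    thus ?case using succ[of d'] by force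
  qed (use d in auto)
  have main: "h d i - h e i \<in> \<int>" if de: "d \<in> A" "e \<in> A" "cov d" "cov e" "h e i \<le> h d i" for d e
  proof -
    define n where "n = nat \<lfloor>h d i - h e i\<rfloor>"
    obtain e' where e': "e' \<in> A" "cov e'" "h e' i = h e i + real n" using iter[OF de(2,4)] by blast
    have "real n \<le> h d i - h e i" "h d i - h e i < real n + 1"
      using de(5) unfolding n_def by (auto simp: of_nat_nat)
    hence "h d i = h e' i" using e' by (intro eq[OF de(1) e'(1) de(3) e'(2)]) auto
    thus ?thesis using e'(3) by simp
  qed
  show ?thesis
  proof (cases "h b i \<le> h a i")
    case True thus ?thesis using main[OF ab cov] by simp
  next
    case False
    hence "- (h b i - h a i) \<in> \<int>" using main[OF ab(2,1) cov(2,1)] by (intro Ints_minus) auto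
    thus ?thesis by simp
  qed
qed

lemma periodic_shift_int:
  assumes per: "\<forall>t. f (t + 1) = f t + (1::real)" and st: "s - t \<in> \<int>"
  shows "f s - f t = s - t"
proof -
  have n: "f (t + real n) = f t + real n" for t n
  proof (induction n)
    case (Suc n)
    have "f (t + real (Suc n)) = f ((t + real n) + 1)" by (simp add: algebra_simps)
    thus ?case using Suc per[rule_format, of "t + real n"] by simp
  qed simp
  obtain k where k: "s - t = of_int k" using st by (rule Ints_cases)
  show ?thesis
  proof (cases "k \<ge> 0")
    case True
    hence "s = t + real (nat k)" using k by simp
    thus ?thesis using n[of t "nat k"] by simp
  next
    case False
    hence "t = s + real (nat (- k))" using k by simp
    thus ?thesis using n[of s "nat (- k)"] by simp
  qed
qed

text \<open>The displacement depends only on the \<open>i\<close>-th coordinate modulo 1, which is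
  constant along a line of tiles. So each line of tiles moves rigidly along itself.\<close>

lemma cube_tiling_shift1:
  assumes T: "cube_tiling I A h R" and i: "i \<in> I" and f: "\<forall>t. f (t + 1) = f t + (1::real)"
  shows "cube_tiling I A (\<lambda>a. (h a)(i := f (h a i))) R"
proof -
  have cov: "\<exists>a\<in>A. \<forall>c\<in>I. ((h a)(i := f (h a i))) c \<le> p c \<and> p c < ((h a)(i := f (h a i))) c + 1" for p
  proof -
    obtain a where a: "a \<in> A" "\<forall>c\<in>I. h a c \<le> p c \<and> p c < h a c + 1" using cube_tilingD(1)[OF T] by blast
    \<comment> \<open>To find the tile over \<open>p\<close> after the shift, \<open>p\<close> is
      moved back by the displacement of its own line of tiles.\<close>
    define q where "q = p(i := p i - (f (h a i) - h a i))"
    obtain b where b: "b \<in> A" "\<forall>c\<in>I. h b c \<le> q c \<and> q c < h b c + 1" using cube_tilingD(1)[OF T] by blast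
    have "h b i - h a i \<in> \<int>"
    proof (rule cube_tiling_line[OF T i b(1) a(1)])
      fix c assume "c \<in> I - {i}"
      hence "h a c \<le> p c \<and> p c < h a c + 1" "h b c \<le> p c \<and> p c < h b c + 1" using a(2) b(2) by (auto simp: q_def)
      thus "\<bar>h b c - h a c\<bar> < 1" by linarith
    qed
    hence "f (h b i) - f (h a i) = h b i - h a i" by (rule periodic_shift_int[OF f])
    moreover have "h b i \<le> p i - (f (h a i) - h a i)" "p i - (f (h a i) - h a i) < h b i + 1"
      using b(2) i by (auto simp: q_def)
    ultimately have "f (h b i) \<le> p i \<and> p i < f (h b i) + 1" by linarith
    hence "\<forall>c\<in>I. ((h b)(i := f (h b i))) c \<le> p c \<and> p c < ((h b)(i := f (h b i))) c + 1"
      using b(2) by (auto simp: q_def)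
    thus ?thesis using b(1) by blast
  qed
  have pack: "R a b" if ab: "a \<in> A" "b \<in> A"
    and close: "\<forall>c\<in>I. \<bar>((h a)(i := f (h a i))) c - ((h b)(i := f (h b i))) c\<bar> < 1" for a b
  proof -
    have c: "\<bar>h a c - h b c\<bar> < 1" if "c \<in> I - {i}" for c using close that by auto
    have "h a i - h b i \<in> \<int>" by (rule cube_tiling_line[OF T i ab c])
    hence "f (h a i) - f (h b i) = h a i - h b i" by (rule periodic_shift_int[OF f])
    moreover have "\<bar>f (h a i) - f (h b i)\<bar> < 1" using close i by auto
    ultimately have "\<bar>h a c - h b c\<bar> < 1" if "c \<in> I" for c using c that by (cases "c = i") auto
    thus ?thesis using cube_tilingD(2)[OF T ab] by blast
  qed
  have eq: "((h a)(i := f (h a i))) c = ((h b)(i := f (h b i))) c" if "a \<in> A" "b \<in> A" "R a b" "c \<in> I" for a b c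
    using cube_tilingD(3)[OF T that(1-3) i] cube_tilingD(3)[OF T that] by simp
  show ?thesis unfolding cube_tiling_def
    by (intro conjI allI ballI impI cov) (rule pack eq; assumption)+
qed

lemma cube_tiling_cong:
  assumes T: "cube_tiling I A h R" and eq: "\<And>a i. i \<in> I \<Longrightarrow> h a i = h' a i"
  shows "cube_tiling I A h' R"
  unfolding cube_tiling_def
proof (intro conjI ballI allI impI)
  fix p
  obtain a where "a \<in> A" "\<forall>i\<in>I. h a i \<le> p i \<and> p i < h a i + 1" using cube_tilingD(1)[OF T] by blast
  thus "\<exists>a\<in>A. \<forall>i\<in>I. h' a i \<le> p i \<and> p i < h' a i + 1" using eq by (metis (no_types, lifting))
next
  fix a b assume ab: "a \<in> A" "b \<in> A"
  show "R a b" if "\<forall>i\<in>I. \<bar>h' a i - h' b i\<bar> < 1"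
    by (rule cube_tilingD(2)[OF T ab]) (use that eq in metis)
  show "h' a i = h' b i" if "R a b" "i \<in> I" for i
    using cube_tilingD(3)[OF T ab that] eq[OF that(2)] by simp
qed

lemma cube_tiling_shift:
  assumes T: "cube_tiling I A h R" and I: "finite I" and f: "\<And>i. \<forall>t. f i (t + 1) = f i t + (1::real)"
  shows "cube_tiling I A (\<lambda>a i. f i (h a i)) R"
proof -
  have "cube_tiling I A (\<lambda>a i. if i \<in> J then f i (h a i) else h a i) R" if "finite J" "J \<subseteq> I" for J
    using that
  proof (induction J rule: finite_induct)
    case (insert j J)
    have "(\<lambda>a i. if i \<in> insert j J then f i (h a i) else h a i) =
        (\<lambda>a. (\<lambda>i. if i \<in> J then f i (h a i) else h a i)(j := f j (if j \<in> J then f j (h a j) else h a j)))"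
      using insert.hyps(2) by (auto simp: fun_eq_iff)
    moreover have IH: "cube_tiling I A (\<lambda>a i. if i \<in> J then f i (h a i) else h a i) R" and jI: "j \<in> I"
      using insert.IH insert.prems by auto
    from cube_tiling_shift1[OF IH jI f[of j]]
    have "cube_tiling I A (\<lambda>a. (\<lambda>i. if i \<in> J then f i (h a i) else h a i)
      (j := f j (if j \<in> J then f j (h a j) else h a j))) R" .
    ultimately show ?case by simp
  qed (use T in simp)
  from this[OF I] have *: "cube_tiling I A (\<lambda>a i. if i \<in> I then f i (h a i) else h a i) R" by simp
  show ?thesis by (rule cube_tiling_cong[OF *]) simp
qed

text \<open>Coordinates outside \<open>I\<close> are ignored, so that slices of a tiling can be
  formed within one type.\<close>

definition lattice_tiling :: "'i::finite set \<Rightarrow> (real ^ 'i) set \<Rightarrow> bool" where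
  "lattice_tiling I L \<longleftrightarrow> add_subgroup L \<and>
    (\<forall>p. \<exists>v\<in>L. \<forall>i\<in>I. v $ i \<le> p i \<and> p i < v $ i + 1) \<and>
    (\<forall>v\<in>L. (\<forall>i\<in>I. \<bar>v $ i\<bar> < 1) \<longrightarrow> (\<forall>i\<in>I. v $ i = 0))"

lemma lattice_tilingD:
  assumes "lattice_tiling I L"
  shows "add_subgroup L" "\<exists>v\<in>L. \<forall>i\<in>I. v $ i \<le> p i \<and> p i < v $ i + 1"
    "v \<in> L \<Longrightarrow> (\<And>i. i \<in> I \<Longrightarrow> \<bar>v $ i\<bar> < 1) \<Longrightarrow> j \<in> I \<Longrightarrow> v $ j = 0"
proof -
  note T = assms[unfolded lattice_tiling_def]
  show "add_subgroup L" using T by (rule conjunct1)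
  show "\<exists>v\<in>L. \<forall>i\<in>I. v $ i \<le> p i \<and> p i < v $ i + 1" using conjunct1[OF conjunct2[OF T]] by (rule spec)
  show "v $ j = 0" if "v \<in> L" "\<And>i. i \<in> I \<Longrightarrow> \<bar>v $ i\<bar> < 1" "j \<in> I"
    using conjunct2[OF conjunct2[OF T]] that by blast
qed

lemma lattice_tiling_cube_tiling:
  assumes L: "lattice_tiling I L"
  shows "cube_tiling I L (\<lambda>v i. v $ i) (\<lambda>u v. \<forall>i\<in>I. u $ i = v $ i)"
  unfolding cube_tiling_def
proof (intro conjI ballI allI impI)
  show "\<exists>a\<in>L. \<forall>i\<in>I. a $ i \<le> p i \<and> p i < a $ i + 1" for p by (rule lattice_tilingD(2)[OF L])
  fix a b i assume ab: "a \<in> L" "b \<in> L" "\<forall>i\<in>I. \<bar>a $ i - b $ i\<bar> < 1" "i \<in> I"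
  hence "(a - b) $ i = 0"
    by (intro lattice_tilingD(3)[OF L] add_subgroupD(2)[OF lattice_tilingD(1)[OF L]]) auto
  thus "a $ i = b $ i" by simp
qed auto

text \<open>Keller's argument: if all integral coordinates of \<open>v\<close> were zero, shifting
  the residue class of each non-integral \<open>v $ i\<close> to that of 0 would give the tiles at
  \<open>v\<close> and at 0 the same corner. The shifted tiling still separates different tiles, so
  the two tiles are the same.\<close>

lemma keller:
  assumes L: "lattice_tiling I L" and v: "v \<in> L" and z: "\<And>i. i \<in> I \<Longrightarrow> v $ i \<in> \<int> \<Longrightarrow> v $ i = 0"
    and j: "j \<in> I"
  shows "v $ j = 0"
proof -
  define f where "f i t = (if t - v $ i \<in> \<int> \<and> v $ i \<notin> \<int> then t - v $ i else t)" for i and t :: real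
  have f1: "\<forall>t. f i (t + 1) = f i t + 1" for i
  proof
    fix t
    have "t + 1 - v $ i \<in> \<int> \<longleftrightarrow> t - v $ i \<in> \<int>" using Ints_add_cancel[of 1 "t - v $ i"] by (simp add: algebra_simps)
    thus "f i (t + 1) = f i t + 1" by (simp add: f_def)
  qed
  have T: "cube_tiling I L (\<lambda>v i. f i (v $ i)) (\<lambda>u v. \<forall>i\<in>I. u $ i = v $ i)"
    by (rule cube_tiling_shift[where f=f, OF lattice_tiling_cube_tiling[OF L] finite f1])
  have fv: "f i (v $ i) = 0" if "i \<in> I" for i
    by (cases "v $ i \<in> \<int>") (simp_all add: f_def z[OF that])
  have f0: "f i 0 = 0" for i by (simp add: f_def)
  have "\<forall>i\<in>I. v $ i = 0 $ i"
  proof (rule cube_tilingD(2)[OF T v add_subgroupD(1)[OF lattice_tilingD(1)[OF L]]])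
    show "\<bar>f i (v $ i) - f i (0 $ i)\<bar> < 1" if "i \<in> I" for i using fv[OF that] f0[of i] by simp
  qed
  thus ?thesis using j by simp
qed

text \<open>Additivity and \<open>f 1 = 1\<close> make \<open>f\<close> a legitimate shift in every
  coordinate, and additivity also keeps the set of corners a group.\<close>

lemma lattice_tiling_additive_image:
  assumes L: "lattice_tiling I L" and f: "Modules.additive f" "f 1 = (1::real)"
  shows "lattice_tiling I ((\<lambda>v. \<chi> i. f (v $ i)) ` L)"
proof -
  let ?F = "\<lambda>v. \<chi> i. f (v $ i)"
  have f1: "\<forall>t. f (t + 1) = f t + 1" by (simp add: Modules.additive.add[OF f(1)] f(2))
  have T: "cube_tiling I L (\<lambda>v i. f (v $ i)) (\<lambda>u v. \<forall>i\<in>I. u $ i = v $ i)"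
    by (rule cube_tiling_shift[where f="\<lambda>_. f", OF lattice_tiling_cube_tiling[OF L] finite f1])
  note sub = lattice_tilingD(1)[OF L]
  show ?thesis unfolding lattice_tiling_def
  proof (intro conjI allI ballI impI)
    have F0: "0 = ?F 0" by (simp add: vec_eq_iff Modules.additive.zero[OF f(1)])
    have Fd: "?F u - ?F v = ?F (u - v)" for u v by (simp add: vec_eq_iff Modules.additive.diff[OF f(1)])
    show "add_subgroup (?F ` L)" unfolding add_subgroup_def
    proof (intro conjI ballI)
      show "0 \<in> ?F ` L" using F0 add_subgroupD(1)[OF sub] by (rule image_eqI)
      fix x y assume "x \<in> ?F ` L" "y \<in> ?F ` L"
      then obtain u v where "x = ?F u" "y = ?F v" "u \<in> L" "v \<in> L" by (elim imageE)
      thus "x - y \<in> ?F ` L" using Fd[of u v] add_subgroupD(2)[OF sub, of u v] by (simp only: image_eqI)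
    qed
    fix p
    obtain v where v: "v \<in> L" "\<forall>i\<in>I. f (v $ i) \<le> p i \<and> p i < f (v $ i) + 1"
      using cube_tilingD(1)[OF T, of p] by (elim bexE)
    show "\<exists>v\<in>?F ` L. \<forall>i\<in>I. v $ i \<le> p i \<and> p i < v $ i + 1"
      by (rule bexI[OF _ imageI[OF v(1)]]) (use v(2) in simp)
  next
    fix w i assume w: "w \<in> ?F ` L" "\<forall>i\<in>I. \<bar>w $ i\<bar> < 1" "i \<in> I"
    then obtain v where v: "v \<in> L" "w = ?F v" by auto
    have "\<forall>i\<in>I. v $ i = 0 $ i"
      by (rule cube_tilingD(2)[OF T v(1) add_subgroupD(1)[OF sub]])
        (use w(2) in \<open>simp add: v(2) Modules.additive.zero[OF f(1)]\<close>)
    thus "w $ i = 0" using v w by (simp add: Modules.additive.zero[OF f(1)])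
  qed
qed

text \<open>Coordinate functions of a Hamel basis of \<real> over \<rat> that contains 1,
  respectively \<open>a\<close> and 1.\<close>

lemma rational_functional:
  fixes a :: real
  shows "\<exists>f :: real \<Rightarrow> real. Modules.additive f \<and> (\<forall>x. f x \<in> \<rat>) \<and> f 1 = 1"
    and "a \<notin> \<rat> \<Longrightarrow> \<exists>g :: real \<Rightarrow> real. Modules.additive g \<and> (\<forall>x. g x \<in> \<rat>) \<and> g 1 = 0 \<and> g a = 1"
proof -
  interpret rv: vector_space "\<lambda>(r::rat) (x::real). of_rat r * x"
    by unfold_locales (simp_all add: algebra_simps of_rat_add of_rat_mult)
  have ind1: "rv.independent {1}" by simp
  have main: "\<exists>g :: real \<Rightarrow> real. Modules.additive g \<and> (\<forall>x. g x \<in> \<rat>) \<and> g b = 1 \<and> (\<forall>c\<in>S - {b}. g c = 0)"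
    if S: "rv.independent S" "b \<in> S" for S b
  proof -
    let ?B = "rv.extend_basis S"
    have B: "rv.independent ?B" "rv.span ?B = UNIV" "S \<subseteq> ?B"
      using rv.independent_extend_basis[OF S(1)] rv.span_extend_basis[OF S(1)] rv.extend_basis_superset[OF S(1)] by auto
    let ?g = "\<lambda>x. of_rat (rv.representation ?B x b) :: real"
    have "rv.representation ?B (x + y) b = rv.representation ?B x b + rv.representation ?B y b" for x y
    proof -
      have "rv.representation ?B (y + x) = (\<lambda>b. rv.representation ?B y b + rv.representation ?B x b)"
        by (rule rv.representation_add[OF B(1)]) (simp_all add: B(2))
      thus ?thesis by (simp add: add.commute)
    qed
    hence add: "Modules.additive ?g" by (simp add: Modules.additive_def of_rat_add)
    have gc: "?g c = (if c = b then 1 else 0)" if "c \<in> S" for c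
      using rv.representation_basis[OF B(1), of c] that B(3) by auto
    show ?thesis
    proof (rule exI[of _ ?g], intro conjI)
      show "Modules.additive ?g" by (rule add)
      show "\<forall>x. ?g x \<in> \<rat>" by simp
      show "?g b = 1" using gc[OF S(2)] by simp
      show "\<forall>c\<in>S - {b}. ?g c = 0" using gc by auto
    qed
  qed
  show "\<exists>f :: real \<Rightarrow> real. Modules.additive f \<and> (\<forall>x. f x \<in> \<rat>) \<and> f 1 = 1" 
  proof -
    obtain g :: "real \<Rightarrow> real" where "Modules.additive g" "\<forall>x. g x \<in> \<rat>" "g 1 = 1"
      using main[OF ind1 singletonI] by metis
    thus ?thesis by metis
  qed
  show "\<exists>g :: real \<Rightarrow> real. Modules.additive g \<and> (\<forall>x. g x \<in> \<rat>) \<and> g 1 = 0 \<and> g a = 1" if a: "a \<notin> \<rat>"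
  proof -
    have "a \<notin> rv.span {1}"
    proof
      assume "a \<in> rv.span {1}"
      then obtain r where "a = of_rat r * 1" unfolding rv.span_singleton by auto
      thus False using a by simp
    qed
    hence "rv.independent {a, 1}" using ind1 by (subst rv.independent_insert) auto
    moreover have "a \<noteq> 1" using a by auto
    ultimately obtain g :: "real \<Rightarrow> real" where g: "Modules.additive g" "\<forall>x. g x \<in> \<rat>" "g a = 1"
      "\<forall>c\<in>{a, 1} - {a}. g c = 0"
      using main[of "{a, 1}" a, OF _ insertI1] by blast
    have "g 1 = 0" using g(4) \<open>a \<noteq> 1\<close> by simp
    thus ?thesis using g(1-3) by blast
  qed
qed

text \<open>The points are treated one by one. Rational points are fixed by \<open>f\<close>. An
  irrational \<open>a\<close> with integral image is repaired by a small multiple of a functional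
  \<open>g\<close> with \<open>g 1 = 0\<close> and \<open>g a = 1\<close>; the earlier points keep
  non-integral images because \<int> is closed.\<close>

lemma rational_functional_finite:
  assumes "finite F"
  obtains f :: "real \<Rightarrow> real" where "Modules.additive f" "\<forall>x. f x \<in> \<rat>" "f 1 = 1"
    "\<forall>a\<in>F. f a \<in> \<int> \<longrightarrow> a \<in> \<int>"
proof -
  have rat: "f r = r" if f: "Modules.additive f" "f 1 = (1::real)" and r: "r \<in> \<rat>" for f r
  proof -
    obtain p q :: int where q: "q > 0" and pq: "r = of_int p / of_int q"
      by (rule Rats_cases'[OF r])
    have "of_int q * f r = f (of_int q *\<^sub>R r)" by (rule additive_of_int_scale[OF f(1), symmetric])
    also have "of_int q *\<^sub>R r = of_int p *\<^sub>R 1" using q pq by simp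
    also have "f \<dots> = of_int p" using additive_of_int_scale[OF f(1), of p 1] f(2) by simp
    finally have "f r * of_int q = r * of_int q" using q pq by (simp add: mult.commute)
    thus ?thesis using q by simp
  qed
  have "\<exists>f :: real \<Rightarrow> real. Modules.additive f \<and> (\<forall>x. f x \<in> \<rat>) \<and> f 1 = (1::real) \<and> (\<forall>a\<in>F. f a \<in> \<int> \<longrightarrow> a \<in> \<int>)"
    using assms
  proof (induction F rule: finite_induct)
    case empty
    show ?case using rational_functional(1) by simp
  next
    case (insert a F)
    then have "\<exists>f :: real \<Rightarrow> real. Modules.additive f \<and> (\<forall>x. f x \<in> \<rat>) \<and> f 1 = (1::real) \<and> (\<forall>a\<in>F. f a \<in> \<int> \<longrightarrow> a \<in> \<int>)"
      by blast
    then obtain f :: "real \<Rightarrow> real" where f: "Modules.additive f" "\<forall>x. f x \<in> \<rat>" "f 1 = (1::real)" "\<forall>a\<in>F. f a \<in> \<int> \<longrightarrow> a \<in> \<int>"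
      by (elim exE conjE)
    show ?case
    proof (cases "a \<notin> \<rat> \<and> f a \<in> \<int>")
      case False
      hence "f a \<in> \<int> \<longrightarrow> a \<in> \<int>" using rat[OF f(1,3)] by metis
      thus ?thesis using f by (metis insert_iff)
    next
      case True
      obtain g :: "real \<Rightarrow> real" where g: "Modules.additive g" "\<forall>x. g x \<in> \<rat>" "g 1 = (0::real)" "g a = 1"
        using rational_functional(2)[OF conjunct1[OF True]] by (elim exE conjE)
      define h where "h n x = f x + g x * inverse (real (Suc n))" for n x
      have lim: "(\<lambda>n. h n x) \<longlonglongrightarrow> f x + g x * 0" for x
        unfolding h_def by (intro tendsto_intros LIMSEQ_inverse_real_of_nat)
      have ev: "\<forall>\<^sub>F n in sequentially. h n b \<in> \<int> \<longrightarrow> b \<in> \<int>" if b: "b \<in> F" for b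
      proof (cases "f b \<in> \<int>")
        case True
        thus ?thesis using f(4) b by simp
      next
        case False
        have "\<forall>\<^sub>F n in sequentially. h n b \<in> - \<int>"
          by (rule topological_tendstoD[OF lim[of b]]) (use False closed_Ints in auto)
        thus ?thesis by eventually_elim simp
      qed
      have "\<forall>\<^sub>F n in sequentially. \<forall>b\<in>F. h n b \<in> \<int> \<longrightarrow> b \<in> \<int>"
        by (rule eventually_ball_finite[OF insert.hyps(1)]) (use ev in blast)
      then obtain n0 where n0: "\<And>n. n \<ge> n0 \<Longrightarrow> \<forall>b\<in>F. h n b \<in> \<int> \<longrightarrow> b \<in> \<int>"
        unfolding eventually_sequentially by blast
      \<comment> \<open>\<open>Suc n0\<close> instead of \<open>n0\<close> makes the added
        coefficient at most 1/2, so it is not an integer even for \<open>n0 = 0\<close>.\<close>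
      let ?n = "Suc n0"
      have "h ?n a \<notin> \<int>"
      proof
        assume "h ?n a \<in> \<int>"
        hence "h ?n a - f a \<in> \<int>" using True by (intro Ints_diff) auto
        hence "inverse (real (Suc ?n)) \<in> \<int>" by (simp add: h_def g(4))
        then obtain k where k: "inverse (real (Suc ?n)) = of_int k" by (rule Ints_cases)
        have "0 < inverse (real (Suc ?n))" "inverse (real (Suc ?n)) < 1" by (auto simp: field_simps)
        hence "0 < k" "k < 1" unfolding k by auto
        thus False by simp
      qed
      moreover have "Modules.additive (h ?n)" using f(1) g(1) by (simp add: Modules.additive_def h_def algebra_simps)
      moreover have "\<forall>x. h ?n x \<in> \<rat>" unfolding h_def using f(2) g(2) by (auto intro!: Rats_add Rats_mult Rats_inverse)
      moreover have "h ?n 1 = 1" using f(3) g(3) by (simp add: h_def)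
      moreover have "\<forall>b\<in>F. h ?n b \<in> \<int> \<longrightarrow> b \<in> \<int>" by (rule n0) simp
      moreover have "h ?n a \<in> \<int> \<longrightarrow> a \<in> \<int>" using calculation(1) by simp
      ultimately show ?thesis by (metis insert_iff)
    qed
  qed
  then obtain f :: "real \<Rightarrow> real" where "Modules.additive f" "\<forall>x. f x \<in> \<rat>" "f 1 = 1" "\<forall>a\<in>F. f a \<in> \<int> \<longrightarrow> a \<in> \<int>"
    by (elim exE conjE)
  thus ?thesis by (rule that)
qed

text \<open>The tiles at equally spaced points of the segment from 0 to \<open>v\<close> form a
  chain of lattice vectors with bounded steps. So on \<open>I\<close> the lattice is generated by
  vectors with coordinates of size at most 2.\<close>

lemma lattice_tiling_induct:
  assumes L: "lattice_tiling I L" and v: "v \<in> L"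
    and zero: "\<And>v. v \<in> L \<Longrightarrow> (\<And>i. i \<in> I \<Longrightarrow> v $ i = 0) \<Longrightarrow> P v"
    and step: "\<And>v w. v \<in> L \<Longrightarrow> w \<in> L \<Longrightarrow> P w \<Longrightarrow> (\<And>i. i \<in> I \<Longrightarrow> \<bar>v $ i - w $ i\<bar> \<le> 2) \<Longrightarrow> P v"
  shows "P v"
proof -
  obtain N where N: "N > 0" "\<And>i. \<bar>v $ i\<bar> \<le> real N"
  proof -
    obtain N where "infnorm v < real N" using reals_Archimedean2 by blast
    hence "\<bar>v $ i\<bar> \<le> real (Suc N)" for i using component_le_infnorm_cart[of v i] by simp
    thus ?thesis using that[of "Suc N"] by simp
  qed
  have main: "P u" if "u \<in> L" "\<And>i. i \<in> I \<Longrightarrow> u $ i \<le> real s * (v $ i / real N) \<and> real s * (v $ i / real N) < u $ i + 1" for u s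
    using that
  proof (induction s arbitrary: u)
    case 0
    have "u $ i = 0" if "i \<in> I" for i
      by (rule lattice_tilingD(3)[OF L 0(1) _ that]) (use 0(2) in force)
    thus ?case by (rule zero[OF 0(1)])
  next
    case (Suc s)
    obtain w where w: "w \<in> L" "\<forall>i\<in>I. w $ i \<le> real s * (v $ i / real N) \<and> real s * (v $ i / real N) < w $ i + 1"
      using lattice_tilingD(2)[OF L, of "\<lambda>i. real s * (v $ i / real N)"] by (elim bexE)
    have "P w" by (rule Suc.IH[OF w(1)]) (use w(2) in blast)
    thus ?case
    proof (rule step[OF Suc.prems(1) w(1)])
      fix i assume i: "i \<in> I"
      have "\<bar>v $ i / real N\<bar> \<le> 1" using N by simp
      moreover have "real (Suc s) * (v $ i / real N) = real s * (v $ i / real N) + v $ i / real N"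
        by (simp only: of_nat_Suc distrib_right mult_1_left add.commute)
      ultimately show "\<bar>u $ i - w $ i\<bar> \<le> 2" using Suc.prems(2)[OF i] w(2)[rule_format, OF i] by linarith
    qed
  qed
  have "real N * (v $ i / real N) = v $ i" for i using N(1) by simp
  thus ?thesis using main[OF v, of N] by simp
qed

text \<open>Two lattice vectors with equal floors differ by less than 1 in each coordinate and hence
  agree on \<open>I\<close>; and a bounded region admits only finitely many floors.\<close>

lemma lattice_tiling_finite_coordinates:
  assumes L: "lattice_tiling I L"
  shows "finite {v $ i | v i. v \<in> L \<and> i \<in> I \<and> (\<forall>i\<in>I. \<bar>v $ i\<bar> \<le> r)}"
proof -
  let ?V = "{v \<in> L. \<forall>i\<in>I. \<bar>v $ i\<bar> \<le> r}"
  let ?r = "\<lambda>v. \<lambda>i\<in>I. v $ i"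
  let ?h = "\<lambda>g. \<lambda>i\<in>I. \<lfloor>g i :: real\<rfloor>"
  have "?h ` ?r ` ?V \<subseteq> (\<Pi>\<^sub>E i\<in>I. {\<lfloor>- r\<rfloor>..\<lfloor>r\<rfloor>})"
  proof (rule subsetI, elim imageE)
    fix x g v assume x: "x = ?h g" "g = ?r v" "v \<in> ?V"
    have "\<lfloor>v $ i\<rfloor> \<in> {\<lfloor>- r\<rfloor>..\<lfloor>r\<rfloor>}" if "i \<in> I" for i
    proof -
      have "\<bar>v $ i\<bar> \<le> r" using x(3) that by blast
      thus ?thesis by (auto intro!: floor_mono)
    qed
    thus "x \<in> (\<Pi>\<^sub>E i\<in>I. {\<lfloor>- r\<rfloor>..\<lfloor>r\<rfloor>})" unfolding x(1,2) by simp
  qed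
  hence "finite (?h ` ?r ` ?V)" by (rule finite_subset) (simp add: finite_PiE)
  moreover have "inj_on ?h (?r ` ?V)"
  proof (rule inj_onI, elim imageE)
    fix x y u v assume *: "?h x = ?h y" "x = ?r u" "y = ?r v" "u \<in> ?V" "v \<in> ?V"
    have fl: "\<lfloor>u $ i\<rfloor> = \<lfloor>v $ i\<rfloor>" if "i \<in> I" for i
      using fun_cong[OF *(1), of i] that unfolding *(2,3) by simp
    have "(u - v) $ i = 0" if i: "i \<in> I" for i
    proof (rule lattice_tilingD(3)[OF L _ _ i])
      show "u - v \<in> L" by (rule add_subgroupD(2)[OF lattice_tilingD(1)[OF L]]) (use * in auto)
      show "\<bar>(u - v) $ j\<bar> < 1" if "j \<in> I" for j
        using fl[OF that] by (simp, linarith)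
    qed
    thus "x = y" unfolding *(2,3) by (intro restrict_ext) simp
  qed
  ultimately have fin: "finite (?r ` ?V)" by (rule finite_imageD)
  have "{v $ i | v i. v \<in> L \<and> i \<in> I \<and> (\<forall>i\<in>I. \<bar>v $ i\<bar> \<le> r)} \<subseteq> (\<Union>i\<in>I. (\<lambda>g. g i) ` ?r ` ?V)"
  proof
    fix t assume "t \<in> {v $ i | v i. v \<in> L \<and> i \<in> I \<and> (\<forall>i\<in>I. \<bar>v $ i\<bar> \<le> r)}"
    then obtain v i where vi: "t = v $ i" "v \<in> L" "i \<in> I" "\<forall>i\<in>I. \<bar>v $ i\<bar> \<le> r" by blast
    have "?r v \<in> ?r ` ?V" using vi by (intro imageI) simp
    moreover have "t = (?r v) i" using vi by simp
    ultimately show "t \<in> (\<Union>i\<in>I. (\<lambda>g. g i) ` ?r ` ?V)" using vi(3) by blast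
  qed
  thus ?thesis by (rule finite_subset) (intro finite_UN_I finite finite_imageI fin)
qed

section \<open>Rational lattice tilings\<close>

lemma common_denominator:
  assumes "finite S" "S \<subseteq> \<rat>"
  obtains D :: nat where "D > 0" "\<forall>s\<in>S. real D * s \<in> \<int>"
proof -
  have "\<exists>D::nat. D > 0 \<and> (\<forall>s\<in>S. real D * s \<in> \<int>)" using assms
  proof (induction S rule: finite_induct)
    case (insert s S)
    then obtain D :: nat where D: "D > 0" "\<forall>s\<in>S. real D * s \<in> \<int>" by auto
    obtain p q :: int where q: "q > 0" and pq: "s = of_int p / of_int q"
      by (rule Rats_cases'[of s]) (use insert.prems in auto)
    have "real (D * nat q) * t \<in> \<int>" if "t \<in> insert s S" for t
    proof (cases "t = s")
      case True
      have "real (D * nat q) * t = of_int (int D * p)" using q pq True by simp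
      thus ?thesis by (metis Ints_of_int)
    next
      case False
      hence "real D * t \<in> \<int>" using D(2) that by simp
      hence "real (nat q) * (real D * t) \<in> \<int>" by (rule Ints_mult[OF Ints_of_nat])
      thus ?thesis by (simp add: algebra_simps)
    qed
    thus ?case using D(1) q by (intro exI[of _ "D * nat q"]) auto
  qed (auto intro: exI[of _ 1])
  then obtain D :: nat where "D > 0" "\<forall>s\<in>S. real D * s \<in> \<int>" by (elim exE conjE)
  thus ?thesis by (rule that)
qed

lemma lattice_tiling_denominator:
  assumes L: "lattice_tiling I L" and rat: "\<And>v i. v \<in> L \<Longrightarrow> i \<in> I \<Longrightarrow> v $ i \<in> \<rat>"
  obtains D :: nat where "D > 0" "\<forall>v\<in>L. \<forall>i\<in>I. real D * v $ i \<in> \<int>"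
proof -
  let ?S = "{v $ i | v i. v \<in> L \<and> i \<in> I \<and> (\<forall>i\<in>I. \<bar>v $ i\<bar> \<le> 2)}"
  have "?S \<subseteq> \<rat>" using rat by auto
  then obtain D :: nat where D: "D > 0" "\<forall>s\<in>?S. real D * s \<in> \<int>"
    by (rule common_denominator[OF lattice_tiling_finite_coordinates[OF L]])
  have "\<forall>i\<in>I. real D * v $ i \<in> \<int>" if "v \<in> L" for v
  proof (rule lattice_tiling_induct[OF L that])
    fix v w assume vw: "v \<in> L" "w \<in> L" "\<forall>i\<in>I. real D * w $ i \<in> \<int>" "\<And>i. i \<in> I \<Longrightarrow> \<bar>v $ i - w $ i\<bar> \<le> 2"
    have "v - w \<in> L" by (rule add_subgroupD(2)[OF lattice_tilingD(1)[OF L] vw(1,2)])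
    hence "real D * (v - w) $ i \<in> \<int>" if "i \<in> I" for i using vw(4) that by (intro D(2)[rule_format]) force
    hence "real D * (v - w) $ i + real D * w $ i \<in> \<int>" if "i \<in> I" for i using vw(3) that by (intro Ints_add) auto
    thus "\<forall>i\<in>I. real D * v $ i \<in> \<int>" by (simp add: algebra_simps)
  qed simp
  hence "\<forall>v\<in>L. \<forall>i\<in>I. real D * v $ i \<in> \<int>" by (rule ballI)
  thus ?thesis by (rule that[OF D(1)])
qed

text \<open>Pigeonhole: as \<open>D\<close> clears denominators, the offset of \<open>n\<close>
  times a unit vector within its tile takes finitely many values. Two equal offsets give a lattice
  vector on the axis.\<close>

lemma lattice_tiling_axis_multiple:
  assumes L: "lattice_tiling I L" and D: "D > 0" "\<forall>v\<in>L. \<forall>i\<in>I. real D * v $ i \<in> \<int>" and i: "i \<in> I"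
  shows "\<exists>n::nat. n > 0 \<and> (\<exists>g\<in>L. \<forall>c\<in>I. g $ c = (if c = i then real n else 0))"
proof -
  define e where "e n c = (if c = i then real n else 0)" for n :: nat and c
  have "\<exists>v\<in>L. \<forall>c\<in>I. v $ c \<le> e n c \<and> e n c < v $ c + 1" for n by (rule lattice_tilingD(2)[OF L])
  then obtain a where a: "\<And>n. a n \<in> L" "\<And>n c. c \<in> I \<Longrightarrow> a n $ c \<le> e n c \<and> e n c < a n $ c + 1" by metis
  define r where "r n = (\<lambda>c\<in>I. \<lfloor>real D * (e n c - a n $ c)\<rfloor>)" for n
  have int: "real D * (e n c - a n $ c) \<in> \<int>" if "c \<in> I" for n c
  proof -
    have "real D * a n $ c \<in> \<int>" using D(2) a(1) that by blast
    moreover have "real D * e n c \<in> \<int>" by (simp add: e_def)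
    ultimately have "real D * e n c - real D * a n $ c \<in> \<int>" by (intro Ints_diff)
    thus ?thesis by (simp add: algebra_simps)
  qed
  have "range r \<subseteq> (\<Pi>\<^sub>E c\<in>I. {0..int D})"
  proof (rule subsetI, elim imageE)
    fix x n assume x: "x = r n"
    have "\<lfloor>real D * (e n c - a n $ c)\<rfloor> \<in> {0..int D}" if c: "c \<in> I" for c
    proof -
      have "0 \<le> e n c - a n $ c" "e n c - a n $ c \<le> 1" using a(2)[OF c, of n] by auto
      hence "0 \<le> real D * (e n c - a n $ c)" "real D * (e n c - a n $ c) \<le> real D * 1"
        by (simp_all only: mult_left_mono of_nat_0_le_iff mult_nonneg_nonneg)
      thus ?thesis by (simp add: floor_le_iff)
    qed
    thus "x \<in> (\<Pi>\<^sub>E c\<in>I. {0..int D})" unfolding x r_def by simp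
  qed
  hence "finite (range r)" by (rule finite_subset) (simp add: finite_PiE)
  hence "\<not> inj r" using finite_imageD infinite_UNIV_nat by blast
  then obtain n m where nm: "r n = r m" "n < m" unfolding inj_def by (metis linorder_neqE_nat)
  have diff: "(a m - a n) $ c = (if c = i then real (m - n) else 0)" if c: "c \<in> I" for c
  proof -
    have "\<lfloor>real D * (e n c - a n $ c)\<rfloor> = \<lfloor>real D * (e m c - a m $ c)\<rfloor>"
      using fun_cong[OF nm(1), of c] c by (simp add: r_def)
    hence "real D * (e n c - a n $ c) = real D * (e m c - a m $ c)" using int[OF c] by (metis of_int_floor)
    hence "a m $ c - a n $ c = e m c - e n c" using D(1) by simp
    thus ?thesis using nm(2) by (simp add: e_def of_nat_diff)
  qed
  have "a m - a n \<in> L" by (rule add_subgroupD(2)[OF lattice_tilingD(1)[OF L] a(1) a(1)])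
  hence "\<exists>g\<in>L. \<forall>c\<in>I. g $ c = (if c = i then real (m - n) else 0)"
    by (rule bexI[rotated]) (intro ballI diff)
  thus ?thesis using nm(2) by (intro exI[of _ "m - n"] conjI) simp_all
qed

lemma add_subgroup_sum:
  assumes "add_subgroup X" "\<And>i. i \<in> I \<Longrightarrow> f i \<in> X"
  shows "sum f I \<in> X"
proof (cases "finite I")
  case True
  thus ?thesis using assms(2)
    by (induction I rule: finite_induct) (use assms(1) in \<open>auto simp: add_subgroupD\<close>)
next
  case False
  thus ?thesis using add_subgroupD(1)[OF assms(1)] by simp
qed

lemma lattice_tiling_contains_multiples:
  fixes I :: "'i::finite set"
  assumes L: "lattice_tiling I L" and D: "D > 0" "\<forall>v\<in>L. \<forall>i\<in>I. real D * v $ i \<in> \<int>"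
  obtains q :: nat where "q > 1" "\<forall>z :: 'i \<Rightarrow> int. \<exists>g\<in>L. \<forall>c\<in>I. g $ c = real q * of_int (z c)"
proof -
  obtain n where n: "\<And>i. i \<in> I \<Longrightarrow> n i > (0::nat)"
    "\<And>i. i \<in> I \<Longrightarrow> \<exists>g\<in>L. \<forall>c\<in>I. g $ c = (if c = i then real (n i) else 0)"
    using lattice_tiling_axis_multiple[OF L D] by metis
  obtain g where g: "\<And>i. i \<in> I \<Longrightarrow> g i \<in> L" "\<And>i c. i \<in> I \<Longrightarrow> c \<in> I \<Longrightarrow> g i $ c = (if c = i then real (n i) else 0)"
    using n(2) by metis
  \<comment> \<open>The factor 2 keeps \<open>q\<close> above 1 even if all \<open>n i\<close> are
    1, so that \<open>q\<close> has a prime factor.\<close>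
  define q where "q = 2 * (\<Prod>i\<in>I. n i)"
  have "(\<Prod>i\<in>I. n i) > 0" using n(1) by (intro prod_pos) auto
  hence "q > 1" unfolding q_def by linarith
  moreover have "\<forall>z :: 'i \<Rightarrow> int. \<exists>g\<in>L. \<forall>c\<in>I. g $ c = real q * of_int (z c)"
  proof
    fix z :: "'i \<Rightarrow> int"
    define k where "k i = int (q div n i) * z i" for i
    have q: "real q = real (q div n i) * real (n i)" if "i \<in> I" for i
    proof -
      have "n i dvd q" unfolding q_def using that by (intro dvd_mult dvd_prodI) auto
      thus ?thesis by (metis dvd_div_mult_self of_nat_mult)
    qed
    let ?g = "\<Sum>i\<in>I. of_int (k i) *\<^sub>R g i"
    have "?g \<in> L"
      by (intro add_subgroup_sum add_subgroup_of_int lattice_tilingD(1)[OF L] g(1))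
    moreover have "?g $ c = real q * of_int (z c)" if c: "c \<in> I" for c
    proof -
      have "?g $ c = (\<Sum>i\<in>I. of_int (k i) * g i $ c)" by (simp add: sum_component)
      also have "\<dots> = (\<Sum>i\<in>I. if i = c then of_int (k c) * real (n c) else 0)"
        by (rule sum.cong) (use g(2) c in auto)
      also have "\<dots> = of_int (k c) * real (n c)" using c by simp
      also have "\<dots> = real q * of_int (z c)" using q[OF c] by (simp add: k_def)
      finally show ?thesis .
    qed
    ultimately show "\<exists>g\<in>L. \<forall>c\<in>I. g $ c = real q * of_int (z c)" by (intro bexI[of _ ?g]) auto
  qed
  ultimately show ?thesis by (rule that)
qed

lemma Ints_div_nat_iff:
  fixes q :: nat
  assumes "q > 0"
  shows "x / real q \<in> \<int> \<longleftrightarrow> (\<exists>z::int. x = real q * of_int z)"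
  using assms by (auto simp: Ints_def field_simps)

text \<open>A vector outside \<open>Q\<close> has an integral coordinate that is not divisible by
  \<open>q\<close>. Along the chain \<open>P k\<close> of divisors of \<open>q\<close> its
  divisibility breaks off at one step, which is one piece. There are as many pieces as prime factors
  in the index \<open>q ^ card I\<close>, as \<open>hajos_subgroups\<close> demands.\<close>

lemma hajos_rational:
  fixes I :: "'i::finite set"
  assumes L: "lattice_tiling I L" and I: "I \<noteq> {}" and rat: "\<And>v i. v \<in> L \<Longrightarrow> i \<in> I \<Longrightarrow> v $ i \<in> \<rat>"
  shows "\<exists>i\<in>I. \<forall>v\<in>L. v $ i \<in> \<int>"
proof -
  note sub = lattice_tilingD(1)[OF L]
  obtain D :: nat where D: "D > 0" "\<forall>v\<in>L. \<forall>i\<in>I. real D * v $ i \<in> \<int>"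
    by (rule lattice_tiling_denominator[OF L rat])
  obtain q :: nat where q: "q > 1" and mult: "\<forall>z :: 'i \<Rightarrow> int. \<exists>g\<in>L. \<forall>c\<in>I. g $ c = real q * of_int (z c)"
    by (rule lattice_tiling_contains_multiples[OF L D])
  have q0: "q > 0" "real q > 0" using q by auto
  define Q where "Q = {v \<in> L. \<forall>i\<in>I. v $ i / real q \<in> \<int>}"
  have subQ: "add_subgroup Q" unfolding add_subgroup_def
  proof (intro conjI ballI)
    show "0 \<in> Q" using add_subgroupD(1)[OF sub] by (simp add: Q_def)
    fix u v assume uv: "u \<in> Q" "v \<in> Q"
    hence "(u - v) $ i / real q \<in> \<int>" if "i \<in> I" for i
      using Ints_diff[of "u $ i / real q" "v $ i / real q"] that by (simp add: Q_def diff_divide_distrib)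
    thus "u - v \<in> Q" using uv add_subgroupD(2)[OF sub] by (simp add: Q_def)
  qed
  obtain ps where ps: "mset ps = prime_factorization q" using ex_mset by blast
  have prod_ps: "prod_list ps = q"
    using prod_mset_prime_factorization_nat[of q] q0 ps by (metis prod_mset_prod_list)
  have prime_ps: "prime (ps ! k)" if "k < length ps" for k
    using that ps by (metis in_prime_factors_imp_prime nth_mem set_mset_mset)
  define P where "P k = prod_list (take k ps)" for k
  have P_Suc: "P (Suc k) = ps ! k * P k" if "k < length ps" for k
    using that by (simp add: P_def take_Suc_conv_app_nth mult.commute)
  have P0: "P 0 = 1" and Plen: "P (length ps) = q" using prod_ps by (simp_all add: P_def)
  have Pdvd: "P k dvd q" for k
  proof -
    have "q = P k * prod_list (drop k ps)"
      unfolding P_def prod_ps[symmetric] by (metis append_take_drop_id prod_list.append)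
    thus ?thesis by simp
  qed
  hence Ppos: "P k > 0" for k using q0 by (metis dvd_pos_nat)
  have lps: "length ps > 0" using prod_ps q by (cases ps) auto
  \<comment> \<open>A tile contains exactly one integer point, the coordinatewise ceiling of its
    corner; modulo \<open>q\<close> these points label the cosets of \<open>Q\<close>.\<close>
  define h where "h v = (\<lambda>i\<in>I. \<lceil>v $ i\<rceil> mod int q)" for v :: "real ^ 'i"
  have h_iff: "h v = h w \<longleftrightarrow> v - w \<in> Q" if vw: "v \<in> L" "w \<in> L" for v w
  proof
    assume eq: "h v = h w"
    have "\<exists>z. \<lceil>v $ i\<rceil> - \<lceil>w $ i\<rceil> = int q * z" if "i \<in> I" for i
    proof -
      have "\<lceil>v $ i\<rceil> mod int q = \<lceil>w $ i\<rceil> mod int q" using fun_cong[OF eq, of i] that by (simp add: h_def)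
      thus ?thesis by (metis mod_eq_dvd_iff dvd_def)
    qed
    then obtain z where z: "\<And>i. i \<in> I \<Longrightarrow> \<lceil>v $ i\<rceil> - \<lceil>w $ i\<rceil> = int q * z i" by metis
    obtain g where g: "g \<in> L" "\<And>c. c \<in> I \<Longrightarrow> g $ c = real q * of_int (z c)" using mult by blast
    have "(v - w - g) $ i = 0" if i: "i \<in> I" for i
    proof (rule lattice_tilingD(3)[OF L _ _ i])
      show "v - w - g \<in> L" by (intro add_subgroupD(2)[OF sub] vw g)
      fix j assume j: "j \<in> I"
      have "of_int \<lceil>v $ j\<rceil> - of_int \<lceil>w $ j\<rceil> = real q * of_int (z j)"
        using z[OF j] by (metis of_int_diff of_int_mult of_int_of_nat_eq)
      moreover have "of_int \<lceil>v $ j\<rceil> - 1 < v $ j" "v $ j \<le> of_int \<lceil>v $ j\<rceil>"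
        "of_int \<lceil>w $ j\<rceil> - 1 < w $ j" "w $ j \<le> of_int \<lceil>w $ j\<rceil>" by linarith+
      ultimately show "\<bar>(v - w - g) $ j\<bar> < 1" using g(2)[OF j] by simp linarith
    qed
    hence "(v - w) $ i = real q * of_int (z i)" if "i \<in> I" for i using g(2)[OF that] that by simp
    hence "(v - w) $ i / real q \<in> \<int>" if "i \<in> I" for i using that q0 by simp
    thus "v - w \<in> Q" unfolding Q_def using add_subgroupD(2)[OF sub vw] by simp
  next
    assume "v - w \<in> Q"
    hence "\<exists>z::int. v $ i - w $ i = real q * of_int z" if "i \<in> I" for i
      using that Ints_div_nat_iff[OF q0(1), of "v $ i - w $ i"] by (simp add: Q_def)
    then obtain z where z: "\<And>i. i \<in> I \<Longrightarrow> v $ i - w $ i = real q * of_int (z i)" by metis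
    have "\<lceil>v $ i\<rceil> mod int q = \<lceil>w $ i\<rceil> mod int q" if "i \<in> I" for i
    proof -
      have "v $ i = w $ i + of_int (int q * z i)" using z[OF that] by simp
      hence "\<lceil>v $ i\<rceil> = \<lceil>w $ i\<rceil> + int q * z i" by (metis ceiling_add_of_int)
      thus ?thesis by simp
    qed
    thus "h v = h w" unfolding h_def by (intro restrict_ext)
  qed
  have "h ` L = (\<Pi>\<^sub>E i\<in>I. {0..<int q})"
  proof (intro equalityI subsetI)
    fix x assume x: "x \<in> (\<Pi>\<^sub>E i\<in>I. {0..<int q})"
    obtain v where v: "v \<in> L" "\<forall>i\<in>I. v $ i \<le> of_int (x i) \<and> of_int (x i) < v $ i + 1"
      using lattice_tilingD(2)[OF L, of "\<lambda>i. of_int (x i)"] by (elim bexE)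
    have "h v i = x i" for i
    proof (cases "i \<in> I")
      case True
      have "\<lceil>v $ i\<rceil> = x i" using v(2) True by (intro ceiling_unique) force+
      moreover have "x i \<in> {0..<int q}" using x True by blast
      ultimately show ?thesis using True by (simp add: h_def)
    next
      case False
      thus ?thesis using PiE_arb[OF x False] by (simp add: h_def)
    qed
    hence "x = h v" by auto
    thus "x \<in> h ` L" using v(1) by blast
  next
    fix x assume "x \<in> h ` L"
    then obtain v where "x = h v" by blast
    thus "x \<in> (\<Pi>\<^sub>E i\<in>I. {0..<int q})" using q0 by (simp add: h_def)
  qed
  moreover have "card (\<Pi>\<^sub>E i\<in>I. {0..<int q}) = q ^ card I" by (simp add: card_PiE)
  ultimately have cardLQ: "card (cosets L Q) = q ^ card I" using card_cosets[OF subQ h_iff] by simp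
  hence finLQ: "finite (cosets L Q)" using q0 by (metis card_ge_0_finite zero_less_power)
  have om: "omega_index L Q = card I * length ps"
  proof -
    have "size (prime_factorization (q ^ m)) = m * length ps" for m
    proof (induction m)
      case (Suc m)
      have "prime_factorization (q ^ Suc m) = prime_factorization q + prime_factorization (q ^ m)"
        using q0 by (simp add: prime_factorization_mult)
      thus ?case using Suc ps by (metis add_mult_distrib mult_Suc size_mset size_union)
    qed simp
    thus ?thesis unfolding omega_index_def cardLQ .
  qed
  define B where "B = I \<times> {..<length ps}"
  define l where "l b v = v $ (fst b) / real (P (Suc (snd b)))" for b :: "'i \<times> nat" and v :: "real ^ 'i"
  have "\<exists>b\<in>B. \<forall>v\<in>L. real (ps ! snd b) * l b v \<in> \<int>"
  proof (rule hajos_subgroups[OF sub subQ _ finLQ, where N = "\<lambda>b. D * P (Suc (snd b))"])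
    show "Q \<subseteq> L" by (auto simp: Q_def)
    show "finite B" by (simp add: B_def)
    show "B \<noteq> {}" using I lps by (auto simp: B_def)
    show "Modules.additive (l b)" for b by (simp add: Modules.additive_def l_def add_divide_distrib)
    show "prime (ps ! snd b)" if "b \<in> B" for b using that prime_ps by (auto simp: B_def)
    show "D * P (Suc (snd b)) > 0" for b using D(1) Ppos by simp
    show "real (D * P (Suc (snd b))) * l b v \<in> \<int>" if "b \<in> B" "v \<in> L" for b v
    proof -
      have "real (D * P (Suc (snd b))) * l b v = real D * v $ fst b" using Ppos[of "Suc (snd b)"] by (simp add: l_def)
      moreover have "fst b \<in> I" using that by (auto simp: B_def)
      moreover have "real D * v $ fst b \<in> \<int>" using D(2) that(2) calculation(2) by blast
      ultimately show ?thesis by (simp only:)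
    qed
    show "l b v \<in> \<int>" if "b \<in> B" "v \<in> Q" for b v
    proof -
      obtain m where m: "q = P (Suc (snd b)) * m" using Pdvd[of "Suc (snd b)"] by blast
      have "fst b \<in> I" using that by (auto simp: B_def)
      hence "v $ fst b / real q \<in> \<int>" using that(2) by (simp add: Q_def)
      hence "real m * (v $ fst b / real q) \<in> \<int>" by (intro Ints_mult) auto
      moreover have "m > 0" using m q0 by (cases m) auto
      ultimately show ?thesis using Ppos[of "Suc (snd b)"] by (simp add: l_def m)
    qed
    show "card B \<le> omega_index L Q" by (simp add: om B_def card_cartesian_product)
    show "L - Q \<subseteq> (\<Union>b\<in>B. cover_piece (ps ! snd b) 0 (l b))"
    proof
      fix v assume v: "v \<in> L - Q"
      \<comment> \<open>If all integral coordinates of \<open>v\<close> were divisible by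
        \<open>q\<close>, a lattice vector \<open>g\<close> would cancel them without making other
        coordinates integral, and \<open>keller\<close> would apply to \<open>v - g\<close>.\<close>
      have "\<exists>i\<in>I. v $ i \<in> \<int> \<and> v $ i / real q \<notin> \<int>"
      proof (rule ccontr)
        assume no: "\<not> (\<exists>i\<in>I. v $ i \<in> \<int> \<and> v $ i / real q \<notin> \<int>)"
        have "\<exists>z::int. (v $ i \<in> \<int> \<longrightarrow> v $ i = real q * of_int z)" if "i \<in> I" for i
          using no that Ints_div_nat_iff[OF q0(1), of "v $ i"] by blast
        then obtain z where z: "\<And>i. i \<in> I \<Longrightarrow> v $ i \<in> \<int> \<Longrightarrow> v $ i = real q * of_int (z i)" by metis
        obtain g where g: "g \<in> L" "\<And>c. c \<in> I \<Longrightarrow> g $ c = real q * of_int (z c)" using mult by blast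
        have "(v - g) $ i = 0" if i: "i \<in> I" for i
        proof (rule keller[OF L _ _ i])
          show "v - g \<in> L" using v g(1) by (intro add_subgroupD(2)[OF sub]) auto
          fix j assume j: "j \<in> I" "(v - g) $ j \<in> \<int>"
          have "real q * of_int (z j) \<in> \<int>" by simp
          hence "(v - g) $ j + g $ j \<in> \<int>" using j(2) g(2)[OF j(1)] by (intro Ints_add) auto
          hence "v $ j \<in> \<int>" by simp
          thus "(v - g) $ j = 0" using z[OF j(1)] g(2)[OF j(1)] by simp
        qed
        hence "v $ i / real q \<in> \<int>" if "i \<in> I" for i using that g(2)[OF that] q0 by simp
        thus False using v by (simp add: Q_def)
      qed
      then obtain i where i: "i \<in> I" "v $ i / real (P 0) \<in> \<int>" "v $ i / real (P (length ps)) \<notin> \<int>"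
        by (auto simp: P0 Plen)
      have "\<exists>k<length ps. v $ i / real (P k) \<in> \<int> \<and> v $ i / real (P (Suc k)) \<notin> \<int>"
      proof (rule ccontr)
        assume no: "\<not> (\<exists>k<length ps. v $ i / real (P k) \<in> \<int> \<and> v $ i / real (P (Suc k)) \<notin> \<int>)"
        have "k \<le> length ps \<Longrightarrow> v $ i / real (P k) \<in> \<int>" for k
        proof (induction k)
          case 0 show ?case by (rule i(2))
        next
          case (Suc k)
          thus ?case using no by (meson Suc_le_lessD less_imp_le)
        qed
        thus False using i(3) by blast
      qed
      then obtain k where k: "k < length ps" "v $ i / real (P k) \<in> \<int>" "v $ i / real (P (Suc k)) \<notin> \<int>" by blast
      have "real (ps ! k) * (v $ i / real (P (Suc k))) = v $ i / real (P k)"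
        using P_Suc[OF k(1)] Ppos[of k] prime_gt_0_nat[OF prime_ps[OF k(1)]] by simp
      hence "v \<in> cover_piece (ps ! snd (i, k)) 0 (l (i, k))" using k by (simp add: cover_piece_def l_def)
      moreover have "(i, k) \<in> B" using i(1) k(1) by (simp add: B_def)
      ultimately show "v \<in> (\<Union>b\<in>B. cover_piece (ps ! snd b) 0 (l b))" by blast
    qed
  qed
  then obtain i k where ik: "i \<in> I" "k < length ps" "\<And>v. v \<in> L \<Longrightarrow> real (ps ! k) * l (i, k) v \<in> \<int>"
    by (auto simp: B_def)
  have "v $ i \<in> \<int>" if "v \<in> L" for v
  proof -
    have "real (ps ! k) * l (i, k) v = v $ i / real (P k)"
      using P_Suc[OF ik(2)] Ppos[of k] prime_gt_0_nat[OF prime_ps[OF ik(2)]] by (simp add: l_def)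
    hence "real (P k) * (v $ i / real (P k)) \<in> \<int>" using ik(3)[OF that] by (intro Ints_mult) auto
    thus ?thesis using Ppos[of k] by simp
  qed
  thus ?thesis using ik(1) by blast
qed

text \<open>A failure in every coordinate is witnessed by finitely many non-integral reals; a
  rational functional that keeps them non-integral carries the failure over to a rational
  lattice.\<close>

theorem hajos:
  fixes I :: "'i::finite set"
  assumes L: "lattice_tiling I L" and I: "I \<noteq> {}"
  shows "\<exists>i\<in>I. \<forall>v\<in>L. v $ i \<in> \<int>"
proof (rule ccontr)
  assume "\<not> ?thesis"
  then obtain v where v: "\<And>i. i \<in> I \<Longrightarrow> v i \<in> L" "\<And>i. i \<in> I \<Longrightarrow> v i $ i \<notin> \<int>" by metis
  obtain f where f: "Modules.additive f" "\<forall>x. f x \<in> \<rat>" "f 1 = (1::real)"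
    "\<forall>a\<in>(\<lambda>i. v i $ i) ` I. f a \<in> \<int> \<longrightarrow> a \<in> \<int>"
    by (rule rational_functional_finite[of "(\<lambda>i. v i $ i) ` I"]) simp
  let ?F = "\<lambda>v. \<chi> i. f (v $ i)"
  have "\<exists>i\<in>I. \<forall>v\<in>?F ` L. v $ i \<in> \<int>"
    by (rule hajos_rational[OF lattice_tiling_additive_image[OF L f(1,3)] I]) (use f(2) in auto)
  then obtain i where i: "i \<in> I" "\<forall>v\<in>L. ?F v $ i \<in> \<int>" by blast
  hence "f (v i $ i) \<in> \<int>" using v(1) by simp
  thus False using f(4) i(1) v(2) by blast
qed

text \<open>Where the integral coordinate \<open>i0\<close> vanishes, the tiling induces a tiling
  with one coordinate less, and \<open>hajos\<close> applies again. Smaller rank means chosen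
  earlier.\<close>

theorem hajos_flag:
  fixes I :: "'i::finite set"
  assumes "lattice_tiling I L"
  shows "\<exists>rk :: 'i \<Rightarrow> nat. inj_on rk I \<and> (\<forall>i\<in>I.
    (\<forall>v\<in>L. (\<forall>c\<in>I. rk c < rk i \<longrightarrow> v $ c = 0) \<longrightarrow> v $ i \<in> \<int>) \<and>
    (\<exists>b\<in>L. b $ i = 1 \<and> (\<forall>c\<in>I. rk c < rk i \<longrightarrow> b $ c = 0)))"
  using assms
proof (induction "card I" arbitrary: I L)
  case 0
  thus ?case by simp
next
  case (Suc n)
  note L = Suc.prems
  have "I \<noteq> {}" using Suc.hyps(2) by auto
  then obtain i0 where i0: "i0 \<in> I" "\<And>v. v \<in> L \<Longrightarrow> v $ i0 \<in> \<int>" using hajos[OF L] by blast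
  let ?L = "{v \<in> L. v $ i0 = 0}"
  let ?I = "I - {i0}"
  note sub = lattice_tilingD(1)[OF L]
  \<comment> \<open>Since the coordinate \<open>i0\<close> is integral, a tile over an integer
    \<open>k\<close> must start at \<open>k\<close>.\<close>
  have corner: "v $ i0 = of_int k" if vk: "v \<in> L" "v $ i0 \<le> of_int k" "of_int k < v $ i0 + 1" for v k
  proof -
    obtain m where m: "v $ i0 = of_int m" using i0(2)[OF vk(1)] by (rule Ints_cases)
    have "m \<le> k" "k < m + 1" using vk(2,3) unfolding m by linarith+
    thus ?thesis using m by simp
  qed
  have L': "lattice_tiling ?I ?L" unfolding lattice_tiling_def
  proof (intro conjI allI ballI impI)
    show "add_subgroup ?L" using sub by (auto simp: add_subgroup_def)
    fix p :: "'i \<Rightarrow> real"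
    obtain v where v: "v \<in> L" "\<forall>i\<in>I. v $ i \<le> (p(i0 := 0)) i \<and> (p(i0 := 0)) i < v $ i + 1"
      using lattice_tilingD(2)[OF L, of "p(i0 := 0)"] by (elim bexE)
    have "v $ i0 = 0" using corner[OF v(1), of 0] v(2)[rule_format, OF i0(1)] by simp
    moreover have "v $ i \<le> p i \<and> p i < v $ i + 1" if "i \<in> ?I" for i using v(2)[rule_format, of i] that by simp
    ultimately show "\<exists>v\<in>?L. \<forall>i\<in>?I. v $ i \<le> p i \<and> p i < v $ i + 1" using v(1) by (intro bexI[of _ v]) auto
  next
    fix v i assume v: "v \<in> ?L" "\<forall>i\<in>?I. \<bar>v $ i\<bar> < 1" "i \<in> ?I"
    show "v $ i = 0"
    proof (rule lattice_tilingD(3)[OF L])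
      show "\<bar>v $ j\<bar> < 1" if "j \<in> I" for j using v that by (cases "j = i0") auto
    qed (use v in auto)
  qed
  have "n = card ?I" using Suc.hyps(2) i0(1) by simp
  from Suc.hyps(1)[OF this L'] obtain rk :: "'i \<Rightarrow> nat" where rk: "inj_on rk ?I"
    "\<forall>i\<in>?I. (\<forall>v\<in>?L. (\<forall>c\<in>?I. rk c < rk i \<longrightarrow> v $ c = 0) \<longrightarrow> v $ i \<in> \<int>) \<and>
      (\<exists>b\<in>?L. b $ i = 1 \<and> (\<forall>c\<in>?I. rk c < rk i \<longrightarrow> b $ c = 0))" by (elim exE conjE)
  define rk' where "rk' c = (if c = i0 then 0 else Suc (rk c))" for c
  have "inj_on rk' I" using rk(1) by (auto simp: inj_on_def rk'_def)
  moreover have "(\<forall>v\<in>L. (\<forall>c\<in>I. rk' c < rk' i \<longrightarrow> v $ c = 0) \<longrightarrow> v $ i \<in> \<int>) \<and>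
    (\<exists>b\<in>L. b $ i = 1 \<and> (\<forall>c\<in>I. rk' c < rk' i \<longrightarrow> b $ c = 0))" if i: "i \<in> I" for i
  proof (cases "i = i0")
    case True
    obtain v where v: "v \<in> L" "\<forall>i\<in>I. v $ i \<le> (if i = i0 then 1 else 0) \<and> (if i = i0 then 1 else 0) < v $ i + 1"
      using lattice_tilingD(2)[OF L, of "\<lambda>i. if i = i0 then 1 else 0"] by (elim bexE)
    have "v $ i0 = 1" using corner[OF v(1), of 1] v(2)[rule_format, OF i0(1)] by simp
    thus ?thesis using v(1) i0(2) True by (auto simp: rk'_def)
  next
    case False
    hence i': "i \<in> ?I" using i by simp
    obtain b where b: "b \<in> ?L" "b $ i = 1" "\<forall>c\<in>?I. rk c < rk i \<longrightarrow> b $ c = 0" using rk(2) i' by blast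
    have "b $ c = 0" if "c \<in> I" "rk' c < rk' i" for c
      using that b False by (cases "c = i0") (auto simp: rk'_def)
    moreover have "v $ i \<in> \<int>" if v: "v \<in> L" "\<forall>c\<in>I. rk' c < rk' i \<longrightarrow> v $ c = 0" for v
    proof -
      have "v \<in> ?L" using v i0(1) False by (simp add: rk'_def)
      moreover have "\<forall>c\<in>?I. rk c < rk i \<longrightarrow> v $ c = 0" using v(2) False by (simp add: rk'_def)
      ultimately show ?thesis using rk(2) i' by blast
    qed
    ultimately show ?thesis using b by blast
  qed
  ultimately show ?case by (intro exI[of _ rk']) blast
qed

section \<open>Limits of lattices along ultrafilters\<close>

definition ultrafilter :: "'a filter \<Rightarrow> bool" where
  "ultrafilter U \<longleftrightarrow> U \<noteq> bot \<and> (\<forall>P. eventually P U \<or> eventually (\<lambda>x. \<not> P x) U)"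

text \<open>Zorn's lemma for the reversed order. The infimum of a chain of proper filters is proper
  because the chain is a filter base; a minimal proper filter equals its restriction to
  \<open>P\<close> whenever that is proper, so it decides \<open>P\<close>.\<close>

lemma ultrafilter_below:
  fixes F :: "'a filter"
  assumes F: "F \<noteq> bot"
  obtains U where "ultrafilter U" "U \<le> F"
proof -
  define A where "A = {G. G \<noteq> bot \<and> G \<le> F}"
  have "\<exists>m\<in>A. \<forall>a\<in>A. a \<le> m \<longrightarrow> a = m"
  proof (rule predicate_Zorn[of A "\<lambda>x y. y \<le> x"])
    show "partial_order_on A (relation_of (\<lambda>x y. y \<le> x) A)"
      by (rule partial_order_on_relation_ofI) auto
    fix C assume C: "C \<in> Chains (relation_of (\<lambda>x y. y \<le> x) A)"
    have CA: "C \<subseteq> A" using C by (auto simp: Chains_def relation_of_def)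
    have tot: "x \<le> y \<or> y \<le> x" if "x \<in> C" "y \<in> C" for x y
      using C that by (auto simp: Chains_def relation_of_def)
    show "\<exists>u\<in>A. \<forall>a\<in>C. u \<le> a"
    proof (cases "C = {}")
      case True
      thus ?thesis using F by (auto simp: A_def)
    next
      case False
      have base: "\<exists>x\<in>C. x \<le> inf G H" if "G \<in> C" "H \<in> C" for G H
        using tot[OF that] that by (metis inf.absorb1 inf.absorb2 order_refl)
      have "eventually (\<lambda>x. False) (Inf C) \<longleftrightarrow> (\<exists>b\<in>C. eventually (\<lambda>x. False) b)"
        by (rule eventually_Inf_base[OF False base])
      hence "Inf C \<noteq> bot" using CA by (auto simp: A_def trivial_limit_def)
      moreover obtain G where "G \<in> C" using False by blast
      hence "Inf C \<le> F" using CA by (metis (no_types, lifting) A_def Inf_lower mem_Collect_eq order_trans subsetD)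
      ultimately show ?thesis by (intro bexI[of _ "Inf C"]) (auto simp: A_def Inf_lower)
    qed
  qed
  then obtain U where U: "U \<in> A" "\<forall>a\<in>A. a \<le> U \<longrightarrow> a = U" by blast
  have "eventually P U \<or> eventually (\<lambda>x. \<not> P x) U" for P
  proof (cases "inf U (principal {x. P x}) = bot")
    case True
    hence "eventually (\<lambda>x. \<not> P x) U" by (simp add: trivial_limit_def eventually_inf_principal)
    thus ?thesis by simp
  next
    case False
    hence "inf U (principal {x. P x}) \<in> A" using U(1) by (auto simp: A_def intro: le_infI1)
    hence "inf U (principal {x. P x}) = U" using U(2) by simp
    hence "U \<le> principal {x. P x}" by (metis inf_le2)
    thus ?thesis by (simp add: le_principal)
  qed
  hence "ultrafilter U" using U(1) by (simp add: ultrafilter_def A_def)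
  moreover have "U \<le> F" using U(1) by (simp add: A_def)
  ultimately show ?thesis by (rule that)
qed

text \<open>Compactness yields a cluster point, and along an ultrafilter a cluster point is a
  limit.\<close>

lemma ultrafilter_tendsto:
  fixes f :: "'a \<Rightarrow> 'b::heine_borel"
  assumes U: "ultrafilter U" and K: "bounded K" and ev: "eventually (\<lambda>j. f j \<in> K) U"
  obtains l where "(f \<longlongrightarrow> l) U"
proof -
  have "compact (closure K)" using K by (simp add: compact_closure)
  moreover have "filtermap f U \<noteq> bot" using U by (simp add: ultrafilter_def filtermap_bot_iff)
  moreover have "eventually (\<lambda>x. x \<in> closure K) (filtermap f U)"
    unfolding eventually_filtermap using ev by (rule eventually_mono) (use closure_subset in auto)
  ultimately obtain l where l: "inf (nhds l) (filtermap f U) \<noteq> bot" unfolding compact_filter by blast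
  have "(f \<longlongrightarrow> l) U"
  proof (rule topological_tendstoI)
    fix S assume S: "open S" "l \<in> S"
    show "eventually (\<lambda>x. f x \<in> S) U"
    proof (rule ccontr)
      assume "\<not> ?thesis"
      hence "eventually (\<lambda>x. f x \<notin> S) U" using U unfolding ultrafilter_def by blast
      hence "eventually (\<lambda>y. y \<notin> S) (filtermap f U)" by (simp add: eventually_filtermap)
      hence "eventually (\<lambda>y. y \<notin> S) (inf (nhds l) (filtermap f U))" by (rule filter_leD[OF inf_le2])
      moreover have "eventually (\<lambda>y. y \<in> S) (nhds l)" using S by (rule eventually_nhds_in_open)
      hence "eventually (\<lambda>y. y \<in> S) (inf (nhds l) (filtermap f U))" by (rule filter_leD[OF inf_le1])
      ultimately have "eventually (\<lambda>y. False) (inf (nhds l) (filtermap f U))" by eventually_elim simp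
      thus False using l by (simp add: trivial_limit_def)
    qed
  qed
  thus ?thesis by (rule that)
qed

section \<open>Volume arguments of Blichfeldt and Minkowski\<close>

lemma emeasure_lborel_shift:
  fixes c :: "'a::euclidean_space"
  assumes "S \<in> sets borel"
  shows "emeasure lborel {x. x + c \<in> S} = emeasure lborel S"
proof -
  have "emeasure lborel S = emeasure (distr lborel borel ((+) c)) S" by (simp add: lborel_distr_plus)
  also have "\<dots> = emeasure lborel ((+) c -` S \<inter> space lborel)" by (rule emeasure_distr) (use assms in auto)
  also have "(+) c -` S \<inter> space lborel = {x. x + c \<in> S}" by (auto simp: add.commute)
  finally show ?thesis by simp
qed

text \<open>The part of \<open>S\<close> in each translate of \<open>F\<close> is moved back into
  \<open>F\<close>. If no two points of \<open>S\<close> differ by an element of \<open>G\<close>,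
  the moved parts are disjoint, and \<open>S\<close> has at most the measure of \<open>F\<close>.
  The translates of \<open>F\<close> may overlap, so a closed box can serve.\<close>

lemma blichfeldt:
  fixes G :: "'a::euclidean_space set"
  assumes G: "add_subgroup G" "countable G" and F: "F \<in> sets borel" "emeasure lborel F \<le> 1"
    and cov: "\<And>x. \<exists>g\<in>G. x - g \<in> F" and S: "S \<in> sets borel" "emeasure lborel S > 1"
  shows "\<exists>a\<in>S. \<exists>b\<in>S. a \<noteq> b \<and> a - b \<in> G"
proof (rule ccontr)
  assume no: "\<not> ?thesis"
  have ne: "G \<noteq> {}" using add_subgroupD(1)[OF G(1)] by auto
  define g where "g = from_nat_into G"
  have gG: "g i \<in> G" for i unfolding g_def by (rule from_nat_into[OF ne])
  define A where "A i = {x \<in> S. x - g i \<in> F}" for i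
  have meas_shift: "{x. x + c \<in> B} \<in> sets borel" if "B \<in> sets borel" for B and c :: 'a
  proof -
    have "(\<lambda>x. x + c) -` B \<inter> space borel \<in> sets borel" by (rule measurable_sets[OF _ that]) simp
    thus ?thesis by (simp add: vimage_def)
  qed
  have A: "A i \<in> sets borel" for i
  proof -
    have "A i = S \<inter> {x. x + (- g i) \<in> F}" by (auto simp: A_def)
    thus ?thesis using sets.Int[OF S(1) meas_shift[OF F(1), of "- g i"]] by simp
  qed
  have UA: "(\<Union>i. A i) = S"
  proof
    show "S \<subseteq> (\<Union>i. A i)"
    proof
      fix x assume x: "x \<in> S"
      obtain h where "h \<in> G" "x - h \<in> F" using cov by blast
      moreover obtain i where "g i = h" unfolding g_def using from_nat_into_surj[OF G(2) \<open>h \<in> G\<close>] by blast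
      ultimately show "x \<in> (\<Union>i. A i)" using x by (auto simp: A_def)
    qed
  qed (auto simp: A_def)
  define T where "T i = {x. x + g i \<in> disjointed A i}" for i
  have dA: "disjointed A i \<in> sets borel" for i
    using sets.range_disjointed_sets[of A borel] A by auto
  have T: "T i \<in> sets borel" for i unfolding T_def by (rule meas_shift[OF dA])
  have "disjoint_family T" unfolding disjoint_family_on_def
  proof (intro ballI impI, rule ccontr)
    fix i j :: nat assume ij: "i \<noteq> j" "T i \<inter> T j \<noteq> {}"
    then obtain x where x: "x + g i \<in> disjointed A i" "x + g j \<in> disjointed A j" by (auto simp: T_def)
    hence "x + g i \<in> S" "x + g j \<in> S" using disjointed_subset[of A] by (auto simp: A_def)
    moreover have "x + g i \<noteq> x + g j"
      using disjoint_family_disjointed[of A] ij(1) x unfolding disjoint_family_on_def by (metis UNIV_I disjoint_iff)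
    moreover have "(x + g i) - (x + g j) \<in> G" using add_subgroupD(2)[OF G(1) gG gG, of i j] by simp
    ultimately show False using no by blast
  qed
  have "emeasure lborel S = emeasure lborel (\<Union>i. disjointed A i)" by (simp add: UN_disjointed_eq UA)
  also have "\<dots> = (\<Sum>i. emeasure lborel (disjointed A i))"
    by (rule suminf_emeasure[symmetric]) (use dA disjoint_family_disjointed in auto)
  also have "\<dots> = (\<Sum>i. emeasure lborel (T i))" unfolding T_def using emeasure_lborel_shift[OF dA] by simp
  also have "\<dots> = emeasure lborel (\<Union>i. T i)"
    by (rule suminf_emeasure) (use T \<open>disjoint_family T\<close> in auto)
  also have "\<dots> \<le> emeasure lborel F"
  proof (rule emeasure_mono)
    show "(\<Union>i. T i) \<subseteq> F"
    proof
      fix x assume "x \<in> (\<Union>i. T i)"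
      then obtain i where "x + g i \<in> A i" using disjointed_subset[of A] by (auto simp: T_def)
      thus "x \<in> F" by (simp add: A_def)
    qed
  qed (use F in simp)
  finally show False using F(2) S(2) by simp
qed

lemma emeasure_box_cart:
  fixes a :: "real ^ 'i::finite"
  assumes "\<And>i. a $ i \<le> b $ i"
  shows "emeasure lborel (box a b) = ennreal (\<Prod>i\<in>UNIV. b $ i - a $ i)"
    "emeasure lborel (cbox a b) = ennreal (\<Prod>i\<in>UNIV. b $ i - a $ i)"
proof -
  have ne: "cbox a b \<noteq> {}" using assms by (auto simp: interval_eq_empty_cart not_less)
  have "emeasure lborel (cbox a b) = ennreal (measure lborel (cbox a b))"
    by (rule emeasure_eq_ennreal_measure) (simp add: emeasure_lborel_cbox_eq)
  also have "measure lborel (cbox a b) = (\<Prod>i\<in>UNIV. b $ i - a $ i)" by (rule content_cbox_cart[OF ne])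
  finally show c: "emeasure lborel (cbox a b) = ennreal (\<Prod>i\<in>UNIV. b $ i - a $ i)" .
  show "emeasure lborel (box a b) = ennreal (\<Prod>i\<in>UNIV. b $ i - a $ i)"
    unfolding c[symmetric] emeasure_lborel_box_eq emeasure_lborel_cbox_eq ..
qed

text \<open>Blichfeldt for a cube of side \<open>e\<close> at 0 together with a small cube of side
  \<open>h\<close> at \<open>p\<close>. Packing forbids two points in the same cube, so a lattice
  vector leads from one cube to the other and thus lies close to \<open>p\<close>.\<close>

lemma packing_almost_covers:
  fixes G :: "(real ^ 'i::finite) set"
  assumes G: "add_subgroup G" "countable G" and F: "F \<in> sets borel" "emeasure lborel F \<le> 1"
    and cov: "\<And>x. \<exists>g\<in>G. x - g \<in> F"
    and pack: "\<And>g. g \<in> G \<Longrightarrow> (\<And>i. \<bar>g $ i\<bar> < e) \<Longrightarrow> g = 0"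
    and e: "0 < h" "h \<le> e" "e \<le> 1" "e ^ CARD('i) + h ^ CARD('i) > 1"
  shows "\<exists>g\<in>G. \<forall>i. - h < p $ i - g $ i \<and> p $ i - g $ i < 1"
proof -
  define C where "C = box (0 :: real ^ 'i) (\<chi> i. e)"
  define D where "D = box p (\<chi> i. p $ i + h)"
  have C: "x \<in> C \<longleftrightarrow> (\<forall>i. 0 < x $ i \<and> x $ i < e)" for x by (simp add: C_def mem_box_cart)
  have D: "x \<in> D \<longleftrightarrow> (\<forall>i. p $ i < x $ i \<and> x $ i < p $ i + h)" for x by (simp add: D_def mem_box_cart)
  have result: ?thesis if cd: "c \<in> C" "d \<in> D" "d - c \<in> G" for c d
  proof (intro bexI[of _ "d - c"] allI)
    fix i
    have "0 < c $ i" "c $ i < e" "p $ i < d $ i" "d $ i < p $ i + h" using cd C D by auto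
    thus "- h < p $ i - (d - c) $ i \<and> p $ i - (d - c) $ i < 1" using e by simp
  qed (use cd in simp)
  show ?thesis
  proof (cases "C \<inter> D = {}")
    case False
    then obtain x where "x \<in> C" "x \<in> D" by blast
    thus ?thesis using result[of x x] add_subgroupD(1)[OF G(1)] by simp
  next
    case True
    have "emeasure lborel C = ennreal (e ^ CARD('i))"
      unfolding C_def using e by (subst emeasure_box_cart) auto
    moreover have "emeasure lborel D = ennreal (h ^ CARD('i))"
      unfolding D_def using e by (subst emeasure_box_cart) auto
    moreover have "emeasure lborel (C \<union> D) = emeasure lborel C + emeasure lborel D"
      by (rule plus_emeasure[symmetric]) (use True in \<open>auto simp: C_def D_def\<close>)
    ultimately have "emeasure lborel (C \<union> D) = ennreal (e ^ CARD('i) + h ^ CARD('i))"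
      using e by (simp add: ennreal_plus)
    hence "emeasure lborel (C \<union> D) > 1" using e(4) by (simp add: ennreal_1[symmetric] ennreal_less_iff del: ennreal_1)
    moreover have "C \<union> D \<in> sets borel" by (auto simp: C_def D_def)
    ultimately obtain a b where ab: "a \<in> C \<union> D" "b \<in> C \<union> D" "a \<noteq> b" "a - b \<in> G"
      using blichfeldt[OF G F cov, of "C \<union> D"] by blast
    have "\<not> (a \<in> C \<and> b \<in> C)"
    proof
      assume *: "a \<in> C \<and> b \<in> C"
      have "\<bar>(a - b) $ i\<bar> < e" for i
      proof -
        have "0 < a $ i" "a $ i < e" "0 < b $ i" "b $ i < e" using * C by auto
        thus ?thesis by simp
      qed
      hence "a - b = 0" by (rule pack[OF ab(4)])
      thus False using ab(3) by simp
    qed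
    moreover have "\<not> (a \<in> D \<and> b \<in> D)"
    proof
      assume *: "a \<in> D \<and> b \<in> D"
      have "\<bar>(a - b) $ i\<bar> < e" for i
      proof -
        have "p $ i < a $ i" "a $ i < p $ i + h" "p $ i < b $ i" "b $ i < p $ i + h" using * D by auto
        thus ?thesis using e(2) by simp
      qed
      hence "a - b = 0" by (rule pack[OF ab(4)])
      thus False using ab(3) by simp
    qed
    moreover have "b - a \<in> G" using add_subgroupD(3)[OF G(1) ab(4)] by simp
    ultimately show ?thesis using ab result[of a b] result[of b a] by blast
  qed
qed

lemma minkowski_cube:
  fixes G :: "(real ^ 'i::finite) set"
  assumes G: "add_subgroup G" "countable G" and F: "F \<in> sets borel" "emeasure lborel F \<le> 1"
    and cov: "\<And>x. \<exists>g\<in>G. x - g \<in> F" and r: "r > 1"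
  shows "\<exists>g\<in>G. g \<noteq> 0 \<and> (\<forall>i. \<bar>g $ i\<bar> < r)"
proof -
  define C where "C = box (0 :: real ^ 'i) (\<chi> i. r)"
  have C: "x \<in> C \<longleftrightarrow> (\<forall>i. 0 < x $ i \<and> x $ i < r)" for x by (simp add: C_def mem_box_cart)
  have "emeasure lborel C = ennreal (r ^ CARD('i))"
    unfolding C_def using r by (subst emeasure_box_cart) auto
  moreover have "r ^ CARD('i) > 1" using r by simp
  ultimately have "emeasure lborel C > 1" by (simp add: ennreal_1[symmetric] ennreal_less_iff del: ennreal_1)
  moreover have "C \<in> sets borel" by (simp add: C_def)
  ultimately obtain a b where ab: "a \<in> C" "b \<in> C" "a \<noteq> b" "a - b \<in> G"
    using blichfeldt[OF G F cov, of C] by blast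
  have "\<bar>(a - b) $ i\<bar> < r" for i
  proof -
    have "0 < a $ i" "a $ i < r" "0 < b $ i" "b $ i < r" using ab C by auto
    thus ?thesis by simp
  qed
  thus ?thesis using ab by (intro bexI[of _ "a - b"]) auto
qed

text \<open>The matrix \<open>1 + M\<close> is unipotent in block form: coordinates in
  \<open>A\<close> stay, the others get a shift that depends on those in \<open>A\<close>. So the
  box with sides \<open>s\<close>, of volume 1, covers modulo \<open>G\<close>: first the
  coordinates in \<open>A\<close> are rounded, then the others.\<close>

lemma sheared_lattice:
  fixes s :: "'i::finite \<Rightarrow> real" and M :: "real ^ 'i \<Rightarrow> real ^ 'i"
  assumes s: "\<And>c. s c > 0" "(\<Prod>c\<in>UNIV. s c) = 1" and M: "Modules.additive M"
    and A: "\<And>c z. c \<in> A \<Longrightarrow> M z $ c = 0" "\<And>z w. (\<And>c. c \<in> A \<Longrightarrow> z $ c = w $ c) \<Longrightarrow> M z = M w"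
  defines "G \<equiv> (\<lambda>z. \<chi> c. s c * (z $ c + M z $ c)) ` {z. \<forall>c. z $ c \<in> \<int>}"
  shows "add_subgroup G" "countable G" "\<exists>g\<in>G. x - g \<in> cbox 0 (\<chi> c. s c)"
    "emeasure lborel (cbox 0 (\<chi> c. s c)) = 1"
proof -
  let ?f = "\<lambda>z. \<chi> c. s c * (z $ c + M z $ c)"
  have f0: "?f 0 = 0" by (simp add: vec_eq_iff Modules.additive.zero[OF M])
  have fd: "?f u - ?f v = ?f (u - v)" for u v
    by (simp add: vec_eq_iff Modules.additive.diff[OF M] algebra_simps)
  show "add_subgroup G" unfolding add_subgroup_def
  proof (intro conjI ballI)
    show "0 \<in> G" unfolding G_def by (rule image_eqI[where x=0 and f="?f"]) (simp_all only: f0, simp)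
    fix x y assume "x \<in> G" "y \<in> G"
    then obtain u v where uv: "x = ?f u" "y = ?f v" "\<forall>c. u $ c \<in> \<int>" "\<forall>c. v $ c \<in> \<int>" unfolding G_def by blast
    have "x - y = ?f (u - v)" unfolding uv by (rule fd)
    thus "x - y \<in> G" unfolding G_def by (rule image_eqI[where f="?f"]) (use uv in simp)
  qed
  have "{z :: real ^ 'i. \<forall>c. z $ c \<in> \<int>} \<subseteq> range (\<lambda>f :: 'i \<Rightarrow> int. \<chi> c. of_int (f c))"
  proof
    fix z :: "real ^ 'i" assume "z \<in> {z. \<forall>c. z $ c \<in> \<int>}"
    hence "z = (\<chi> c. of_int \<lfloor>z $ c\<rfloor>)" by (auto simp: vec_eq_iff elim!: Ints_cases)
    thus "z \<in> range (\<lambda>f :: 'i \<Rightarrow> int. \<chi> c. of_int (f c))"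
      by (rule image_eqI[where x="\<lambda>c. \<lfloor>z $ c\<rfloor>"]) simp
  qed
  hence "countable {z :: real ^ 'i. \<forall>c. z $ c \<in> \<int>}" by (rule countable_subset) simp
  thus "countable G" unfolding G_def by simp
  show "\<exists>g\<in>G. x - g \<in> cbox 0 (\<chi> c. s c)"
  proof -
    define w :: "real ^ 'i" where "w = (\<chi> c. if c \<in> A then of_int \<lfloor>x $ c / s c\<rfloor> else 0)"
    define z :: "real ^ 'i" where "z = (\<chi> c. of_int \<lfloor>x $ c / s c - M w $ c\<rfloor>)"
    have "M z = M w" by (rule A(2)) (simp add: z_def w_def A(1))
    hence e: "x $ c - s c * (z $ c + M z $ c) = s c * frac (x $ c / s c - M w $ c)" for c
      using s(1)[of c] by (simp add: z_def frac_def field_simps)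
    have "0 \<le> s c * frac t \<and> s c * frac t \<le> s c" for c t
      using s(1)[of c] frac_ge_0[of t] less_imp_le[OF frac_lt_1[of t]] by (simp add: mult_left_le)
    hence "x - ?f z \<in> cbox 0 (\<chi> c. s c)" by (simp add: mem_box_cart e)
    moreover have "?f z \<in> G" unfolding G_def by (rule imageI) (simp add: z_def)
    ultimately show ?thesis by blast
  qed
  show "emeasure lborel (cbox 0 (\<chi> c. s c)) = 1"
    using s by (subst emeasure_box_cart(2)) (auto simp: less_imp_le)
qed

section \<open>Limits of lattices without short vectors\<close>

definition limit_lattice :: "nat filter \<Rightarrow> (nat \<Rightarrow> 'a::topological_space set) \<Rightarrow> 'a set" where
  "limit_lattice U G = {v. \<exists>g. (\<forall>j. g j \<in> G j) \<and> (g \<longlongrightarrow> v) U}"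

text \<open>Norms that approach 1 from below are tolerated, since the failure of improvability
  excludes no more than norms below a bound tending to 1.\<close>

definition nearly_admissible :: "nat filter \<Rightarrow> (nat \<Rightarrow> (real ^ 'i::finite) set) \<Rightarrow> bool" where
  "nearly_admissible U G \<longleftrightarrow>
    (\<forall>e<1. eventually (\<lambda>j. \<forall>v\<in>G j. infnorm v \<le> e \<longrightarrow> v = 0) U)"

text \<open>Discreteness makes a limit statement exact: the members of a sequence with a short limit
  are themselves short from some stage on, hence zero.\<close>

lemma nearly_admissible_limit:
  assumes G: "nearly_admissible U G" and g: "eventually (\<lambda>j. g j \<in> G j) U" "(g \<longlongrightarrow> v) U" and v: "infnorm v < 1"
  shows "eventually (\<lambda>j. g j = 0) U"
proof -
  obtain e where e: "infnorm v < e" "e < 1" using dense[OF v] by blast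
  have "((\<lambda>j. infnorm (g j)) \<longlongrightarrow> infnorm v) U" by (rule tendsto_infnorm[OF g(2)])
  hence "eventually (\<lambda>j. infnorm (g j) < e) U" using e(1) by (rule order_tendstoD(2))
  moreover have "eventually (\<lambda>j. \<forall>v\<in>G j. infnorm v \<le> e \<longrightarrow> v = 0) U"
    using G e(2) unfolding nearly_admissible_def by blast
  ultimately show ?thesis using g(1) by eventually_elim auto
qed

lemma nearly_admissible_limit_zero:
  assumes "ultrafilter U" "nearly_admissible U G" "v \<in> limit_lattice U G" "infnorm v < 1"
  shows "v = 0"
proof -
  obtain g where g: "\<forall>j. g j \<in> G j" "(g \<longlongrightarrow> v) U" using assms(3) by (auto simp: limit_lattice_def)
  have U: "U \<noteq> bot" using assms(1) by (simp add: ultrafilter_def)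
  have "eventually (\<lambda>j. g j = 0) U" by (rule nearly_admissible_limit[OF assms(2) _ g(2) assms(4)]) (use g in simp)
  hence "(g \<longlongrightarrow> 0) U" by (rule tendsto_eventually)
  thus ?thesis using tendsto_unique[OF U g(2)] by simp
qed

lemma add_subgroup_limit_lattice:
  fixes G :: "nat \<Rightarrow> 'a::real_normed_vector set"
  assumes "\<And>j. add_subgroup (G j)"
  shows "add_subgroup (limit_lattice U G)"
  unfolding add_subgroup_def
proof (intro conjI ballI)
  show "0 \<in> limit_lattice U G"
    unfolding limit_lattice_def using add_subgroupD(1)[OF assms] by (auto intro!: exI[of _ "\<lambda>_. 0"])
  fix u v assume "u \<in> limit_lattice U G" "v \<in> limit_lattice U G"
  then obtain g h where "\<forall>j. g j \<in> G j" "(g \<longlongrightarrow> u) U" "\<forall>j. h j \<in> G j" "(h \<longlongrightarrow> v) U"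
    unfolding limit_lattice_def by blast
  thus "u - v \<in> limit_lattice U G"
    unfolding limit_lattice_def using add_subgroupD(2)[OF assms]
    by (auto intro!: exI[of _ "\<lambda>j. g j - h j"] tendsto_diff)
qed

lemma infnorm_le_iff_cart: "infnorm (v :: real ^ 'i::finite) \<le> e \<longleftrightarrow> (\<forall>i. \<bar>v $ i\<bar> \<le> e)"
proof
  assume "infnorm v \<le> e"
  thus "\<forall>i. \<bar>v $ i\<bar> \<le> e" using component_le_infnorm_cart[of v] order_trans by blast
next
  assume "\<forall>i. \<bar>v $ i\<bar> \<le> e"
  thus "infnorm v \<le> e" unfolding infnorm_cart by (intro cSup_least) auto
qed

lemma infnorm_less_iff_cart: "infnorm (v :: real ^ 'i::finite) < e \<longleftrightarrow> (\<forall>i. \<bar>v $ i\<bar> < e)"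
proof
  assume "infnorm v < e"
  thus "\<forall>i. \<bar>v $ i\<bar> < e" using component_le_infnorm_cart[of v] le_less_trans by blast
next
  assume a: "\<forall>i. \<bar>v $ i\<bar> < e"
  let ?m = "Max (range (\<lambda>i. \<bar>v $ i\<bar>))"
  have "infnorm v \<le> ?m" unfolding infnorm_le_iff_cart by simp
  moreover have "?m < e" using a by (subst Max_less_iff) auto
  ultimately show "infnorm v < e" by (rule le_less_trans)
qed

lemma limit_lattice_support:
  assumes U: "ultrafilter U" and v: "v \<in> limit_lattice U G" and supp: "\<And>j g. g \<in> G j \<Longrightarrow> g $ i = 0"
  shows "v $ i = (0::real)"
proof -
  obtain g where g: "\<forall>j. g j \<in> G j" "(g \<longlongrightarrow> v) U" using v by (auto simp: limit_lattice_def)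
  have "((\<lambda>j. g j $ i) \<longlongrightarrow> v $ i) U" by (rule tendsto_vec_nth[OF g(2)])
  moreover have "(\<lambda>j. g j $ i) = (\<lambda>j. 0)" using supp g(1) by auto
  ultimately have "((\<lambda>j. 0) \<longlongrightarrow> v $ i) U" by simp
  thus ?thesis using U tendsto_const_iff[of U 0 "v $ i"] by (auto simp: ultrafilter_def)
qed

text \<open>Covering up to a tolerance passes to the limit with closed inequalities. Half-open cubes
  are recovered by approaching \<open>p\<close> from above; the vectors found on the way become
  constant, as distinct limit vectors are at distance at least 1.\<close>

lemma lattice_tiling_limit:
  fixes G :: "nat \<Rightarrow> (real ^ 'i::finite) set"
  assumes U: "ultrafilter U" "U \<le> sequentially" and G: "\<And>j. add_subgroup (G j)" and adm: "nearly_admissible U G"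
    and supp: "\<And>j g i. g \<in> G j \<Longrightarrow> i \<notin> I \<Longrightarrow> g $ i = 0"
    and cov: "\<And>p h. 0 < h \<Longrightarrow> h < 1 \<Longrightarrow>
      eventually (\<lambda>j. \<exists>g\<in>G j. \<forall>i\<in>I. - h < p i - g $ i \<and> p i - g $ i < 1 + h) U"
  shows "lattice_tiling I (limit_lattice U G)"
proof -
  have Ubot: "U \<noteq> bot" using U(1) by (simp add: ultrafilter_def)
  let ?L = "limit_lattice U G"
  note sub = add_subgroup_limit_lattice[OF G, of U]
  have supp': "v $ i = 0" if "v \<in> ?L" "i \<notin> I" for v i
    by (rule limit_lattice_support[OF U(1) that(1)]) (use supp that(2) in blast)
  have pack: "v = 0" if "v \<in> ?L" "\<And>i. i \<in> I \<Longrightarrow> \<bar>v $ i\<bar> < 1" for v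
  proof (rule nearly_admissible_limit_zero[OF U(1) adm that(1)])
    have "\<bar>v $ i\<bar> < 1" for i using that(2)[of i] supp'[OF that(1), of i] by (cases "i \<in> I") auto
    thus "infnorm v < 1" by (simp add: infnorm_less_iff_cart)
  qed
  have approx: "\<exists>v\<in>?L. \<forall>i\<in>I. - h \<le> p i - v $ i \<and> p i - v $ i \<le> 1 + h" if h: "0 < h" "h < 1" for p h
  proof -
    define g where "g j = (if \<exists>g\<in>G j. \<forall>i\<in>I. - h < p i - g $ i \<and> p i - g $ i < 1 + h
      then SOME g. g \<in> G j \<and> (\<forall>i\<in>I. - h < p i - g $ i \<and> p i - g $ i < 1 + h) else 0)" for j
    have gG: "g j \<in> G j" for j
    proof (cases "\<exists>g\<in>G j. \<forall>i\<in>I. - h < p i - g $ i \<and> p i - g $ i < 1 + h")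
      case True
      hence "\<exists>g. g \<in> G j \<and> (\<forall>i\<in>I. - h < p i - g $ i \<and> p i - g $ i < 1 + h)" by blast
      from someI_ex[OF this] show ?thesis using True by (simp add: g_def)
    next
      case False
      thus ?thesis unfolding g_def by (subst if_not_P) (simp_all only: add_subgroupD(1)[OF G] not_False_eq_True)
    qed
    have ev: "eventually (\<lambda>j. \<forall>i\<in>I. - h < p i - g j $ i \<and> p i - g j $ i < 1 + h) U"
      using cov[OF h, of p]
    proof eventually_elim
      case (elim j)
      hence "\<exists>g. g \<in> G j \<and> (\<forall>i\<in>I. - h < p i - g $ i \<and> p i - g $ i < 1 + h)" by blast
      from someI_ex[OF this] show ?case using elim by (simp add: g_def)
    qed
    define B where "B = Max (range (\<lambda>i. \<bar>p i\<bar>)) + 2"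
    have "eventually (\<lambda>j. g j \<in> cbox (\<chi> i. - B) (\<chi> i. B)) U" using ev
    proof eventually_elim
      case (elim j)
      have pm: "\<bar>p i\<bar> \<le> Max (range (\<lambda>i. \<bar>p i\<bar>))" for i by simp
      have gp: "\<bar>g j $ i\<bar> \<le> \<bar>p i\<bar> + 2" for i
        using elim supp[OF gG, of i j] h by (cases "i \<in> I") force+
      have "\<bar>g j $ i\<bar> \<le> B" for i unfolding B_def using pm[of i] gp[of i] by linarith
      thus ?case by (simp add: mem_box_cart abs_le_iff, metis minus_le_iff)
    qed
    from ultrafilter_tendsto[OF U(1) bounded_cbox this] obtain v where v: "(g \<longlongrightarrow> v) U" by blast
    have "- h \<le> p i - v $ i \<and> p i - v $ i \<le> 1 + h" if i: "i \<in> I" for i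
    proof -
      have t: "((\<lambda>j. p i - g j $ i) \<longlongrightarrow> p i - v $ i) U" by (intro tendsto_intros v)
      have "eventually (\<lambda>j. - h \<le> p i - g j $ i) U" "eventually (\<lambda>j. p i - g j $ i \<le> 1 + h) U"
        using ev by (eventually_elim, use i in force)+
      thus ?thesis using tendsto_lowerbound[OF t _ Ubot] tendsto_upperbound[OF t _ Ubot] by blast
    qed
    moreover have "v \<in> ?L" using gG v by (auto simp: limit_lattice_def)
    ultimately show ?thesis by blast
  qed
  have exact: "\<exists>v\<in>?L. \<forall>i\<in>I. v $ i \<le> p i \<and> p i < v $ i + 1" for p
  proof -
    \<comment> \<open>Probing at \<open>p + t n\<close> with tolerance \<open>t n / 2\<close> makes
      the upper bound strict, because the offset exceeds the tolerance; the lower bound is off by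
      3/2 of \<open>t n\<close>, which disappears in the limit.\<close>
    define t where "t n = inverse (real (Suc n))" for n
    have t: "0 < t n" "t n / 2 < 1" for n unfolding t_def by (auto simp: field_simps)
    have "\<exists>v\<in>?L. \<forall>i\<in>I. - (t n / 2) \<le> (p i + t n) - v $ i \<and> (p i + t n) - v $ i \<le> 1 + t n / 2" for n
      by (rule approx) (use t in auto)
    then obtain w where w: "\<And>n. w n \<in> ?L"
      "\<And>n i. i \<in> I \<Longrightarrow> - (t n / 2) \<le> (p i + t n) - w n $ i \<and> (p i + t n) - w n $ i \<le> 1 + t n / 2" by metis
    define B where "B = Max (range (\<lambda>i. \<bar>p i\<bar>)) + 3"
    have "w n \<in> cbox (\<chi> i. - B) (\<chi> i. B)" for n
    proof -
      have pm: "\<bar>p i\<bar> \<le> Max (range (\<lambda>i. \<bar>p i\<bar>))" for i by simp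
      have "t n \<le> 1" unfolding t_def by (simp add: field_simps)
      hence wp: "\<bar>w n $ i\<bar> \<le> \<bar>p i\<bar> + 3" for i
        using w(2)[of i n] supp'[OF w(1), of i n] t[of n] by (cases "i \<in> I") force+
      have "\<bar>w n $ i\<bar> \<le> B" for i unfolding B_def using pm[of i] wp[of i] by linarith
      thus ?thesis by (simp add: mem_box_cart abs_le_iff, metis minus_le_iff)
    qed
    hence "eventually (\<lambda>n. w n \<in> cbox (\<chi> i. - B) (\<chi> i. B)) U" by simp
    from ultrafilter_tendsto[OF U(1) bounded_cbox this] obtain l where l: "(w \<longlongrightarrow> l) U" by blast
    have evi: "eventually (\<lambda>n. \<bar>w n $ i - l $ i\<bar> < 1/2) U" for i
      using tendstoD[OF tendsto_vec_nth[OF l, of i], of "1/2"] by (simp add: dist_real_def)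
    have evall: "eventually (\<lambda>n. \<forall>i. \<bar>w n $ i - l $ i\<bar> < 1/2) U"
      using eventually_ball_finite[of UNIV "\<lambda>n i. \<bar>w n $ i - l $ i\<bar> < 1/2" U] evi by simp
    then obtain m where m: "\<And>i. \<bar>w m $ i - l $ i\<bar> < 1/2"
      using eventually_happens'[OF Ubot] by blast
    from evall have same: "eventually (\<lambda>n. w n = w m) U"
    proof eventually_elim
      case (elim n)
      have "w n - w m = 0"
      proof (rule pack)
        show "w n - w m \<in> ?L" by (rule add_subgroupD(2)[OF sub w(1) w(1)])
        show "\<bar>(w n - w m) $ i\<bar> < 1" for i
        proof -
          have "\<bar>w n $ i - l $ i\<bar> < 1/2" using elim by blast
          thus ?thesis using m[of i] unfolding vector_minus_component abs_less_iff by linarith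
        qed
      qed
      thus ?case by simp
    qed
    have t0: "(t \<longlongrightarrow> 0) U"
      using LIMSEQ_inverse_real_of_nat filterlim_mono[OF _ order_refl U(2)] unfolding t_def by blast
    have "w m $ i \<le> p i \<and> p i < w m $ i + 1" if i: "i \<in> I" for i
    proof
      have "eventually (\<lambda>n. - (t n / 2) - t n \<le> p i - w m $ i) U"
        using same
      proof eventually_elim
        case (elim n)
        thus ?case using w(2)[OF i, of n] by simp
      qed
      moreover have "((\<lambda>n. - (t n / 2) - t n) \<longlongrightarrow> - (0 / 2) - 0) U" by (intro tendsto_intros t0) simp
      ultimately have "- (0 / 2) - 0 \<le> p i - w m $ i" using tendsto_upperbound[OF _ _ Ubot] by blast
      thus "w m $ i \<le> p i" by simp
      show "p i < w m $ i + 1" using w(2)[OF i, of m] t(1)[of m] by simp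
    qed
    thus ?thesis using w(1) by blast
  qed
  show ?thesis unfolding lattice_tiling_def
  proof (intro conjI allI ballI impI sub exact)
    fix v i assume "v \<in> ?L" "\<forall>i\<in>I. \<bar>v $ i\<bar> < 1" "i \<in> I"
    hence "v = 0" by (intro pack) auto
    thus "v $ i = 0" by simp
  qed
qed

section \<open>Triangularity along a flag of coordinates\<close>

lemma rank_descend:
  fixes rk :: "'i \<Rightarrow> nat"
  assumes "finite I" and step: "\<And>i. i \<in> I \<Longrightarrow> (\<And>c. c \<in> I \<Longrightarrow> rk i < rk c \<Longrightarrow> P c) \<Longrightarrow> P i" and i: "i \<in> I"
  shows "P i"
  using i
proof (induction "Max (rk ` I) - rk i" arbitrary: i rule: less_induct)
  case less
  have le: "rk c \<le> Max (rk ` I)" if "c \<in> I" for c using assms(1) that by simp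
  show ?case
  proof (rule step[OF less.prems])
    fix c assume c: "c \<in> I" "rk i < rk c"
    show "P c" by (rule less.hyps) (use c le[OF c(1)] le[OF less.prems] in auto)
  qed
qed

text \<open>The coefficients vanish below rank \<open>rk i\<close> and the terms vanish above it, so
  only the diagonal term is left.\<close>

lemma rank_sum:
  fixes rk :: "'i \<Rightarrow> nat" and t :: "'i \<Rightarrow> 'v::real_vector"
  assumes I: "finite I" and inj: "inj_on rk I" and i: "i \<in> I"
    and a: "a i = 1" "\<And>c. c \<in> I \<Longrightarrow> rk c < rk i \<Longrightarrow> a c = 0"
    and t: "\<And>c. c \<in> I \<Longrightarrow> rk i < rk c \<Longrightarrow> t c = 0"
  shows "(\<Sum>c\<in>I. a c *\<^sub>R t c) = t i"
proof -
  have "(\<Sum>c\<in>I. a c *\<^sub>R t c) = (\<Sum>c\<in>I. if c = i then t i else 0)"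
  proof (rule sum.cong[OF refl])
    fix c assume c: "c \<in> I"
    consider "rk c < rk i" | "rk c = rk i" | "rk i < rk c" by linarith
    thus "a c *\<^sub>R t c = (if c = i then t i else 0)"
    proof cases
      case 1 thus ?thesis using a(2)[OF c] by auto
    next
      case 2
      hence "c = i" using inj_onD[OF inj _ c i] by simp
      thus ?thesis using a(1) by simp
    next
      case 3 thus ?thesis using t[OF c] by auto
    qed
  qed
  thus ?thesis using I i by simp
qed

lemma linear_axis_expansion:
  fixes f :: "real ^ 'i::finite \<Rightarrow> 'v::real_vector"
  assumes "linear f" "\<And>i. i \<notin> I \<Longrightarrow> v $ i = 0"
  shows "f v = (\<Sum>i\<in>I. v $ i *\<^sub>R f (axis i 1))"
proof -
  have "v = (\<Sum>i\<in>UNIV. (v $ i) *\<^sub>R axis i 1)"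
    using basis_expansion[of v] by (simp add: scalar_mult_eq_scaleR)
  also have "\<dots> = (\<Sum>i\<in>I. (v $ i) *\<^sub>R axis i 1)"
    by (rule sum.mono_neutral_right) (use assms(2) in auto)
  finally have "f v = f (\<Sum>i\<in>I. (v $ i) *\<^sub>R axis i 1)" by (rule arg_cong)
  also have "\<dots> = (\<Sum>i\<in>I. v $ i *\<^sub>R f (axis i 1))"
    by (simp add: linear_sum[OF assms(1)] linear_scale[OF assms(1)])
  finally show ?thesis .
qed

text \<open>In the limit the maps kill the triangular basis from its last vector on, because their values
  are short limits of lattice vectors; rescaling shows that the maps themselves vanish.\<close>

theorem flag_annihilation:
  fixes A :: "nat \<Rightarrow> (real ^ 'i::finite) set" and B :: "nat \<Rightarrow> (real ^ 'k::finite) set"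
    and T :: "nat \<Rightarrow> real ^ 'i \<Rightarrow> real ^ 'k" and rk :: "'i \<Rightarrow> nat"
  assumes U: "ultrafilter U" and T: "\<And>j. linear (T j)"
    and TAB: "\<And>j v. v \<in> A j \<Longrightarrow> T j v \<in> B j" and B: "nearly_admissible U B"
    and supp: "\<And>j v i. v \<in> A j \<Longrightarrow> i \<notin> I \<Longrightarrow> v $ i = 0"
    and inj: "inj_on rk I"
    and flag: "\<And>i. i \<in> I \<Longrightarrow> \<exists>b\<in>limit_lattice U A. b $ i = 1 \<and> (\<forall>c\<in>I. rk c < rk i \<longrightarrow> b $ c = 0)"
    and lim: "\<And>i. i \<in> I \<Longrightarrow> ((\<lambda>j. T j (axis i 1)) \<longlongrightarrow> t i) U" and small: "\<And>i. i \<in> I \<Longrightarrow> infnorm (t i) < 1"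
  shows "eventually (\<lambda>j. \<forall>i\<in>I. T j (axis i 1) = 0) U"
proof (rule ccontr)
  assume not0: "\<not> ?thesis"
  have Ubot: "U \<noteq> bot" using U by (simp add: ultrafilter_def)
  have "\<exists>b g. (\<forall>j. g j \<in> A j) \<and> (g \<longlongrightarrow> b) U \<and> b $ i = 1 \<and> (\<forall>c\<in>I. rk c < rk i \<longrightarrow> b $ c = 0)"
    if "i \<in> I" for i using flag[OF that] unfolding limit_lattice_def by blast
  then obtain b g where bg: "\<And>i j. i \<in> I \<Longrightarrow> g i j \<in> A j" "\<And>i. i \<in> I \<Longrightarrow> (g i \<longlongrightarrow> b i) U"
    "\<And>i. i \<in> I \<Longrightarrow> b i $ i = 1" "\<And>i c. i \<in> I \<Longrightarrow> c \<in> I \<Longrightarrow> rk c < rk i \<Longrightarrow> b i $ c = 0"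
    by metis
  have Tg: "T j (g i j) = (\<Sum>c\<in>I. g i j $ c *\<^sub>R T j (axis c 1))" if "i \<in> I" for i j
    by (rule linear_axis_expansion[OF T supp[OF bg(1)[OF that]]])
  have limg: "((\<lambda>j. g i j $ c) \<longlongrightarrow> b i $ c) U" if "i \<in> I" for i c
    by (rule tendsto_vec_nth[OF bg(2)[OF that]])
  have fin: "finite I" by simp
  \<comment> \<open>By triangularity the limit of \<open>T j (g i j)\<close> is \<open>t i\<close>,
    which is short. So these values vanish eventually and \<open>t i\<close> is zero, as the lower
    ranks require.\<close>
  have kill: "eventually (\<lambda>j. T j (g i j) = 0) U" if i: "i \<in> I" for i
  proof -
    have "t i = 0 \<and> eventually (\<lambda>j. T j (g i j) = 0) U"
    proof (rule rank_descend[where rk=rk and I=I and P="\<lambda>i. t i = 0 \<and> eventually (\<lambda>j. T j (g i j) = 0) U", OF fin _ i])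
      fix i assume i: "i \<in> I" and IH: "\<And>c. c \<in> I \<Longrightarrow> rk i < rk c \<Longrightarrow> t c = 0 \<and> eventually (\<lambda>j. T j (g c j) = 0) U"
      have "((\<lambda>j. \<Sum>c\<in>I. g i j $ c *\<^sub>R T j (axis c 1)) \<longlongrightarrow> (\<Sum>c\<in>I. b i $ c *\<^sub>R t c)) U"
        by (intro tendsto_sum tendsto_scaleR limg[OF i] lim)
      also have "(\<Sum>c\<in>I. b i $ c *\<^sub>R t c) = t i"
        by (rule rank_sum[where a="\<lambda>c. b i $ c", OF fin inj i bg(3)[OF i] bg(4)[OF i]]) (use IH in auto)
      also have "(\<lambda>j. \<Sum>c\<in>I. g i j $ c *\<^sub>R T j (axis c 1)) = (\<lambda>j. T j (g i j))" using Tg[OF i] by auto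
      finally have l: "((\<lambda>j. T j (g i j)) \<longlongrightarrow> t i) U" .
      have ev: "eventually (\<lambda>j. T j (g i j) = 0) U"
        by (rule nearly_admissible_limit[OF B _ l small[OF i]]) (simp add: TAB bg(1)[OF i])
      hence "((\<lambda>j. T j (g i j)) \<longlongrightarrow> 0) U" by (rule tendsto_eventually)
      hence "t i = 0" using tendsto_unique[OF Ubot l] by simp
      thus "t i = 0 \<and> eventually (\<lambda>j. T j (g i j) = 0) U" using ev by simp
    qed
    thus ?thesis by simp
  qed
  have ev_ne: "eventually (\<lambda>j. \<not> (\<forall>i\<in>I. T j (axis i 1) = 0)) U"
    using U not0 unfolding ultrafilter_def by blast
  \<comment> \<open>The images of the axes might tend to zero without vanishing. Divided by their
    total size they are bounded with sizes adding up to 1; where \<open>m j\<close> is 0, division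
    by zero makes \<open>X\<close> zero.\<close>
  define m where "m j = (\<Sum>i\<in>I. norm (T j (axis i 1)))" for j
  define X where "X i j = (1 / m j) *\<^sub>R T j (axis i 1)" for i j
  have m0: "m j \<ge> 0" for j unfolding m_def by (intro sum_nonneg) simp
  have Xb: "X i j \<in> cball 0 1" if "i \<in> I" for i j
  proof -
    have "norm (T j (axis i 1)) \<le> m j" unfolding m_def by (rule member_le_sum) (use that in auto)
    thus ?thesis using m0[of j] by (cases "m j = 0") (simp_all add: X_def divide_le_eq)
  qed
  have "\<exists>x. (X i \<longlongrightarrow> x) U" if "i \<in> I" for i
  proof -
    have "eventually (\<lambda>j. X i j \<in> cball 0 1) U" using Xb[OF that] by simp
    from ultrafilter_tendsto[OF U bounded_cball this] show ?thesis by blast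
  qed
  then obtain x where x: "\<And>i. i \<in> I \<Longrightarrow> (X i \<longlongrightarrow> x i) U" by metis
  \<comment> \<open>The relations \<open>T j (g i j) = 0\<close> are exact, so they survive the
    rescaling and kill the normalized limits from the highest rank down.\<close>
  have x0: "x i = 0" if i: "i \<in> I" for i
  proof (rule rank_descend[where rk=rk and I=I and P="\<lambda>i. x i = 0", OF fin _ i])
    fix i assume i: "i \<in> I" and IH: "\<And>c. c \<in> I \<Longrightarrow> rk i < rk c \<Longrightarrow> x c = 0"
    have "((\<lambda>j. \<Sum>c\<in>I. g i j $ c *\<^sub>R X c j) \<longlongrightarrow> (\<Sum>c\<in>I. b i $ c *\<^sub>R x c)) U"
      by (intro tendsto_sum tendsto_scaleR limg[OF i] x)
    also have "(\<Sum>c\<in>I. b i $ c *\<^sub>R x c) = x i"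
      by (rule rank_sum[where a="\<lambda>c. b i $ c", OF fin inj i bg(3)[OF i] bg(4)[OF i]]) (use IH in auto)
    finally have l: "((\<lambda>j. \<Sum>c\<in>I. g i j $ c *\<^sub>R X c j) \<longlongrightarrow> x i) U" .
    have eqX: "(\<Sum>c\<in>I. g i j $ c *\<^sub>R X c j) = (1 / m j) *\<^sub>R T j (g i j)" for j
      unfolding Tg[OF i] X_def by (simp add: scaleR_sum_right mult.commute)
    have "eventually (\<lambda>j. (\<Sum>c\<in>I. g i j $ c *\<^sub>R X c j) = 0) U"
      using kill[OF i] by eventually_elim (simp add: eqX)
    hence "((\<lambda>j. \<Sum>c\<in>I. g i j $ c *\<^sub>R X c j) \<longlongrightarrow> 0) U" by (rule tendsto_eventually)
    thus "x i = 0" using tendsto_unique[OF Ubot l] by simp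
  qed
  have "((\<lambda>j. \<Sum>i\<in>I. norm (X i j)) \<longlongrightarrow> (\<Sum>i\<in>I. norm (x i))) U"
    by (intro tendsto_sum tendsto_norm x)
  hence l0: "((\<lambda>j. \<Sum>i\<in>I. norm (X i j)) \<longlongrightarrow> 0) U" using x0 by simp
  have "eventually (\<lambda>j. (\<Sum>i\<in>I. norm (X i j)) = 1) U"
    using ev_ne
  proof eventually_elim
    case (elim j)
    then obtain i where "i \<in> I" "norm (T j (axis i 1)) > 0" by auto
    hence "m j > 0" unfolding m_def by (intro sum_pos2[of I i]) auto
    moreover have "(\<Sum>i\<in>I. norm (X i j)) = (1 / m j) * m j"
      unfolding X_def m_def[of j] sum_distrib_left using m0[of j] by (intro sum.cong) (simp_all add: m_def)
    ultimately show ?case by simp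
  qed
  hence "((\<lambda>j. \<Sum>i\<in>I. norm (X i j)) \<longlongrightarrow> 1) U" by (rule tendsto_eventually)
  from tendsto_unique[OF Ubot l0 this] show False by simp
qed

section \<open>Exterior powers of lattices\<close>

text \<open>The creation operator: left multiplication by the \<open>i\<close>-th basis
  vector.\<close>

definition cre :: "'m::{finite,linorder} \<Rightarrow> real ^ ('m set) \<Rightarrow> real ^ ('m set)" where
  "cre i W = (\<chi> L. if i \<in> L then wedge_sign {i} (L - {i}) * W $ (L - {i}) else 0)"

text \<open>The annihilation operator: contraction with the \<open>i\<close>-th coordinate
  functional.\<close>

definition ann :: "'m::{finite,linorder} \<Rightarrow> real ^ ('m set) \<Rightarrow> real ^ ('m set)" where
  "ann i W = (\<chi> K. if i \<in> K then 0 else wedge_sign {i} K * W $ insert i K)"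

lemma wedge_sign_singleton: "wedge_sign {i} K = (- 1) ^ card {j \<in> K. j < i}"
proof -
  have "{(a, b). a \<in> {i} \<and> b \<in> K \<and> b < a} = Pair i ` {j \<in> K. j < i}" by auto
  thus ?thesis unfolding wedge_sign_def by (simp add: card_image inj_on_def)
qed

lemma wedge_sign_square: "wedge_sign I J * wedge_sign I J = 1"
  by (simp add: wedge_sign_def flip: power_add mult_2)

lemma abs_wedge_sign: "\<bar>wedge_sign I J\<bar> = 1"
  by (simp add: wedge_sign_def power_abs)

lemma wedge_sign_Ints: "wedge_sign I J \<in> \<int>"
  by (simp add: wedge_sign_def)

lemma wedge_sign_insert:
  assumes "j \<notin> K"
  shows "wedge_sign {i} (insert j K) = (if j < i then - 1 else 1) * wedge_sign {i} K"
proof (cases "j < i")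
  case True
  hence "{k \<in> insert j K. k < i} = insert j {k \<in> K. k < i}" by auto
  thus ?thesis using True assms by (simp add: wedge_sign_singleton)
next
  case False
  hence "{k \<in> insert j K. k < i} = {k \<in> K. k < i}" by auto
  thus ?thesis using False by (simp add: wedge_sign_singleton)
qed

lemma wedge_sign_swap:
  assumes "i \<noteq> j" "i \<notin> K" "j \<notin> K"
  shows "wedge_sign {i} (insert j K) * wedge_sign {j} K = - (wedge_sign {j} (insert i K) * wedge_sign {i} K)"
  using assms by (auto simp: wedge_sign_insert)

lemma cre_component: "cre i W $ L = (if i \<in> L then wedge_sign {i} (L - {i}) * W $ (L - {i}) else 0)"
  and ann_component: "ann i W $ K = (if i \<in> K then 0 else wedge_sign {i} K * W $ insert i K)"
  by (simp_all add: cre_def ann_def)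

lemma linear_cre: "linear (cre i)" and linear_ann: "linear (ann i)"
  by (auto intro!: linearI simp: vec_eq_iff cre_component ann_component algebra_simps)

lemma ann_ann: "ann i (ann j W) = - ann j (ann i W)"
proof (rule vec_eq_iff[THEN iffD2], rule allI)
  fix K
  show "ann i (ann j W) $ K = (- ann j (ann i W)) $ K"
  proof (cases "i = j \<or> i \<in> K \<or> j \<in> K")
    case True thus ?thesis by (auto simp: ann_component)
  next
    case False
    hence ne: "i \<noteq> j" "j \<noteq> i" "i \<notin> K" "j \<notin> K" by auto
    have "ann i (ann j W) $ K = (wedge_sign {j} (insert i K) * wedge_sign {i} K) * W $ insert i (insert j K)"
      using ne by (simp add: ann_component insert_commute)
    moreover have "ann j (ann i W) $ K = (wedge_sign {i} (insert j K) * wedge_sign {j} K) * W $ insert i (insert j K)"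
      using ne by (simp add: ann_component insert_commute)
    ultimately show ?thesis using wedge_sign_swap[OF ne(1,3,4)] by simp
  qed
qed

text \<open>The canonical anticommutation relation. For \<open>i = j\<close> exactly one summand
  survives at each \<open>K\<close>, according to whether \<open>i\<close> belongs to
  \<open>K\<close>; for \<open>i \<noteq> j\<close> the two orders differ by one inversion.\<close>

lemma ann_cre: "ann i (cre j W) + cre j (ann i W) = (if i = j then W else 0)"
proof (rule vec_eq_iff[THEN iffD2], rule allI)
  fix K
  show "(ann i (cre j W) + cre j (ann i W)) $ K = (if i = j then W else 0) $ K"
  proof (cases "i = j")
    case True
    show ?thesis
    proof (cases "i \<in> K")
      case iK: True
      hence "insert i (K - {i}) = K" by auto
      thus ?thesis using True iK wedge_sign_square[of "{i}" "K - {i}"]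
        by (simp add: ann_component cre_component flip: mult.assoc)
    next
      case False
      thus ?thesis using True wedge_sign_square[of "{i}" K]
        by (simp add: ann_component cre_component flip: mult.assoc)
    qed
  next
    case ij: False
    show ?thesis
    proof (cases "i \<in> K \<or> j \<notin> K")
      case True thus ?thesis using ij by (auto simp: ann_component cre_component)
    next
      case False
      define H where "H = K - {j}"
      have K: "K = insert j H" "j \<notin> H" "i \<notin> H" "insert i K - {j} = insert i H" using False ij by (auto simp: H_def)
      have s: "wedge_sign {i} (insert j H) * wedge_sign {j} (insert i H) = - (wedge_sign {j} H * wedge_sign {i} H)"
        using ij K(2,3) by (auto simp: wedge_sign_insert)
      have "ann i (cre j W) $ K = (wedge_sign {i} (insert j H) * wedge_sign {j} (insert i H)) * W $ insert i H"
        using False ij K by (simp add: ann_component cre_component)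
      moreover have "cre j (ann i W) $ K = (wedge_sign {j} H * wedge_sign {i} H) * W $ insert i H"
        using K ij by (simp add: ann_component cre_component)
      ultimately show ?thesis unfolding s using ij by simp
    qed
  qed
qed

lemma ext_vec_component: "ext_vec v $ L = (\<Sum>i\<in>UNIV. if L = {i} then v $ i else 0)"
  unfolding ext_vec_def by (simp add: axis_def if_distrib cong: if_cong)

lemma wedge_ext_vec: "ext_vec v \<and>\<^sub>E W = (\<Sum>i\<in>UNIV. v $ i *\<^sub>R cre i W)"
proof -
  have ax: "axis {i} 1 \<and>\<^sub>E W = cre i W" for i
  proof (rule vec_eq_iff[THEN iffD2], rule allI)
    fix S
    have "(axis {i} 1 \<and>\<^sub>E W) $ S = (\<Sum>I\<in>Pow S. if I = {i} then wedge_sign {i} (S - {i}) * W $ (S - {i}) else 0)"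
      unfolding wedge_def vec_lambda_beta by (intro sum.cong) (auto simp: axis_def)
    also have "\<dots> = cre i W $ S" by (auto simp: cre_component sum.delta)
    finally show "(axis {i} 1 \<and>\<^sub>E W) $ S = cre i W $ S" .
  qed
  have l: "linear (\<lambda>A. A \<and>\<^sub>E W)"
    by (rule bilinear_wedge[unfolded bilinear_def, THEN conjunct2, rule_format])
  show ?thesis unfolding ext_vec_def linear_sum[OF l] linear_scale[OF l] ax ..
qed

text \<open>Here \<open>f\<close> holds the coefficients of a functional, which is why transposed
  maps appear in \<open>iota_diag\<close> and \<open>iota_shear\<close>.\<close>

definition iota :: "real ^ ('m::{finite,linorder}) \<Rightarrow> real ^ ('m set) \<Rightarrow> real ^ ('m set)" where
  "iota f W = (\<Sum>i\<in>UNIV. f $ i *\<^sub>R ann i W)"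

lemma linear_iota: "linear (iota f)"
  unfolding iota_def by (intro linear_compose_sum ballI linear_compose_scale_right linear_ann)

lemma linear_wedge: "linear (\<lambda>W. A \<and>\<^sub>E W)"
  by (rule bilinear_wedge[unfolded bilinear_def, THEN conjunct1, rule_format])

lemma iota_add_left: "iota (f + g) W = iota f W + iota g W"
  by (simp add: iota_def scaleR_add_left sum.distrib)

lemma iota_axis: "iota (axis i c) W = c *\<^sub>R ann i W"
proof -
  have "iota (axis i c) W = (\<Sum>j\<in>UNIV. if j = i then c *\<^sub>R ann i W else 0)"
    unfolding iota_def by (intro sum.cong) (auto simp: axis_def)
  thus ?thesis by simp
qed

lemma ann_iota: "ann i (iota f W) = - iota f (ann i W)"
  unfolding iota_def linear_sum[OF linear_ann] linear_scale[OF linear_ann]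
  by (subst ann_ann) (simp add: sum_negf)

lemma ann_wedge: "ann i (ext_vec v \<and>\<^sub>E W) = v $ i *\<^sub>R W - ext_vec v \<and>\<^sub>E ann i W"
proof -
  have "ann i (ext_vec v \<and>\<^sub>E W) + ext_vec v \<and>\<^sub>E ann i W = (\<Sum>j\<in>UNIV. v $ j *\<^sub>R (ann i (cre j W) + cre j (ann i W)))"
    by (simp add: wedge_ext_vec linear_sum[OF linear_ann] linear_scale[OF linear_ann] scaleR_add_right sum.distrib)
  also have "\<dots> = (\<Sum>j\<in>UNIV. if j = i then v $ i *\<^sub>R W else 0)"
    unfolding ann_cre by (intro sum.cong) auto
  finally show ?thesis by (simp add: algebra_simps)
qed

text \<open>Contraction is an antiderivation: \<open>ann_wedge\<close> summed with weights
  \<open>f\<close>.\<close>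

lemma iota_wedge: "iota f (ext_vec v \<and>\<^sub>E W) = (\<Sum>i\<in>UNIV. f $ i * v $ i) *\<^sub>R W - ext_vec v \<and>\<^sub>E iota f W"
proof -
  have "iota f (ext_vec v \<and>\<^sub>E W) = (\<Sum>i\<in>UNIV. (f $ i * v $ i) *\<^sub>R W - f $ i *\<^sub>R (ext_vec v \<and>\<^sub>E ann i W))"
    unfolding iota_def ann_wedge by (simp add: scaleR_diff_right)
  also have "\<dots> = (\<Sum>i\<in>UNIV. f $ i * v $ i) *\<^sub>R W - ext_vec v \<and>\<^sub>E iota f W"
    unfolding iota_def sum_subtractf scaleR_sum_left linear_sum[OF linear_wedge] linear_scale[OF linear_wedge] ..
  finally show ?thesis .
qed

lemma wedge_wedge_self: "ext_vec v \<and>\<^sub>E (ext_vec v \<and>\<^sub>E W) = 0"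
  by (simp add: wedge_assoc[symmetric] wedge_self bilinear_lzero[OF bilinear_wedge])

lemma ext_vec_add: "ext_vec (u + v) = ext_vec u + ext_vec v"
  by (simp add: ext_vec_def scaleR_add_left sum.distrib)

lemma ext_vec_scale: "ext_vec (c *\<^sub>R v) = c *\<^sub>R ext_vec v"
  by (simp add: ext_vec_def scaleR_sum_right)

lemma wedge_anticommute: "ext_vec u \<and>\<^sub>E (ext_vec v \<and>\<^sub>E W) = - (ext_vec v \<and>\<^sub>E (ext_vec u \<and>\<^sub>E W))"
proof -
  have "ext_vec (u + v) \<and>\<^sub>E (ext_vec (u + v) \<and>\<^sub>E W) = 0" by (rule wedge_wedge_self)
  hence "ext_vec u \<and>\<^sub>E (ext_vec v \<and>\<^sub>E W) + ext_vec v \<and>\<^sub>E (ext_vec u \<and>\<^sub>E W) = 0"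
    by (simp add: ext_vec_add bilinear_ladd[OF bilinear_wedge] bilinear_radd[OF bilinear_wedge] wedge_wedge_self
        add.commute)
  thus ?thesis by (rule eq_neg_iff_add_eq_0[THEN iffD2])
qed

text \<open>The action on the exterior algebra of the linear map that adds \<open>x\<close> times the coordinate at \<open>z\<close>
  (where \<open>x\<close> vanishes) and then scales the coordinates by \<open>s\<close>.\<close>

definition diag_ext :: "('m::{finite,linorder} \<Rightarrow> real) \<Rightarrow> real ^ ('m set) \<Rightarrow> real ^ ('m set)" where
  "diag_ext s W = (\<chi> K. (\<Prod>i\<in>K. s i) * W $ K)"

definition shear_ext :: "'m::{finite,linorder} \<Rightarrow> real ^ ('m::{finite,linorder}) \<Rightarrow> real ^ ('m set) \<Rightarrow> real ^ ('m set)" where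
  "shear_ext z x W = W + ext_vec x \<and>\<^sub>E ann z W"

lemma linear_diag_ext: "linear (diag_ext s)"
  by (auto intro!: linearI simp: vec_eq_iff diag_ext_def algebra_simps)

lemma linear_shear_ext: "linear (shear_ext z x)"
  unfolding shear_ext_def
  by (intro linear_compose_add linear_ident linear_compose[OF linear_ann linear_wedge, unfolded o_def])

lemma cre_diag: "cre i (diag_ext s W) = (1 / s i) *\<^sub>R diag_ext s (cre i W)" if "s i \<noteq> 0"
proof (rule vec_eq_iff[THEN iffD2], rule allI)
  fix K
  show "cre i (diag_ext s W) $ K = ((1 / s i) *\<^sub>R diag_ext s (cre i W)) $ K"
  proof (cases "i \<in> K")
    case True
    hence "(\<Prod>j\<in>K. s j) = s i * (\<Prod>j\<in>K - {i}. s j)" by (intro prod.remove) auto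
    thus ?thesis using that True by (simp add: cre_component diag_ext_def)
  qed (simp add: cre_component diag_ext_def)
qed

lemma ann_diag: "ann i (diag_ext s W) = s i *\<^sub>R diag_ext s (ann i W)"
  by (simp add: vec_eq_iff ann_component diag_ext_def)

lemma wedge_diag:
  assumes "\<And>i. s i \<noteq> 0"
  shows "ext_vec (\<chi> i. s i * v $ i) \<and>\<^sub>E diag_ext s W = diag_ext s (ext_vec v \<and>\<^sub>E W)"
  using assms by (simp add: wedge_ext_vec cre_diag linear_sum[OF linear_diag_ext] linear_scale[OF linear_diag_ext])

lemma iota_diag: "iota f (diag_ext s W) = diag_ext s (iota (\<chi> i. s i * f $ i) W)"
  by (simp add: iota_def ann_diag linear_sum[OF linear_diag_ext] linear_scale[OF linear_diag_ext] mult.commute)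

text \<open>The shear is multiplicative: \<open>ann_wedge\<close> produces the multiple
  \<open>v $ z\<close> of \<open>x\<close>, the mixed terms match by
  \<open>wedge_anticommute\<close>, and the quadratic term contains \<open>x\<close> twice.\<close>

lemma wedge_shear:
  assumes "x $ z = 0"
  shows "ext_vec (v + (v $ z) *\<^sub>R x) \<and>\<^sub>E shear_ext z x W = shear_ext z x (ext_vec v \<and>\<^sub>E W)"
proof -
  note bl = bilinear_wedge
  have "ext_vec x \<and>\<^sub>E (ext_vec v \<and>\<^sub>E ann z W) = - (ext_vec v \<and>\<^sub>E (ext_vec x \<and>\<^sub>E ann z W))" by (rule wedge_anticommute)
  thus ?thesis
    unfolding shear_ext_def ann_wedge ext_vec_add ext_vec_scale
    by (simp add: bilinear_ladd[OF bl] bilinear_radd[OF bl] bilinear_lmul[OF bl] bilinear_rmul[OF bl]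
        bilinear_rsub[OF bl] wedge_wedge_self)
qed

text \<open>The functional is pulled back along the shear, which adds its value at \<open>x\<close>
  to the coefficient at \<open>z\<close>.\<close>

lemma iota_shear:
  assumes "x $ z = 0"
  shows "iota f (shear_ext z x W) = shear_ext z x (iota (f + axis z (\<Sum>i\<in>UNIV. f $ i * x $ i)) W)"
proof -
  note bl = bilinear_wedge
  let ?c = "\<Sum>i\<in>UNIV. f $ i * x $ i"
  have aa: "ann z (ann z W) = 0" using ann_ann[of z z W] by (simp add: vec_eq_iff)
  have "iota f (shear_ext z x W) = iota f W + ?c *\<^sub>R ann z W - ext_vec x \<and>\<^sub>E iota f (ann z W)"
    unfolding shear_ext_def linear_add[OF linear_iota] iota_wedge by simp
  also have "\<dots> = shear_ext z x (iota (f + axis z ?c) W)"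
    unfolding shear_ext_def iota_add_left iota_axis linear_add[OF linear_ann] linear_scale[OF linear_ann] aa ann_iota
    by (simp add: bilinear_rneg[OF bl])
  finally show ?thesis .
qed

text \<open>The determinant of an exterior power of a diagonal matrix is a power of its determinant,
  as every index lies in the same number of \<open>k\<close>-sets.\<close>

lemma prod_subsets_of_card:
  fixes s :: "'m::finite \<Rightarrow> real"
  assumes "(\<Prod>i\<in>UNIV. s i) = 1"
  shows "(\<Prod>K\<in>UNIV. if card K = k then \<Prod>i\<in>K. s i else 1) = 1"
proof (cases k)
  case 0
  have "(if card K = k then \<Prod>i\<in>K. s i else 1) = 1" for K :: "'m set" using 0 by auto
  thus ?thesis by simp
next
  case (Suc l)
  have card_eq: "card {K. card K = k \<and> i \<in> K} = (CARD('m) - 1) choose l" for i :: 'm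
  proof -
    have "{K. card K = k \<and> i \<in> K} = insert i ` {H. H \<subseteq> UNIV - {i} \<and> card H = l}"
    proof (intro equalityI subsetI)
      fix K assume K: "K \<in> {K. card K = k \<and> i \<in> K}"
      hence "K = insert i (K - {i})" "card (K - {i}) = l" using Suc by auto
      thus "K \<in> insert i ` {H. H \<subseteq> UNIV - {i} \<and> card H = l}" by blast
    next
      fix K assume "K \<in> insert i ` {H. H \<subseteq> UNIV - {i} \<and> card H = l}"
      then obtain H where "K = insert i H" "i \<notin> H" "card H = l" by blast
      thus "K \<in> {K. card K = k \<and> i \<in> K}" using Suc by simp
    qed
    moreover have "inj_on (insert i) {H. H \<subseteq> UNIV - {i} \<and> card H = l}" by (auto simp: inj_on_def)
    ultimately show ?thesis by (simp add: card_image n_subsets)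
  qed
  have "(\<Prod>K\<in>UNIV. if card K = k then \<Prod>i\<in>K. s i else 1) =
      (\<Prod>K\<in>UNIV. \<Prod>i\<in>UNIV. if card K = k \<and> i \<in> K then s i else 1)"
  proof (rule prod.cong[OF refl])
    fix K :: "'m set"
    show "(if card K = k then \<Prod>i\<in>K. s i else 1) = (\<Prod>i\<in>UNIV. if card K = k \<and> i \<in> K then s i else 1)"
      by (simp add: prod.If_cases)
  qed
  also have "\<dots> = (\<Prod>i\<in>UNIV. \<Prod>K\<in>UNIV. if card K = k \<and> i \<in> K then s i else 1)" by (rule prod.swap)
  also have "\<dots> = (\<Prod>i\<in>UNIV. s i ^ ((CARD('m) - 1) choose l))"
    by (rule prod.cong[OF refl]) (simp add: prod.If_cases card_eq)
  also have "\<dots> = (\<Prod>i\<in>UNIV. s i) ^ ((CARD('m) - 1) choose l)" by (rule prod_power_distrib[symmetric])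
  finally show ?thesis using assms by simp
qed

lemma int_ext_power_iff: "W \<in> int_ext_power k \<longleftrightarrow> (\<forall>K. W $ K \<in> \<int> \<and> (card K \<noteq> k \<longrightarrow> W $ K = 0))"
  unfolding int_ext_power_def by (auto simp: ext_power_iff)

lemma wedge_ext_vec_component: "(ext_vec v \<and>\<^sub>E W) $ L = (\<Sum>i\<in>L. v $ i * wedge_sign {i} (L - {i}) * W $ (L - {i}))"
proof -
  have "(ext_vec v \<and>\<^sub>E W) $ L = (\<Sum>i\<in>UNIV. if i \<in> L then v $ i * wedge_sign {i} (L - {i}) * W $ (L - {i}) else 0)"
    by (simp add: wedge_ext_vec cre_component) (rule sum.cong, auto)
  thus ?thesis by (simp add: sum.If_cases)
qed

lemma iota_component: "iota f W $ K = (\<Sum>i\<in>-K. f $ i * wedge_sign {i} K * W $ insert i K)"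
proof -
  have "iota f W $ K = (\<Sum>i\<in>UNIV. if i \<in> - K then f $ i * wedge_sign {i} K * W $ insert i K else 0)"
    by (simp add: iota_def ann_component) (rule sum.cong, auto)
  also have "\<dots> = (\<Sum>i\<in>-K. f $ i * wedge_sign {i} K * W $ insert i K)"
    by (subst sum.If_cases) (auto intro: sum.cong simp: Compl_eq)
  finally show ?thesis .
qed

lemma wedge_int_ext_power:
  assumes "\<And>i. u $ i \<in> \<int>" "W \<in> int_ext_power k"
  shows "ext_vec u \<and>\<^sub>E W \<in> int_ext_power (Suc k)"
  unfolding int_ext_power_iff
proof (intro allI conjI impI)
  fix L
  show "(ext_vec u \<and>\<^sub>E W) $ L \<in> \<int>" unfolding wedge_ext_vec_component
    using assms by (intro Ints_sum Ints_mult wedge_sign_Ints) (auto simp: int_ext_power_iff)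
  assume L: "card L \<noteq> Suc k"
  have "W $ (L - {i}) = 0" if "i \<in> L" for i
  proof -
    have "card L = Suc (card (L - {i}))" by (rule card.remove[OF finite that])
    thus ?thesis using L assms(2) by (simp add: int_ext_power_iff)
  qed
  thus "(ext_vec u \<and>\<^sub>E W) $ L = 0" unfolding wedge_ext_vec_component by simp
qed

lemma iota_int_ext_power:
  assumes "\<And>i. f $ i \<in> \<int>" "W \<in> int_ext_power (Suc k)"
  shows "iota f W \<in> int_ext_power k"
  unfolding int_ext_power_iff
proof (intro allI conjI impI)
  fix K
  show "iota f W $ K \<in> \<int>" unfolding iota_component
    using assms by (intro Ints_sum Ints_mult wedge_sign_Ints) (auto simp: int_ext_power_iff)
  assume K: "card K \<noteq> k"
  have "W $ insert i K = 0" if "i \<in> - K" for i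
    using that K assms(2) by (simp add: int_ext_power_iff)
  thus "iota f W $ K = 0" unfolding iota_component by simp
qed

section \<open>The exterior powers of one unimodular lattice\<close>

locale unimodular_shear =
  fixes s :: "'m::{finite,linorder} \<Rightarrow> real" and z :: 'm and x :: "real ^ ('m::{finite,linorder})"
  assumes s_pos: "\<And>i. s i > 0" and s_prod: "(\<Prod>i\<in>UNIV. s i) = 1" and x_z: "x $ z = 0"
begin

definition ext_map :: "real ^ ('m set) \<Rightarrow> real ^ ('m set)" where
  "ext_map W = diag_ext s (shear_ext z x W)"

definition ext_lattice :: "nat \<Rightarrow> (real ^ ('m set)) set" where
  "ext_lattice k = ext_map ` int_ext_power k"

definition vec_map :: "real ^ ('m::{finite,linorder}) \<Rightarrow> real ^ ('m::{finite,linorder})" where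
  "vec_map u = (\<chi> i. s i * (u $ i + u $ z * x $ i))"

text \<open>The transpose of \<open>vec_map\<close>: the functional \<open>f\<close> composed with
  it. It is integral exactly if \<open>f\<close> belongs to the dual lattice.\<close>

definition dual_map :: "real ^ ('m::{finite,linorder}) \<Rightarrow> real ^ ('m::{finite,linorder})" where
  "dual_map f = (\<chi> i. s i * f $ i) + axis z (\<Sum>i\<in>UNIV. s i * f $ i * x $ i)"

lemma linear_ext_map: "linear ext_map"
  unfolding ext_map_def using linear_compose[OF linear_shear_ext linear_diag_ext] by (simp add: o_def)

lemma wedge_ext_map: "ext_vec (vec_map u) \<and>\<^sub>E ext_map W = ext_map (ext_vec u \<and>\<^sub>E W)"
proof -
  have s0: "s i \<noteq> 0" for i using s_pos[of i] by simp
  have "vec_map u = (\<chi> i. s i * (u + (u $ z) *\<^sub>R x) $ i)" by (simp add: vec_map_def)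
  thus ?thesis unfolding ext_map_def
    using wedge_diag[of s "u + (u $ z) *\<^sub>R x" "shear_ext z x W", OF s0] wedge_shear[OF x_z, of u W] by (simp only:)
qed

lemma iota_ext_map: "iota f (ext_map W) = ext_map (iota (dual_map f) W)"
  unfolding ext_map_def iota_diag iota_shear[OF x_z] dual_map_def by simp

lemma ext_map_component:
  "ext_map W $ K = (\<Prod>i\<in>K. s i) * (W $ K + (ext_vec x \<and>\<^sub>E ann z W) $ K)"
  by (simp add: ext_map_def diag_ext_def shear_ext_def)

text \<open>The shear reads coordinates at sets containing \<open>z\<close> and changes those at
  sets avoiding \<open>z\<close>: the block form that \<open>sheared_lattice\<close> asks
  for.\<close>

lemma wedge_ann_component:
  "(ext_vec x \<and>\<^sub>E ann z W) $ K = (if z \<in> K then 0 else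
    \<Sum>i\<in>K. x $ i * wedge_sign {i} (K - {i}) * (wedge_sign {z} (K - {i}) * W $ insert z (K - {i})))"
proof (cases "z \<in> K")
  case True
  have h: "x $ i * wedge_sign {i} (K - {i}) * ann z W $ (K - {i}) = 0" if "i \<in> K" for i
    using True x_z by (cases "i = z") (auto simp: ann_component)
  have "(ext_vec x \<and>\<^sub>E ann z W) $ K = 0"
    unfolding wedge_ext_vec_component by (rule sum.neutral) (use h in blast)
  thus ?thesis using True by simp
next
  case False
  thus ?thesis by (simp add: wedge_ext_vec_component ann_component)
qed

lemma ext_map_degree:
  assumes "\<And>K. card K \<noteq> k \<Longrightarrow> W $ K = 0" "card K \<noteq> k"
  shows "ext_map W $ K = 0"
proof -
  have "W $ insert z (K - {i}) = 0" if "i \<in> K" "z \<notin> K" for i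
  proof -
    have "card (insert z (K - {i})) = card K" using card.remove[OF finite that(1)] that(2) by simp
    thus ?thesis using assms by simp
  qed
  hence "(ext_vec x \<and>\<^sub>E ann z W) $ K = 0" unfolding wedge_ann_component by simp
  thus ?thesis using assms by (simp add: ext_map_component)
qed

lemma ext_lattice_support: "w \<in> ext_lattice k \<Longrightarrow> card K \<noteq> k \<Longrightarrow> w $ K = 0"
proof -
  assume w: "w \<in> ext_lattice k" and K: "card K \<noteq> k"
  obtain W where W: "w = ext_map W" "W \<in> int_ext_power k" using w by (auto simp: ext_lattice_def)
  show "w $ K = 0" unfolding W(1) by (rule ext_map_degree[OF _ K]) (use W(2) in \<open>simp add: int_ext_power_iff\<close>)
qed

lemma add_subgroup_ext_lattice: "add_subgroup (ext_lattice k)"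
  unfolding add_subgroup_def
proof (intro conjI ballI)
  have "(0 :: real ^ ('m set)) \<in> int_ext_power k" by (simp add: int_ext_power_iff)
  thus "0 \<in> ext_lattice k" unfolding ext_lattice_def
    by (rule image_eqI[rotated]) (simp add: linear_0[OF linear_ext_map])
  fix a b assume "a \<in> ext_lattice k" "b \<in> ext_lattice k"
  then obtain u v where uv: "a = ext_map u" "b = ext_map v" "u \<in> int_ext_power k" "v \<in> int_ext_power k"
    unfolding ext_lattice_def by blast
  have "a - b = ext_map (u - v)" unfolding uv linear_diff[OF linear_ext_map] ..
  moreover have "u - v \<in> int_ext_power k" using uv(3,4) by (auto simp: int_ext_power_iff)
  ultimately show "a - b \<in> ext_lattice k" unfolding ext_lattice_def by blast
qed

text \<open>The full set contains \<open>z\<close>, so the shear does not change that coordinate,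
  and the scaling factor is the product of all \<open>s i\<close>.\<close>

lemma ext_lattice_top:
  assumes "w \<in> ext_lattice CARD('m)"
  shows "w $ K \<in> \<int>"
proof (cases "K = UNIV")
  case True
  obtain W where W: "w = ext_map W" "W \<in> int_ext_power CARD('m)" using assms by (auto simp: ext_lattice_def)
  have "w $ UNIV = W $ UNIV" unfolding W(1) ext_map_component wedge_ann_component by (simp add: s_prod)
  thus ?thesis using W(2) True by (simp add: int_ext_power_iff)
next
  case False
  hence "card K \<noteq> CARD('m)" using card_subset_eq[of UNIV K] by auto
  thus ?thesis using ext_lattice_support[OF assms] by simp
qed

lemma ext_lattice_one:
  assumes "V \<in> ext_lattice 1"
  obtains u where "\<forall>i. u $ i \<in> \<int>" "V = ext_vec (vec_map u)"
proof -
  obtain W where W: "V = ext_map W" "W \<in> int_ext_power 1" using assms by (auto simp: ext_lattice_def)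
  define u :: "real ^ ('m::{finite,linorder})" where "u = (\<chi> i. W $ {i})"
  have u: "\<forall>i. u $ i \<in> \<int>" using W(2) by (simp add: u_def int_ext_power_iff)
  have e0: "(axis {} 1 :: real ^ ('m set)) $ K = (if K = {} then 1 else 0)" for K by (simp add: axis_def)
  \<comment> \<open>Multiplying by the unit of the exterior algebra reduces vectors to
    \<open>wedge_ext_map\<close>.\<close>
  have unit: "ext_vec v \<and>\<^sub>E axis {} 1 = ext_vec v" for v :: "real ^ ('m::{finite,linorder})"
  proof (rule vec_eq_iff[THEN iffD2], rule allI)
    fix L
    have "(ext_vec v \<and>\<^sub>E axis {} 1) $ L = (\<Sum>i\<in>L. if L = {i} then v $ i else 0)"
      unfolding wedge_ext_vec_component e0
    proof (rule sum.cong[OF refl])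
      fix i assume i: "i \<in> L"
      show "v $ i * wedge_sign {i} (L - {i}) * (if L - {i} = {} then 1 else 0) = (if L = {i} then v $ i else 0)"
      proof (cases "L = {i}")
        case True
        have "wedge_sign {i} {} = 1" by (simp add: wedge_sign_singleton)
        thus ?thesis unfolding True by simp
      next
        case False
        hence "L - {i} \<noteq> {}" using i by auto
        thus ?thesis using False by simp
      qed
    qed
    also have "\<dots> = (\<Sum>i\<in>UNIV. if L = {i} then v $ i else 0)" by (rule sum.mono_neutral_left) auto
    finally show "(ext_vec v \<and>\<^sub>E axis {} 1) $ L = ext_vec v $ L" by (simp add: ext_vec_component)
  qed
  have "W = ext_vec u"
  proof (rule vec_eq_iff[THEN iffD2], rule allI)
    fix L
    show "W $ L = ext_vec u $ L"
    proof (cases "card L = 1")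
      case True
      then obtain i where "L = {i}" by (auto simp: card_1_singleton_iff)
      thus ?thesis by (simp add: ext_vec_component u_def)
    next
      case False
      hence "L \<noteq> {i}" for i by auto
      thus ?thesis using W(2) False by (simp add: ext_vec_component int_ext_power_iff)
    qed
  qed
  moreover have "ext_map (axis {} 1) = axis {} 1"
    by (rule vec_eq_iff[THEN iffD2], rule allI) (auto simp: ext_map_component wedge_ann_component e0)
  ultimately have "V = ext_vec (vec_map u)" using wedge_ext_map[of u "axis {} 1"] W(1) unit by simp
  with u show ?thesis by (rule that)
qed

lemma wedge_ext_lattice:
  assumes "V \<in> ext_lattice 1" "w \<in> ext_lattice k"
  shows "V \<and>\<^sub>E w \<in> ext_lattice (Suc k)"
proof -
  obtain u where u: "\<forall>i. u $ i \<in> \<int>" "V = ext_vec (vec_map u)" by (rule ext_lattice_one[OF assms(1)])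
  obtain W where W: "w = ext_map W" "W \<in> int_ext_power k" using assms(2) by (auto simp: ext_lattice_def)
  have "ext_vec u \<and>\<^sub>E W \<in> int_ext_power (Suc k)" by (rule wedge_int_ext_power) (use u W in auto)
  thus ?thesis unfolding u(2) W(1) wedge_ext_map ext_lattice_def by (rule imageI)
qed

lemma iota_ext_lattice:
  assumes "\<And>i. dual_map f $ i \<in> \<int>" "w \<in> ext_lattice (Suc k)"
  shows "iota f w \<in> ext_lattice k"
proof -
  obtain W where W: "w = ext_map W" "W \<in> int_ext_power (Suc k)" using assms(2) by (auto simp: ext_lattice_def)
  have "iota (dual_map f) W \<in> int_ext_power k" by (rule iota_int_ext_power[OF assms(1) W(2)])
  thus ?thesis unfolding W(1) iota_ext_map ext_lattice_def by (rule imageI)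
qed

text \<open>Minkowski for the dual lattice. Its matrix is the inverse transpose, a shear into
  coordinate \<open>z\<close> followed by scaling with \<open>1 / s\<close>, again of determinant
  1.\<close>

lemma dual_vector:
  assumes "r > 1"
  obtains f where "f \<noteq> 0" "\<forall>i. \<bar>f $ i\<bar> < r" "\<forall>i. dual_map f $ i \<in> \<int>"
proof -
  define M where "M c = axis z (- (\<Sum>i\<in>UNIV. c $ i * x $ i))" for c :: "real ^ ('m::{finite,linorder})"
  let ?t = "\<lambda>i. 1 / s i"
  have t: "?t i > 0" for i using s_pos by simp
  have tp: "(\<Prod>i\<in>UNIV. ?t i) = 1" by (simp add: prod_dividef s_prod)
  have M: "Modules.additive M"
    by (auto simp: Modules.additive_def M_def vec_eq_iff axis_def sum.distrib algebra_simps)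
  have A1: "M c $ i = 0" if "i \<in> - {z}" for i c using that by (simp add: M_def axis_def)
  have A2: "M c = M d" if "\<And>i. i \<in> - {z} \<Longrightarrow> c $ i = d $ i" for c d
  proof -
    have "c $ i * x $ i = d $ i * x $ i" for i using that[of i] x_z by (cases "i = z") auto
    hence "(\<Sum>i\<in>UNIV. c $ i * x $ i) = (\<Sum>i\<in>UNIV. d $ i * x $ i)" by (intro sum.cong refl)
    thus ?thesis by (simp only: M_def)
  qed
  note lat = sheared_lattice[of ?t M "- {z}", OF t tp M A1 A2]
  let ?G = "(\<lambda>w. \<chi> c. 1 / s c * (w $ c + M w $ c)) ` {w. \<forall>c. w $ c \<in> \<int>}"
  have "\<exists>g\<in>?G. g \<noteq> 0 \<and> (\<forall>i. \<bar>g $ i\<bar> < r)"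
    by (rule minkowski_cube[OF lat(1,2) borel_closed[OF closed_cbox] _ lat(3) assms]) (simp_all only: lat(4) order_refl)
  then obtain w where w: "\<forall>c. w $ c \<in> \<int>" and g: "(\<chi> c. 1 / s c * (w $ c + M w $ c)) \<noteq> 0"
    "\<forall>i. \<bar>(\<chi> c. 1 / s c * (w $ c + M w $ c)) $ i\<bar> < r" by blast
  let ?f = "\<chi> c. 1 / s c * (w $ c + M w $ c)"
  have sf: "s i * ?f $ i = w $ i + M w $ i" for i using s_pos[of i] by simp
  have "(\<Sum>i\<in>UNIV. s i * ?f $ i * x $ i) = (\<Sum>i\<in>UNIV. w $ i * x $ i)"
  proof (rule sum.cong[OF refl])
    fix i
    show "s i * ?f $ i * x $ i = w $ i * x $ i"
      unfolding sf using A1[of i w] x_z by (cases "i = z") auto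
  qed
  hence "dual_map ?f = w" unfolding dual_map_def sf by (simp add: vec_eq_iff M_def axis_def)
  thus ?thesis using that[OF g] w by simp
qed

text \<open>The lattice occupies only the coordinates at sets of size \<open>k\<close>. Completing
  it by the integers in all other coordinates keeps the volume and adds no short vectors, so the
  volume argument runs in the full space; \<open>pr\<close> projects back.\<close>

lemma ext_lattice_almost_covers:
  assumes adm: "\<And>w. w \<in> ext_lattice k \<Longrightarrow> infnorm w \<le> e \<Longrightarrow> w = 0"
    and e: "0 < h" "h \<le> e" "e \<le> 1" "e ^ CARD('m set) + h ^ CARD('m set) > 1"
  shows "\<exists>g\<in>ext_lattice k. \<forall>K\<in>{K. card K = k}. - h < p K - g $ K \<and> p K - g $ K < 1"
proof -
  define t where "t K = (if card K = k then \<Prod>i\<in>K. s i else 1)" for K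
  define M where "M W = (\<chi> K. if card K = k then (ext_vec x \<and>\<^sub>E ann z W) $ K else 0)" for W
  let ?A = "{K. z \<in> K \<or> card K \<noteq> k}"
  have t: "t K > 0" for K unfolding t_def using s_pos by (simp add: prod_pos)
  have tp: "(\<Prod>K\<in>UNIV. t K) = 1" unfolding t_def by (rule prod_subsets_of_card[OF s_prod])
  have M: "Modules.additive M"
    by (auto simp: Modules.additive_def M_def vec_eq_iff linear_add[OF linear_ann] linear_add[OF linear_wedge])
  have A1: "M W $ K = 0" if "K \<in> ?A" for K W using that by (auto simp: M_def wedge_ann_component)
  have A2: "M W = M V" if eq: "\<And>K. K \<in> ?A \<Longrightarrow> W $ K = V $ K" for W V
    unfolding M_def wedge_ann_component using eq by (simp cong: if_cong sum.cong)
  note lat = sheared_lattice[of t M ?A, OF t tp M A1 A2]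
  let ?F = "\<lambda>W. \<chi> c. t c * (W $ c + M W $ c)"
  let ?G = "?F ` {W. \<forall>c. W $ c \<in> \<int>}"
  define pr where "pr g = (\<chi> K. if card K = k then g $ K else 0)" for g :: "real ^ ('m set)"
  have pr_lat: "pr (?F W) \<in> ext_lattice k" if W: "\<forall>c. W $ c \<in> \<int>" for W
  proof -
    have "pr W \<in> int_ext_power k" using W by (simp add: int_ext_power_iff pr_def)
    moreover have "pr (?F W) = ext_map (pr W)"
    proof (rule vec_eq_iff[THEN iffD2], rule allI)
      fix K
      show "pr (?F W) $ K = ext_map (pr W) $ K"
      proof (cases "card K = k")
        case True
        have "pr W $ insert z (K - {i}) = W $ insert z (K - {i})" if "i \<in> K" "z \<notin> K" for i
        proof -
          have "card (insert z (K - {i})) = card K" using card.remove[OF finite that(1)] that(2) by simp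
          thus ?thesis using True by (simp add: pr_def)
        qed
        hence "(ext_vec x \<and>\<^sub>E ann z (pr W)) $ K = (ext_vec x \<and>\<^sub>E ann z W) $ K"
          unfolding wedge_ann_component by simp
        thus ?thesis using True by (simp add: pr_def t_def M_def ext_map_component)
      next
        case False
        have "ext_map (pr W) $ K = 0" by (rule ext_map_degree[OF _ False]) (simp add: pr_def)
        thus ?thesis using False by (simp add: pr_def)
      qed
    qed
    ultimately show ?thesis unfolding ext_lattice_def by blast
  qed
  have pack: "g = 0" if g: "g \<in> ?G" "\<And>K. \<bar>g $ K\<bar> < e" for g
  proof -
    obtain W where W: "g = ?F W" "\<forall>c. W $ c \<in> \<int>" using g(1) by blast
    have "infnorm (pr g) \<le> e" unfolding infnorm_le_iff_cart using g(2) e by (simp add: pr_def less_imp_le)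
    hence "pr g = 0" using adm pr_lat[OF W(2)] W(1) by blast
    hence "g $ K = 0" if "card K = k" for K using that by (simp add: vec_eq_iff pr_def) metis
    moreover have "g $ K = 0" if "card K \<noteq> k" for K
    proof -
      have "g $ K = W $ K" using that unfolding W(1) by (simp add: t_def M_def)
      moreover obtain c where "W $ K = of_int c" using W(2) by (meson Ints_cases)
      ultimately show ?thesis using g(2)[of K] e(3) by simp
    qed
    ultimately show "g = 0" by (simp add: vec_eq_iff) metis
  qed
  have F1: "emeasure lborel (cbox 0 (\<chi> c. t c)) \<le> 1" by (simp only: lat(4) order_refl)
  have "\<exists>g\<in>?G. \<forall>K. - h < (\<chi> K. p K) $ K - g $ K \<and> (\<chi> K. p K) $ K - g $ K < 1"
    by (rule packing_almost_covers[OF lat(1,2) borel_closed[OF closed_cbox] F1 lat(3) pack e])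
  then obtain W where W: "\<forall>c. W $ c \<in> \<int>" "\<forall>K. - h < (\<chi> K. p K) $ K - ?F W $ K \<and> (\<chi> K. p K) $ K - ?F W $ K < 1"
    by blast
  have "pr (?F W) $ K = ?F W $ K" if "card K = k" for K using that by (simp add: pr_def)
  thus ?thesis using W(2) by (intro bexI[OF _ pr_lat[OF W(1)]]) auto
qed

end

section \<open>Matrix entries of the exchange operator\<close>

lemma axis_wedge: "axis {i} 1 \<and>\<^sub>E W = cre i W"
proof -
  have "axis {i} 1 \<and>\<^sub>E W = (\<Sum>j\<in>UNIV. if j = i then cre i W else 0)"
    unfolding ext_vec_axis[symmetric] wedge_ext_vec by (intro sum.cong) (auto simp: axis_def)
  thus ?thesis by simp
qed

lemma wedge_iota_axis_expand: "(ext_vec v \<and>\<^sub>E iota f (axis L 1)) $ L' =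
  (\<Sum>l\<in>L'. \<Sum>i\<in>-(L' - {l}). if insert i (L' - {l}) = L
    then v $ l * wedge_sign {l} (L' - {l}) * (f $ i * wedge_sign {i} (L' - {l})) else 0)"
  unfolding wedge_ext_vec_component iota_component sum_distrib_left
  by (intro sum.cong refl) (auto simp: axis_def)

text \<open>The only way from \<open>insert i K\<close> to \<open>insert l K\<close> is to contract
  \<open>i\<close> and multiply by \<open>l\<close>, so the double sum has one term.\<close>

lemma wedge_iota_axis_exchange:
  assumes "l \<noteq> i" "l \<notin> K" "i \<notin> K"
  shows "(ext_vec v \<and>\<^sub>E iota f (axis (insert i K) 1)) $ insert l K =
    wedge_sign {l} K * wedge_sign {i} K * (v $ l * f $ i)"
proof -
  let ?t = "\<lambda>l' i'. if insert i' (insert l K - {l'}) = insert i K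
    then v $ l' * wedge_sign {l'} (insert l K - {l'}) * (f $ i' * wedge_sign {i'} (insert l K - {l'})) else 0"
  have 1: "(\<Sum>i'\<in>-(insert l K - {l'}). ?t l' i') = 0" if "l' \<in> K" for l'
  proof (rule sum.neutral, rule ballI)
    fix i'
    have "l \<in> insert i' (insert l K - {l'})" using that assms by auto
    moreover have "l \<notin> insert i K" using assms by auto
    ultimately have "insert i' (insert l K - {l'}) \<noteq> insert i K" by metis
    thus "?t l' i' = 0" by simp
  qed
  have K: "insert l K - {l} = K" using assms by auto
  have 2: "(\<Sum>i'\<in>-K. ?t l i') = (\<Sum>i'\<in>-K. if i' = i then v $ l * wedge_sign {l} K * (f $ i * wedge_sign {i} K) else 0)"
  proof (rule sum.cong[OF refl])
    fix i' assume "i' \<in> - K"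
    hence "insert i' K = insert i K \<longleftrightarrow> i' = i" using assms by blast
    thus "?t l i' = (if i' = i then v $ l * wedge_sign {l} K * (f $ i * wedge_sign {i} K) else 0)"
      unfolding K by simp
  qed
  have "(ext_vec v \<and>\<^sub>E iota f (axis (insert i K) 1)) $ insert l K =
      (\<Sum>l'\<in>insert l K. \<Sum>i'\<in>-(insert l K - {l'}). ?t l' i')" by (rule wedge_iota_axis_expand)
  also have "\<dots> = (\<Sum>i'\<in>-(insert l K - {l}). ?t l i') + (\<Sum>l'\<in>K. \<Sum>i'\<in>-(insert l K - {l'}). ?t l' i')"
    by (rule sum.insert) (use assms in auto)
  also have "(\<Sum>l'\<in>K. \<Sum>i'\<in>-(insert l K - {l'}). ?t l' i') = 0"
    by (rule sum.neutral) (use 1 in blast)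
  also have "(\<Sum>i'\<in>-(insert l K - {l}). ?t l i') = (\<Sum>i'\<in>-K. ?t l i')" by (simp only: K)
  also have "\<dots> = v $ l * wedge_sign {l} K * (f $ i * wedge_sign {i} K)"
    unfolding 2 using assms by (subst sum.delta) auto
  finally show ?thesis by simp
qed

text \<open>Each index of \<open>L\<close> can be taken out and put back, with the same sign
  twice.\<close>

lemma wedge_iota_axis_diag: "(ext_vec v \<and>\<^sub>E iota f (axis L 1)) $ L = (\<Sum>i\<in>L. v $ i * f $ i)"
  unfolding wedge_iota_axis_expand
proof (rule sum.cong[OF refl])
  fix l assume l: "l \<in> L"
  let ?K = "L - {l}"
  have "(\<Sum>i\<in>-?K. if insert i ?K = L then v $ l * wedge_sign {l} ?K * (f $ i * wedge_sign {i} ?K) else 0) =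
      (\<Sum>i\<in>-?K. if i = l then v $ l * wedge_sign {l} ?K * (f $ l * wedge_sign {l} ?K) else 0)"
  proof (rule sum.cong[OF refl])
    fix i assume "i \<in> - ?K"
    hence "insert i ?K = L \<longleftrightarrow> i = l" using l by blast
    thus "(if insert i ?K = L then v $ l * wedge_sign {l} ?K * (f $ i * wedge_sign {i} ?K) else 0) =
      (if i = l then v $ l * wedge_sign {l} ?K * (f $ l * wedge_sign {l} ?K) else 0)" by simp
  qed
  also have "\<dots> = v $ l * wedge_sign {l} ?K * (f $ l * wedge_sign {l} ?K)" by (subst sum.delta) auto
  also have "\<dots> = (wedge_sign {l} ?K * wedge_sign {l} ?K) * (v $ l * f $ l)" by (simp only: ac_simps)
  finally show "(\<Sum>i\<in>-?K. if insert i ?K = L then v $ l * wedge_sign {l} ?K * (f $ i * wedge_sign {i} ?K) else 0) =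
    v $ l * f $ l" by (simp add: wedge_sign_square)
qed

text \<open>Distinct sets either differ by one exchange, with a single product as entry, or give the
  entry 0. So the bound on products carries over with no factor depending on the dimension.\<close>

lemma wedge_iota_axis_off_diag:
  assumes "L \<noteq> L'" and c: "\<And>l i. \<bar>v $ l * f $ i\<bar> \<le> c"
  shows "\<bar>(ext_vec v \<and>\<^sub>E iota f (axis L 1)) $ L'\<bar> \<le> c"
proof (cases "\<exists>l i. l \<in> L' \<and> i \<notin> L' - {l} \<and> insert i (L' - {l}) = L")
  case True
  then obtain l i where li: "l \<in> L'" "i \<notin> L' - {l}" "insert i (L' - {l}) = L" by blast
  define K where "K = L' - {l}"
  have L: "L = insert i K" "L' = insert l K" "l \<notin> K" "i \<notin> K" using li by (auto simp: K_def)
  have "l \<noteq> i" using assms(1) L by auto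
  from wedge_iota_axis_exchange[OF this L(3,4), of v f] have
    "\<bar>(ext_vec v \<and>\<^sub>E iota f (axis L 1)) $ L'\<bar> = \<bar>v $ l * f $ i\<bar>"
    unfolding L(1,2) by (simp only: abs_mult abs_wedge_sign mult_1_left)
  thus ?thesis using c by simp
next
  case False
  have "(ext_vec v \<and>\<^sub>E iota f (axis L 1)) $ L' = 0"
    unfolding wedge_iota_axis_expand using False by (intro sum.neutral ballI) auto
  moreover have "0 \<le> c" using c[of undefined undefined] by (meson abs_ge_zero order_trans)
  ultimately show ?thesis by simp
qed

text \<open>The ultrafilter turns a failure into short nonzero vectors for eventually all
  \<open>j\<close>, and boundedness makes them converge. The value 0 fills in where no short vector
  exists.\<close>

lemma not_nearly_admissible:
  assumes U: "ultrafilter U" and G: "\<And>j. 0 \<in> G j" and not: "\<not> nearly_admissible U G"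
  obtains e w w0 where "0 \<le> e" "e < 1" "\<forall>j. w j \<in> G j" "eventually (\<lambda>j. w j \<noteq> 0) U" "(w \<longlongrightarrow> w0) U" "infnorm w0 \<le> e"
proof -
  have Ubot: "U \<noteq> bot" using U by (simp add: ultrafilter_def)
  obtain e where e: "e < 1" "\<not> eventually (\<lambda>j. \<forall>v\<in>G j. infnorm v \<le> e \<longrightarrow> v = 0) U"
    using not unfolding nearly_admissible_def by blast
  define P where "P j v \<longleftrightarrow> v \<in> G j \<and> infnorm v \<le> e \<and> v \<noteq> 0" for j v
  have "eventually (\<lambda>j. \<not> (\<forall>v\<in>G j. infnorm v \<le> e \<longrightarrow> v = 0)) U"
    using U e(2) unfolding ultrafilter_def by blast
  hence ev: "eventually (\<lambda>j. \<exists>v. P j v) U" by (rule eventually_mono) (auto simp: P_def)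
  define w where "w j = (if \<exists>v. P j v then SOME v. P j v else 0)" for j
  have w: "P j (w j)" if "\<exists>v. P j v" for j
    unfolding w_def using that someI_ex[OF that] by simp
  have "w j \<in> G j" for j
    using w[of j] G[of j] by (cases "\<exists>v. P j v") (auto simp: P_def w_def)
  moreover have "eventually (\<lambda>j. w j \<noteq> 0) U" using ev by (rule eventually_mono) (use w in \<open>auto simp: P_def\<close>)
  moreover have le: "eventually (\<lambda>j. infnorm (w j) \<le> e) U" using ev by (rule eventually_mono) (use w in \<open>auto simp: P_def\<close>)
  hence "eventually (\<lambda>j. w j \<in> cbox (\<chi> i. - e) (\<chi> i. e)) U"
    by (rule eventually_mono) (simp add: infnorm_le_iff_cart mem_box_cart abs_le_iff, metis minus_le_iff)
  from ultrafilter_tendsto[OF U bounded_cbox this] obtain w0 where w0: "(w \<longlongrightarrow> w0) U" by blast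
  moreover have i: "infnorm w0 \<le> e" by (rule tendsto_upperbound[OF tendsto_infnorm[OF w0] le Ubot])
  moreover have "0 \<le> e" using i infnorm_pos_le[of w0] by linarith
  ultimately show ?thesis using that[of e w w0] e(1) by simp
qed

section \<open>Sequences of lattices: from vectors to higher powers\<close>

locale shear_sequence =
  fixes s :: "nat \<Rightarrow> 'm::{finite,linorder} \<Rightarrow> real" and z :: 'm and x :: "real ^ ('m::{finite,linorder})" and U :: "nat filter"
  assumes shear: "\<And>j. unimodular_shear (s j) z x" and U: "ultrafilter U" "U \<le> sequentially"
begin

definition lat :: "nat \<Rightarrow> nat \<Rightarrow> (real ^ ('m set)) set" where
  "lat k j = unimodular_shear.ext_lattice (s j) z x k"

lemma Ubot: "U \<noteq> bot" using U by (simp add: ultrafilter_def)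

lemma lat_subgroup: "add_subgroup (lat k j)"
  unfolding lat_def by (rule unimodular_shear.add_subgroup_ext_lattice[OF shear])

lemma lat_support: "w \<in> lat k j \<Longrightarrow> card K \<noteq> k \<Longrightarrow> w $ K = 0"
  unfolding lat_def by (rule unimodular_shear.ext_lattice_support[OF shear])

lemma lat_wedge: "V \<in> lat 1 j \<Longrightarrow> w \<in> lat k j \<Longrightarrow> V \<and>\<^sub>E w \<in> lat (Suc k) j"
  unfolding lat_def by (rule unimodular_shear.wedge_ext_lattice[OF shear])

lemma lat_tiling:
  assumes "nearly_admissible U (lat k)"
  shows "lattice_tiling {K. card K = k} (limit_lattice U (lat k))"
proof (rule lattice_tiling_limit[OF U lat_subgroup assms])
  show "g $ K = 0" if "g \<in> lat k j" "K \<notin> {K. card K = k}" for j g K using lat_support that by blast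
  fix p and h :: real assume h: "0 < h" "h < 1"
  let ?D = "CARD('m set)"
  \<comment> \<open>The root makes \<open>e ^ ?D\<close> at least \<open>1 - h ^ ?D / 2\<close>,
    which meets the volume condition with \<open>e\<close> still below 1; the maximum ensures
    \<open>h \<le> e\<close>.\<close>
  define e where "e = max h (root ?D (1 - h ^ ?D / 2))"
  have D: "?D > 0" by simp
  have hD: "0 < h ^ ?D" "h ^ ?D < 1" using h by (auto simp: power_less_one_iff)
  have r: "0 \<le> root ?D (1 - h ^ ?D / 2)" "root ?D (1 - h ^ ?D / 2) < 1"
    using hD D by (auto simp: real_root_lt_1_iff)
  have e: "h \<le> e" "e < 1" unfolding e_def using h r by auto
  have "1 - h ^ ?D / 2 = root ?D (1 - h ^ ?D / 2) ^ ?D" using hD D by simp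
  also have "\<dots> \<le> e ^ ?D" by (rule power_mono) (use r in \<open>auto simp: e_def\<close>)
  finally have sum: "e ^ ?D + h ^ ?D > 1" using hD by linarith
  have "eventually (\<lambda>j. \<forall>v\<in>lat k j. infnorm v \<le> e \<longrightarrow> v = 0) U"
    using assms e(2) unfolding nearly_admissible_def by blast
  thus "eventually (\<lambda>j. \<exists>g\<in>lat k j. \<forall>K\<in>{K. card K = k}. - h < p K - g $ K \<and> p K - g $ K < 1 + h) U"
  proof eventually_elim
    case (elim j)
    have "\<exists>g\<in>lat k j. \<forall>K\<in>{K. card K = k}. - h < p K - g $ K \<and> p K - g $ K < 1"
      unfolding lat_def
      by (rule unimodular_shear.ext_lattice_almost_covers[OF shear _ h(1) e(1) less_imp_le[OF e(2)] sum])
        (use elim in \<open>auto simp: lat_def\<close>)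
    thus ?case using h(1) by force
  qed
qed

lemma nearly_admissible_top: "nearly_admissible U (lat CARD('m))"
  unfolding nearly_admissible_def
proof (intro allI impI always_eventually ballI)
  fix e :: real and j v assume e: "e < 1" and v: "v \<in> lat CARD('m) j" "infnorm v \<le> e"
  have "v $ K = 0" for K
  proof -
    have "v $ K \<in> \<int>" using v(1) unfolding lat_def by (rule unimodular_shear.ext_lattice_top[OF shear])
    then obtain c where "v $ K = of_int c" by (rule Ints_cases)
    moreover have "\<bar>v $ K\<bar> < 1" using v(2) e infnorm_le_iff_cart[of v e] by (meson le_less_trans)
    ultimately show ?thesis by simp
  qed
  thus "v = 0" by (simp add: vec_eq_iff)
qed

text \<open>Multiplication by a basis vector moves coordinates or drops them, up to sign, so the
  images of the axes in the limit are as short as \<open>w0\<close> and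
  \<open>flag_annihilation\<close> applies. Below the top degree, a \<open>w j\<close> annihilated
  by all basis vectors is zero.\<close>

lemma nearly_admissible_down:
  assumes adm1: "nearly_admissible U (lat 1)" and admk: "nearly_admissible U (lat (Suc k))" and k: "k < CARD('m)"
  shows "nearly_admissible U (lat k)"
proof (rule ccontr)
  assume not: "\<not> nearly_admissible U (lat k)"
  obtain e w w0 where w: "0 \<le> e" "e < 1" "\<forall>j. w j \<in> lat k j" "eventually (\<lambda>j. w j \<noteq> 0) U" "(w \<longlongrightarrow> w0) U"
    "infnorm w0 \<le> e"
    by (rule not_nearly_admissible[OF U(1) add_subgroupD(1)[OF lat_subgroup] not])
  let ?I = "{K :: 'm set. card K = 1}"
  obtain rk :: "'m set \<Rightarrow> nat" where rk: "inj_on rk ?I"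
    "\<forall>K\<in>?I. (\<forall>v\<in>limit_lattice U (lat 1). (\<forall>c\<in>?I. rk c < rk K \<longrightarrow> v $ c = 0) \<longrightarrow> v $ K \<in> \<int>) \<and>
      (\<exists>b\<in>limit_lattice U (lat 1). b $ K = 1 \<and> (\<forall>c\<in>?I. rk c < rk K \<longrightarrow> b $ c = 0))"
    using hajos_flag[OF lat_tiling[OF adm1]] by (elim exE conjE)
  have "eventually (\<lambda>j. \<forall>K\<in>?I. axis K 1 \<and>\<^sub>E w j = 0) U"
  proof (rule flag_annihilation[OF U(1), where A = "lat 1" and B = "lat (Suc k)" and T = "\<lambda>j V. V \<and>\<^sub>E w j" and rk = rk
        and t = "\<lambda>K. axis K 1 \<and>\<^sub>E w0", OF _ _ admk _ rk(1)])
    show "linear (\<lambda>V. V \<and>\<^sub>E w j)" for j by (rule bilinear_wedge[unfolded bilinear_def, THEN conjunct2, rule_format])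
    show "v \<and>\<^sub>E w j \<in> lat (Suc k) j" if "v \<in> lat 1 j" for j v using lat_wedge[OF that] w(3) by blast
    show "v $ K = 0" if "v \<in> lat 1 j" "K \<notin> ?I" for j v K using lat_support that by blast
    show "\<exists>b\<in>limit_lattice U (lat 1). b $ K = 1 \<and> (\<forall>c\<in>?I. rk c < rk K \<longrightarrow> b $ c = 0)" if "K \<in> ?I" for K
      using rk(2) that by blast
    fix K :: "'m set" assume "K \<in> ?I"
    then obtain i where K: "K = {i}" by (auto simp: card_1_singleton_iff)
    show "((\<lambda>j. axis K 1 \<and>\<^sub>E w j) \<longlongrightarrow> axis K 1 \<and>\<^sub>E w0) U"
      unfolding K axis_wedge
      by (rule bounded_linear.tendsto[OF linear_conv_bounded_linear[THEN iffD1, OF linear_cre] w(5)])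
    have "\<bar>cre i w0 $ L\<bar> \<le> e" for L
      using w(1,6) by (simp add: cre_component abs_mult abs_wedge_sign infnorm_le_iff_cart)
    hence "infnorm (cre i w0) \<le> e" by (simp add: infnorm_le_iff_cart)
    thus "infnorm (axis K 1 \<and>\<^sub>E w0) < 1" unfolding K axis_wedge using w(2) by simp
  qed
  hence "eventually (\<lambda>j. False) U" using w(4)
  proof eventually_elim
    case (elim j)
    have "w j $ K = 0" for K
    proof (cases "card K = k")
      case True
      hence "K \<noteq> UNIV" using k by auto
      then obtain i where i: "i \<notin> K" by auto
      have "axis {i} 1 \<and>\<^sub>E w j = 0" using elim(1) by simp
      hence "cre i (w j) $ insert i K = 0" unfolding axis_wedge by simp
      hence "wedge_sign {i} K * w j $ K = 0" using i by (simp add: cre_component)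
      thus ?thesis using abs_wedge_sign[of "{i}" K] by auto
    next
      case False thus ?thesis using lat_support w(3) by blast
    qed
    thus False using elim(2) by (simp add: vec_eq_iff)
  qed
  thus False using Ubot by (simp add: trivial_limit_def)
qed

theorem nearly_admissible_powers:
  assumes adm1: "nearly_admissible U (lat 1)" and k: "k \<le> CARD('m)"
  shows "nearly_admissible U (lat k)"
  using k
proof (induction "CARD('m) - k" arbitrary: k)
  case 0
  hence "k = CARD('m)" by simp
  thus ?case using nearly_admissible_top by simp
next
  case (Suc d)
  hence "nearly_admissible U (lat (Suc k))" by (intro Suc.hyps(1)) auto
  thus ?case by (rule nearly_admissible_down[OF adm1]) (use Suc.hyps(2) in simp)
qed

end

section \<open>From one power back to vectors\<close>

lemma tendsto_wedge_iota:
  assumes "(v \<longlongrightarrow> v0) F" "(f \<longlongrightarrow> f0) F" "(W \<longlongrightarrow> W0) F"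
  shows "((\<lambda>j. ext_vec (v j) \<and>\<^sub>E iota (f j) (W j)) \<longlongrightarrow> ext_vec v0 \<and>\<^sub>E iota f0 W0) F"
proof -
  have cre: "((\<lambda>j. cre i (H j)) \<longlongrightarrow> cre i H0) F" if "(H \<longlongrightarrow> H0) F" for i H H0
    by (rule bounded_linear.tendsto[OF linear_conv_bounded_linear[THEN iffD1, OF linear_cre] that])
  have ann: "((\<lambda>j. ann i (H j)) \<longlongrightarrow> ann i H0) F" if "(H \<longlongrightarrow> H0) F" for i H H0
    by (rule bounded_linear.tendsto[OF linear_conv_bounded_linear[THEN iffD1, OF linear_ann] that])
  have "((\<lambda>j. iota (f j) (W j)) \<longlongrightarrow> iota f0 W0) F"
    unfolding iota_def by (intro tendsto_sum tendsto_scaleR tendsto_vec_nth assms(2) ann[OF assms(3)])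
  from cre[OF this] show ?thesis
    unfolding wedge_ext_vec by (intro tendsto_sum tendsto_scaleR tendsto_vec_nth assms(1))
qed

lemma linear_wedge_iota: "linear (\<lambda>W. ext_vec v \<and>\<^sub>E iota f W)"
  using linear_compose[OF linear_iota linear_wedge] by (simp add: o_def)

text \<open>Two \<open>k\<close>-sets related by the exchange of \<open>l\<close> and
  \<open>i\<close> exist as long as \<open>k\<close> is neither 0 nor the full size.\<close>

lemma exists_subset_avoiding:
  fixes l i :: "'m::finite"
  assumes "k < CARD('m)" "l \<noteq> i" "k > 0"
  obtains K where "l \<notin> K" "i \<notin> K" "card (insert l K) = k" "card (insert i K) = k"
proof -
  have "card (UNIV - {l, i}) = CARD('m) - 2" using assms(2) by (subst card_Diff_subset) auto
  hence "k - 1 \<le> card (UNIV - {l, i})" using assms by linarith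
  then obtain K where K: "K \<subseteq> UNIV - {l, i}" "card K = k - 1" by (meson obtain_subset_with_card_n)
  show ?thesis by (rule that[of K]) (use K assms in \<open>auto simp: card_insert_if\<close>)
qed

text \<open>Columns are treated from the highest rank down. Up to rank \<open>rk i\<close> the flag
  vector \<open>b\<close> has the same image as \<open>axis i 1\<close>, since later columns vanish
  there. Subtracting the integral part of the diagonal entry times \<open>b\<close> leaves a vector
  of \<open>M\<close> with all these coordinates below 1 in size; from the lowest rank up, the flag
  makes each of them an integer, hence zero.\<close>

lemma short_operator_triangular:
  fixes M :: "(real ^ 'i::finite) set" and rk :: "'i \<Rightarrow> nat" and E :: "real ^ 'i \<Rightarrow> real ^ 'i"
  assumes M: "add_subgroup M" and supp: "\<And>v i. v \<in> M \<Longrightarrow> i \<notin> I \<Longrightarrow> v $ i = 0" and inj: "inj_on rk I"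
    and int: "\<And>v i. v \<in> M \<Longrightarrow> i \<in> I \<Longrightarrow> (\<And>c. c \<in> I \<Longrightarrow> rk c < rk i \<Longrightarrow> v $ c = 0) \<Longrightarrow> v $ i \<in> \<int>"
    and one: "\<And>i. i \<in> I \<Longrightarrow> \<exists>b\<in>M. b $ i = 1 \<and> (\<forall>c\<in>I. rk c < rk i \<longrightarrow> b $ c = 0)"
    and E: "linear E" "\<And>v. v \<in> M \<Longrightarrow> E v \<in> M"
    and off: "\<And>i c. i \<in> I \<Longrightarrow> c \<in> I \<Longrightarrow> c \<noteq> i \<Longrightarrow> \<bar>E (axis i 1) $ c\<bar> < 1"
    and i: "i \<in> I"
  shows "E (axis i 1) $ i \<in> \<int>" "\<And>c. c \<in> I \<Longrightarrow> rk c < rk i \<Longrightarrow> E (axis i 1) $ c = 0"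
proof -
  define P where "P i \<longleftrightarrow> E (axis i 1) $ i \<in> \<int> \<and> (\<forall>c\<in>I. rk c < rk i \<longrightarrow> E (axis i 1) $ c = 0)" for i
  have fin: "finite I" by simp
  have "P i"
  proof (rule rank_descend[OF fin _ i])
    fix i assume i: "i \<in> I" and IH: "\<And>c. c \<in> I \<Longrightarrow> rk i < rk c \<Longrightarrow> P c"
    obtain b where b: "b \<in> M" "b $ i = 1" "\<forall>c\<in>I. rk c < rk i \<longrightarrow> b $ c = 0" using one[OF i] by blast
    have Eb: "E b $ c = E (axis i 1) $ c" if c: "c \<in> I" "rk c \<le> rk i" for c
    proof -
      have "E b = (\<Sum>c\<in>I. b $ c *\<^sub>R E (axis c 1))"
        by (rule linear_axis_expansion[OF E(1) supp[OF b(1)]])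
      hence "E b $ c = (\<Sum>d\<in>I. b $ d *\<^sub>R (E (axis d 1) $ c))" by (simp add: sum_component)
      also have "\<dots> = E (axis i 1) $ c"
      proof (rule rank_sum[where a="\<lambda>d. b $ d", OF fin inj i b(2)])
        show "b $ d = 0" if "d \<in> I" "rk d < rk i" for d using b(3) that by blast
        show "E (axis d 1) $ c = 0" if "d \<in> I" "rk i < rk d" for d
          using IH[OF that] c that unfolding P_def by simp
      qed
      finally show ?thesis .
    qed
    define n where "n = \<lfloor>E (axis i 1) $ i\<rfloor>"
    define u where "u = E b - of_int n *\<^sub>R b"
    have u: "u \<in> M" unfolding u_def
      by (intro add_subgroupD(2)[OF M] E(2) add_subgroup_of_int[OF M] b(1))
    have uc: "u $ c = E (axis i 1) $ c" if "c \<in> I" "rk c < rk i" for c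
      using Eb[OF that(1)] that b(3) by (simp add: u_def)
    have ui: "u $ i = E (axis i 1) $ i - of_int n" using Eb[OF i] b(2) by (simp add: u_def)
    have low: "u $ c = 0" if "c \<in> I" "rk c \<le> rk i" for c
      using that
    proof (induction "rk c" arbitrary: c rule: less_induct)
      case less
      have "u $ c \<in> \<int>" by (rule int[OF u less.prems(1)]) (use less.hyps less.prems in auto)
      then obtain k where k: "u $ c = of_int k" by (rule Ints_cases)
      have "\<bar>u $ c\<bar> < 1"
      proof (cases "rk c = rk i")
        case True
        hence "c = i" using inj_onD[OF inj _ less.prems(1) i] by simp
        thus ?thesis using ui unfolding n_def by simp linarith
      next
        case False
        hence lt: "rk c < rk i" using less.prems(2) by simp
        hence "c \<noteq> i" by auto
        thus ?thesis using uc[OF less.prems(1) lt] off[OF i less.prems(1)] by simp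
      qed
      thus ?case unfolding k by simp
    qed
    show "P i" unfolding P_def
    proof (intro conjI ballI impI)
      have "E (axis i 1) $ i = of_int n" using low[OF i] ui by simp
      thus "E (axis i 1) $ i \<in> \<int>" by simp
      show "E (axis i 1) $ c = 0" if "c \<in> I" "rk c < rk i" for c using low[OF that(1)] uc[OF that] that(2) by simp
    qed
  qed
  thus "E (axis i 1) $ i \<in> \<int>" "\<And>c. c \<in> I \<Longrightarrow> rk c < rk i \<Longrightarrow> E (axis i 1) $ c = 0" by (auto simp: P_def)
qed

context shear_sequence
begin

lemma lat_one_vector:
  assumes "V \<in> lat 1 j"
  shows "V = ext_vec (\<chi> i. V $ {i})"
proof (rule vec_eq_iff[THEN iffD2], rule allI)
  fix L
  show "V $ L = ext_vec (\<chi> i. V $ {i}) $ L"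
  proof (cases "card L = 1")
    case True
    then obtain i where "L = {i}" by (auto simp: card_1_singleton_iff)
    thus ?thesis by (simp add: ext_vec_component)
  next
    case False
    hence "L \<noteq> {i}" for i by auto
    thus ?thesis using lat_support[OF assms False] by (simp add: ext_vec_component)
  qed
qed

text \<open>A short vector \<open>v\<close> of the lattice and a dual vector \<open>f\<close> of norm about 1 give the integral
  operator \<open>v \<and> (f \<rfloor> _)\<close>, whose matrix entries are single products of coordinates
  of \<open>v\<close> and \<open>f\<close>, hence short. Triangularity forces the supports of \<open>v\<close> and \<open>f\<close> to be disjoint
  and then the operator to vanish.\<close>

theorem nearly_admissible_vectors:
  assumes k: "0 < k" "k < CARD('m)" and adm: "nearly_admissible U (lat k)"
  shows "nearly_admissible U (lat 1)"
proof (rule ccontr)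
  assume not: "\<not> nearly_admissible U (lat 1)"
  obtain e V V0 where V: "0 \<le> e" "e < 1" "\<forall>j. V j \<in> lat 1 j" "eventually (\<lambda>j. V j \<noteq> 0) U" "(V \<longlongrightarrow> V0) U"
    "infnorm V0 \<le> e"
    by (rule not_nearly_admissible[OF U(1) add_subgroupD(1)[OF lat_subgroup] not])
  define v where "v j = (\<chi> i. V j $ {i})" for j
  define v0 where "v0 = (\<chi> i. V0 $ {i})"
  have Vv: "V j = ext_vec (v j)" for j unfolding v_def by (rule lat_one_vector) (use V(3) in blast)
  have v: "(v \<longlongrightarrow> v0) U"
    by (rule vec_tendstoI) (simp add: v_def v0_def tendsto_vec_nth[OF V(5)])
  have v0: "\<bar>v0 $ i\<bar> \<le> e" for i using V(6) by (simp add: v0_def infnorm_le_iff_cart)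
  \<comment> \<open>Any \<open>r\<close> with \<open>1 < r\<close> and \<open>e * r < 1\<close>
    would do: the first provides dual vectors, the second keeps products of coordinates below
    1.\<close>
  define r where "r = 2 / (1 + e)"
  have r: "r > 1" "e * r < 1" "r \<ge> 0" unfolding r_def using V(1,2) by (simp_all add: field_simps)
  have "\<exists>f. f \<noteq> 0 \<and> (\<forall>i. \<bar>f $ i\<bar> < r) \<and> (\<forall>i. unimodular_shear.dual_map (s j) z x f $ i \<in> \<int>)" for j
    by (rule unimodular_shear.dual_vector[OF shear[of j] r(1)]) blast
  then obtain f where f: "\<And>j. f j \<noteq> 0" "\<And>j i. \<bar>f j $ i\<bar> < r"
    "\<And>j i. unimodular_shear.dual_map (s j) z x (f j) $ i \<in> \<int>" by metis
  have "f j \<in> cbox (\<chi> i. - r) (\<chi> i. r)" for j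
  proof -
    have "- r \<le> f j $ i \<and> f j $ i \<le> r" for i using f(2)[of j i] by linarith
    thus ?thesis by (simp add: mem_box_cart)
  qed
  hence "eventually (\<lambda>j. f j \<in> cbox (\<chi> i. - r) (\<chi> i. r)) U" by simp
  from ultrafilter_tendsto[OF U(1) bounded_cbox this] obtain f0 where f0: "(f \<longlongrightarrow> f0) U" by blast
  have f0r: "\<bar>f0 $ i\<bar> \<le> r" for i
    by (rule tendsto_upperbound[OF tendsto_rabs[OF tendsto_vec_nth[OF f0]] _ Ubot]) (simp add: less_imp_le f(2))
  have prod: "\<bar>v0 $ l * f0 $ i\<bar> \<le> e * r" for l i
    unfolding abs_mult by (rule mult_mono[OF v0 f0r V(1)]) simp
  define E where "E W = ext_vec v0 \<and>\<^sub>E iota f0 W" for W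
  define T where "T j W = ext_vec (v j) \<and>\<^sub>E iota (f j) W" for j W
  have T: "T j w \<in> lat k j" if "w \<in> lat k j" for j w
  proof -
    obtain l where l: "k = Suc l" using k(1) by (cases k) auto
    have "iota (f j) w \<in> lat l j"
      unfolding lat_def by (rule unimodular_shear.iota_ext_lattice[OF shear f(3)]) (use that l in \<open>simp add: lat_def\<close>)
    hence "V j \<and>\<^sub>E iota (f j) w \<in> lat (Suc l) j" using lat_wedge V(3) by blast
    thus ?thesis by (simp add: T_def Vv l)
  qed
  have TE: "((\<lambda>j. T j (W j)) \<longlongrightarrow> E W0) U" if "(W \<longlongrightarrow> W0) U" for W W0
    unfolding T_def E_def by (rule tendsto_wedge_iota[OF v f0 that])
  let ?I = "{K :: 'm set. card K = k}"
  let ?L = "limit_lattice U (lat k)"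
  obtain rk :: "'m set \<Rightarrow> nat" where rk: "inj_on rk ?I"
    "\<forall>K\<in>?I. (\<forall>v\<in>?L. (\<forall>c\<in>?I. rk c < rk K \<longrightarrow> v $ c = 0) \<longrightarrow> v $ K \<in> \<int>) \<and>
      (\<exists>b\<in>?L. b $ K = 1 \<and> (\<forall>c\<in>?I. rk c < rk K \<longrightarrow> b $ c = 0))"
    using hajos_flag[OF lat_tiling[OF adm]] by (elim exE conjE)
  have EL: "E w \<in> ?L" if "w \<in> ?L" for w
  proof -
    obtain g where g: "\<forall>j. g j \<in> lat k j" "(g \<longlongrightarrow> w) U" using \<open>w \<in> ?L\<close> unfolding limit_lattice_def by blast
    show ?thesis unfolding limit_lattice_def
      by (rule CollectI, rule exI[of _ "\<lambda>j. T j (g j)"]) (use T TE g in auto)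
  qed
  have off: "\<bar>E (axis K 1) $ c\<bar> < 1" if "c \<noteq> K" for K c
  proof -
    have "\<bar>E (axis K 1) $ c\<bar> \<le> e * r"
      unfolding E_def by (rule wedge_iota_axis_off_diag[OF _ prod]) (use that in auto)
    thus ?thesis using r(2) by linarith
  qed
  have suppL: "w $ K = 0" if "w \<in> ?L" "K \<notin> ?I" for w K
    by (rule limit_lattice_support[OF U(1) that(1)]) (use that(2) lat_support in blast)
  have intL: "w $ K \<in> \<int>" if "w \<in> ?L" "K \<in> ?I" "\<And>c. c \<in> ?I \<Longrightarrow> rk c < rk K \<Longrightarrow> w $ c = 0" for w K
    using rk(2) that by blast
  have oneL: "\<exists>b\<in>?L. b $ K = 1 \<and> (\<forall>c\<in>?I. rk c < rk K \<longrightarrow> b $ c = 0)" if "K \<in> ?I" for K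
    using rk(2) that by blast
  have linE: "linear E" unfolding E_def by (rule linear_wedge_iota)
  have sublim: "add_subgroup ?L" by (rule add_subgroup_limit_lattice[OF lat_subgroup])
  have diag_int: "E (axis K 1) $ K \<in> \<int>" if "K \<in> ?I" for K
    by (rule short_operator_triangular(1)[OF sublim suppL rk(1) intL oneL linE EL off that])
  have tri: "E (axis K 1) $ c = 0" if "K \<in> ?I" "c \<in> ?I" "rk c < rk K" for K c
    by (rule short_operator_triangular(2)[OF sublim suppL rk(1) intL oneL linE EL off that])
  have diag: "E (axis K 1) $ K = (\<Sum>i\<in>K. v0 $ i * f0 $ i)" for K unfolding E_def by (rule wedge_iota_axis_diag)
  have exch: "\<exists>\<epsilon>. \<epsilon> \<noteq> 0 \<and> E (axis (insert i K) 1) $ insert l K = \<epsilon> * (v0 $ l * f0 $ i)"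
    if "l \<noteq> i" "l \<notin> K" "i \<notin> K" for l i K
  proof -
    have "wedge_sign {l} K * wedge_sign {i} K \<noteq> 0" using abs_wedge_sign[of "{l}" K] abs_wedge_sign[of "{i}" K] by auto
    thus ?thesis unfolding E_def wedge_iota_axis_exchange[OF that] by blast
  qed
  \<comment> \<open>Were the product at \<open>i\<close> nonzero, exchange \<open>i\<close> with
    some \<open>l\<close>. One of the two exchange entries lies on the vanishing side of the
    triangle, which forces the product at \<open>l\<close> to be 0. Then the product at
    \<open>i\<close> is a difference of integral diagonal entries and is below 1 in size.\<close>
  have disj: "v0 $ i * f0 $ i = 0" for i
  proof (rule ccontr)
    assume ne: "v0 $ i * f0 $ i \<noteq> 0"
    have "1 < CARD('m)" using k by simp
    hence "UNIV \<noteq> {i}" by (metis card.empty card.insert empty_iff finite.emptyI less_irrefl One_nat_def)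
    then obtain l where l: "l \<noteq> i" by blast
    obtain K where K: "l \<notin> K" "i \<notin> K" "card (insert l K) = k" "card (insert i K) = k"
      by (rule exists_subset_avoiding[OF k(2) l k(1)])
    have I: "insert l K \<in> ?I" "insert i K \<in> ?I" using K by auto
    have "insert l K \<noteq> insert i K" using K l by auto
    hence "rk (insert l K) \<noteq> rk (insert i K)" using inj_onD[OF rk(1) _ I] by blast
    then consider "rk (insert l K) < rk (insert i K)" | "rk (insert i K) < rk (insert l K)" by linarith
    hence "v0 $ l * f0 $ l = 0"
    proof cases
      case 1
      have "v0 $ l * f0 $ i = 0" using exch[OF l K(1,2)] tri[OF I(2,1) 1] by auto
      thus ?thesis using ne by auto
    next
      case 2
      have "v0 $ i * f0 $ l = 0" using exch[OF l[symmetric] K(2,1)] tri[OF I(1,2) 2] by auto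
      thus ?thesis using ne by auto
    qed
    moreover have "(\<Sum>h\<in>insert i K. v0 $ h * f0 $ h) - (\<Sum>h\<in>insert l K. v0 $ h * f0 $ h) \<in> \<int>"
      using diag_int[OF I(1)] diag_int[OF I(2)] unfolding diag by (rule Ints_diff[rotated])
    ultimately have "v0 $ i * f0 $ i \<in> \<int>" using K by auto
    then obtain n where n: "v0 $ i * f0 $ i = of_int n" by (rule Ints_cases)
    have "\<bar>v0 $ i * f0 $ i\<bar> < 1" using prod[of i i] r(2) by linarith
    thus False using ne unfolding n by simp
  qed
  \<comment> \<open>Only now are the diagonal entries, being sums, known to be small, so that every
    column is short enough for \<open>flag_annihilation\<close>.\<close>
  have "eventually (\<lambda>j. \<forall>K\<in>?I. T j (axis K 1) = 0) U"
  proof (rule flag_annihilation[OF U(1), where A = "lat k" and B = "lat k" and T = T and rk = rk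
        and t = "\<lambda>K. E (axis K 1)", OF _ _ adm _ rk(1) oneL])
    show "linear (T j)" for j unfolding T_def by (rule linear_wedge_iota)
    show "T j w \<in> lat k j" if "w \<in> lat k j" for j w by (rule T[OF that])
    show "w $ K = 0" if "w \<in> lat k j" "K \<notin> ?I" for j w K using lat_support that by blast
    show "((\<lambda>j. T j (axis K 1)) \<longlongrightarrow> E (axis K 1)) U" for K by (rule TE) simp
    show "infnorm (E (axis K 1)) < 1" for K
      unfolding infnorm_less_iff_cart
    proof
      fix c show "\<bar>E (axis K 1) $ c\<bar> < 1"
        by (cases "c = K") (use off in \<open>simp_all add: diag disj\<close>)
    qed
  qed
  hence "eventually (\<lambda>j. False) U" using V(4)
  proof eventually_elim
    case (elim j)
    \<comment> \<open>The zero entries kill all products of a coordinate of \<open>v j\<close> and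
      one of \<open>f j\<close>: exchange entries those with different indices, and differences of
      diagonal entries the rest. This is impossible for two nonzero vectors.\<close>
    have diag0: "(\<Sum>h\<in>K. v j $ h * f j $ h) = 0" if "card K = k" for K
      using elim(1) that wedge_iota_axis_diag[of "v j" "f j" K] by (simp add: T_def)
    have cross0: "v j $ l * f j $ i = 0" if li: "l \<noteq> i" for l i
    proof -
      obtain K where K: "l \<notin> K" "i \<notin> K" "card (insert l K) = k" "card (insert i K) = k"
        by (rule exists_subset_avoiding[OF k(2) li k(1)])
      have "wedge_sign {l} K * wedge_sign {i} K * (v j $ l * f j $ i) = 0"
        using elim(1) K(4) wedge_iota_axis_exchange[OF li K(1,2), of "v j" "f j"] by (simp add: T_def)
      thus ?thesis using abs_wedge_sign[of "{l}" K] abs_wedge_sign[of "{i}" K] by auto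
    qed
    have "v j \<noteq> 0" using elim(2) Vv[of j] by (auto simp: ext_vec_def)
    then obtain l where l: "v j $ l \<noteq> 0" by (auto simp: vec_eq_iff)
    obtain i where i: "f j $ i \<noteq> 0" using f(1)[of j] by (auto simp: vec_eq_iff)
    have li: "l = i" using cross0[of l i] l i by auto
    have "1 < CARD('m)" using k by simp
    hence "UNIV \<noteq> {l}" by (metis card.empty card.insert empty_iff finite.emptyI less_irrefl One_nat_def)
    then obtain h where h: "h \<noteq> l" by blast
    have vh: "v j $ h = 0" using cross0[OF h] i li by auto
    obtain K where K: "h \<notin> K" "l \<notin> K" "card (insert h K) = k" "card (insert l K) = k"
      by (rule exists_subset_avoiding[OF k(2) h k(1)])
    have "v j $ l * f j $ l = 0" using diag0[OF K(3)] diag0[OF K(4)] K(1,2) vh by simp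
    thus False using l i li by simp
  qed
  thus False using Ubot by (simp add: trivial_limit_def)
qed

end

section \<open>Dirichlet improvability\<close>

text \<open>The extra index \<open>None\<close> belongs to the denominator; it precedes all other
  indices in the order on options.\<close>

definition lift_vec :: "real ^ ('n::{finite,linorder}) \<Rightarrow> real ^ ('n option)" where
  "lift_vec x = (\<chi> i. case i of None \<Rightarrow> 0 | Some i \<Rightarrow> x $ i)"

definition flow :: "real \<Rightarrow> 'n::finite option \<Rightarrow> real" where
  "flow S i = (case i of None \<Rightarrow> 1 / S | Some _ \<Rightarrow> S powr (1 / real CARD('n)))"

definition flow_lattice :: "real ^ ('n::{finite,linorder}) \<Rightarrow> real \<Rightarrow> nat \<Rightarrow> (real ^ ('n option set)) set" where
  "flow_lattice x S k = unimodular_shear.ext_lattice (flow S) None (lift_vec x) k"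

text \<open>The exponents that depend on the degree are absorbed into the parameter
  \<open>S\<close>, so that one family of lattices serves all degrees; \<open>k\<close> stands for
  \<open>d + 1\<close>.\<close>

definition improvable :: "nat \<Rightarrow> real ^ ('n::{finite,linorder}) \<Rightarrow> bool" where
  "improvable k x \<longleftrightarrow> (\<exists>e<1. \<exists>S0. \<forall>S>S0. \<exists>w\<in>flow_lattice x S k. w \<noteq> 0 \<and> infnorm w \<le> e)"

lemma powr_inverse_card_power:
  assumes "S > 0" shows "(S powr (1 / real CARD('n::finite))) ^ CARD('n) = S"
  using assms by (simp add: powr_powr flip: powr_realpow)

lemma unimodular_shear_flow:
  assumes "S > 0"
  shows "unimodular_shear (flow S) (None :: 'n::{finite,linorder} option) (lift_vec x)"
proof
  show "flow S i > 0" for i :: "'n option" using assms by (simp add: flow_def split: option.split)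
  have "(\<Prod>i\<in>UNIV. flow S (i :: 'n option)) = flow S (None :: 'n option) * (\<Prod>i\<in>range Some. flow S (i :: 'n option))"
    unfolding UNIV_option_conv by (rule prod.insert) auto
  also have "(\<Prod>i\<in>range Some. flow S (i :: 'n option)) = (\<Prod>i\<in>(UNIV :: 'n set). S powr (1 / real CARD('n)))"
    by (subst prod.reindex) (simp_all add: flow_def)
  also have "\<dots> = S" using powr_inverse_card_power[OF assms, where 'n='n] by simp
  finally show "(\<Prod>i\<in>UNIV. flow S (i :: 'n option)) = 1" using assms by (simp add: flow_def)
  show "lift_vec x $ None = 0" by (simp add: lift_vec_def)
qed

text \<open>A failure in degree \<open>k\<close> supplies parameters tending to infinity whose
  lattices have no nonzero vectors up to norms tending to 1. Along an ultrafilter this is near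
  admissibility, which \<open>tr\<close> carries to degree \<open>l\<close>, against improvability
  there.\<close>

lemma improvable_transfer:
  fixes x :: "real ^ ('n::{finite,linorder})"
  assumes tr: "\<And>S U. (\<And>j. S j > 0) \<Longrightarrow> ultrafilter U \<Longrightarrow> U \<le> sequentially \<Longrightarrow>
      nearly_admissible U (\<lambda>j. flow_lattice x (S j) k) \<Longrightarrow> nearly_admissible U (\<lambda>j. flow_lattice x (S j) l)"
    and l: "improvable l x"
  shows "improvable k x"
proof (rule ccontr)
  assume not: "\<not> improvable k x"
  have "\<exists>S. S > real (Suc j) \<and> (\<forall>w\<in>flow_lattice x S k. infnorm w \<le> 1 - inverse (real (Suc j)) \<longrightarrow> w = 0)" for j
    using not unfolding improvable_def by (metis diff_less_eq inverse_positive_iff_positive less_add_same_cancel1 of_nat_0_less_iff zero_less_Suc)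
  then obtain S where S: "\<And>j. S j > real (Suc j)"
    "\<And>j w. w \<in> flow_lattice x (S j) k \<Longrightarrow> infnorm w \<le> 1 - inverse (real (Suc j)) \<Longrightarrow> w = 0" by metis
  obtain U where U: "ultrafilter U" "U \<le> sequentially"
    by (rule ultrafilter_below[OF trivial_limit_sequentially])
  have "nearly_admissible U (\<lambda>j. flow_lattice x (S j) k)" unfolding nearly_admissible_def
  proof (intro allI impI)
    fix e :: real assume e: "e < 1"
    have "(\<lambda>j. 1 - inverse (real (Suc j))) \<longlonglongrightarrow> 1 - 0" by (intro tendsto_intros LIMSEQ_inverse_real_of_nat)
    hence "eventually (\<lambda>j. e < 1 - inverse (real (Suc j))) sequentially"
      by (rule order_tendstoD(1)) (use e in simp)
    hence "eventually (\<lambda>j. e < 1 - inverse (real (Suc j))) U" by (rule filter_leD[OF U(2)])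
    thus "eventually (\<lambda>j. \<forall>v\<in>flow_lattice x (S j) k. infnorm v \<le> e \<longrightarrow> v = 0) U"
    proof eventually_elim
      case (elim j)
      thus ?case using S(2)[of _ j] by force
    qed
  qed
  moreover have "S j > 0" for j using S(1)[of j] by linarith
  ultimately have adm: "nearly_admissible U (\<lambda>j. flow_lattice x (S j) l)" using tr U by blast
  obtain e S0 where e: "e < 1" "\<And>T. T > S0 \<Longrightarrow> \<exists>w\<in>flow_lattice x T l. w \<noteq> 0 \<and> infnorm w \<le> e"
    using l unfolding improvable_def by blast
  have "eventually (\<lambda>j. \<forall>v\<in>flow_lattice x (S j) l. infnorm v \<le> e \<longrightarrow> v = 0) U"
    using adm e(1) unfolding nearly_admissible_def by blast
  moreover have "eventually (\<lambda>j. S0 < real j) sequentially" by real_asymp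
  hence "eventually (\<lambda>j. S0 < real j) U" by (rule filter_leD[OF U(2)])
  ultimately have "eventually (\<lambda>j. False) U"
  proof eventually_elim
    case (elim j)
    have "S j > S0" using elim(2) S(1)[of j] by simp
    thus False using e(2)[of "S j"] elim(1) by blast
  qed
  thus False using U(1) by (simp add: ultrafilter_def trivial_limit_def)
qed

text \<open>The ambient dimension is \<open>CARD('n) + 1\<close>, so \<open>k\<close> lies strictly
  below the top degree, as the passage back to vectors requires.\<close>

theorem improvable_iff:
  fixes x :: "real ^ ('n::{finite,linorder})"
  assumes k: "0 < k" "k \<le> CARD('n)"
  shows "improvable k x \<longleftrightarrow> improvable 1 x"
proof -
  have seq: "shear_sequence (\<lambda>j. flow (S j)) (None :: 'n option) (lift_vec x) U"
    if "\<And>j. S j > 0" "ultrafilter U" "U \<le> sequentially" for S U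
    by (unfold_locales) (use that unimodular_shear_flow[of "S _" x] in \<open>auto simp: unimodular_shear_def\<close>)
  have lat: "shear_sequence.lat (\<lambda>j. flow (S j)) (None :: 'n option) (lift_vec x) m = (\<lambda>j. flow_lattice x (S j) m)"
    if "\<And>j. S j > 0" "ultrafilter U" "U \<le> sequentially" for S U m
    using shear_sequence.lat_def[OF seq[of S U, OF that]] by (auto simp: flow_lattice_def)
  have c: "CARD('n option) = Suc CARD('n)" by simp
  have up: "nearly_admissible U (\<lambda>j. flow_lattice x (S j) k)"
    if S: "\<And>j. S j > 0" "ultrafilter U" "U \<le> sequentially" and adm: "nearly_admissible U (\<lambda>j. flow_lattice x (S j) 1)" for S U
    using shear_sequence.nearly_admissible_powers[OF seq[of S U, OF S], of k] adm k c by (simp add: lat[of S U, OF S])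
  have down: "nearly_admissible U (\<lambda>j. flow_lattice x (S j) 1)"
    if S: "\<And>j. S j > 0" "ultrafilter U" "U \<le> sequentially" and adm: "nearly_admissible U (\<lambda>j. flow_lattice x (S j) k)" for S U
    using shear_sequence.nearly_admissible_vectors[OF seq[of S U, OF S] k(1)] adm k c by (simp add: lat[of S U, OF S])
  show ?thesis using improvable_transfer[of x k 1] improvable_transfer[of x 1 k] up down by blast
qed

text \<open>The form e \<and> Z + Y, where e is the basis vector of \<open>None\<close>.\<close>

definition ext_pair :: "real ^ ('n::{finite,linorder} set) \<Rightarrow> real ^ ('n set) \<Rightarrow> real ^ ('n option set)" where
  "ext_pair Z Y = (\<chi> K. if None \<in> K then Z $ (Some -` K) else Y $ (Some -` K))"

lemma option_set_cases:
  obtains (None) H where "K = insert None (Some ` H)" | (Some) L where "K = Some ` L"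
proof -
  have *: "K - {None} = Some ` (Some -` K)"
  proof (intro equalityI subsetI)
    fix a assume "a \<in> K - {None}"
    thus "a \<in> Some ` (Some -` K)" by (cases a) auto
  qed auto
  show ?thesis
  proof (cases "None \<in> K")
    case True
    hence "K = insert None (Some ` (Some -` K))" using * by blast
    thus ?thesis by (rule that(1))
  next
    case False
    hence "K = Some ` (Some -` K)" using * by blast
    thus ?thesis by (rule that(2))
  qed
qed

lemma ext_pair_component:
  "ext_pair Z Y $ insert None (Some ` H) = Z $ H" "ext_pair Z Y $ (Some ` L) = Y $ L"
proof -
  have "Some -` insert None (Some ` H) = H" "Some -` Some ` L = L" by auto
  thus "ext_pair Z Y $ insert None (Some ` H) = Z $ H" "ext_pair Z Y $ (Some ` L) = Y $ L"
    by (auto simp: ext_pair_def)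
qed

lemma card_option_sets: "card (insert None (Some ` H)) = Suc (card H)" "card (Some ` L) = card L"
  for H L :: "'n::finite set"
  by (simp_all add: card_image)

lemma int_ext_power_pair:
  fixes W :: "real ^ ('n::{finite,linorder} option set)"
  shows "W \<in> int_ext_power (Suc d) \<longleftrightarrow> (\<exists>Z\<in>int_ext_power d. \<exists>Y\<in>int_ext_power (Suc d). W = ext_pair Z Y)"
proof
  assume W: "W \<in> int_ext_power (Suc d)"
  define Z where "Z = (\<chi> H. W $ insert None (Some ` H))"
  define Y where "Y = (\<chi> L. W $ (Some ` L))"
  have "W = ext_pair Z Y"
  proof (rule vec_eq_iff[THEN iffD2], rule allI)
    fix K show "W $ K = ext_pair Z Y $ K"
      by (cases K rule: option_set_cases) (simp_all only: ext_pair_component Z_def Y_def vec_lambda_beta)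
  qed
  moreover have WK: "W $ K \<in> \<int>" "card K \<noteq> Suc d \<Longrightarrow> W $ K = 0" for K
    using W by (auto simp: int_ext_power_iff)
  have "Z \<in> int_ext_power d" unfolding int_ext_power_iff Z_def vec_lambda_beta
    by (intro allI conjI impI WK) (simp add: card_image)
  moreover have "Y \<in> int_ext_power (Suc d)" unfolding int_ext_power_iff Y_def vec_lambda_beta
    by (intro allI conjI impI WK) (simp add: card_image)
  ultimately show "\<exists>Z\<in>int_ext_power d. \<exists>Y\<in>int_ext_power (Suc d). W = ext_pair Z Y" by blast
next
  assume "\<exists>Z\<in>int_ext_power d. \<exists>Y\<in>int_ext_power (Suc d). W = ext_pair Z Y"
  then obtain Z Y where ZY: "Z \<in> int_ext_power d" "Y \<in> int_ext_power (Suc d)" "W = ext_pair Z Y" by blast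
  show "W \<in> int_ext_power (Suc d)" unfolding int_ext_power_iff
  proof
    fix K show "W $ K \<in> \<int> \<and> (card K \<noteq> Suc d \<longrightarrow> W $ K = 0)"
      by (cases K rule: option_set_cases)
        (use ZY in \<open>simp_all only: ext_pair_component card_option_sets int_ext_power_iff, auto\<close>)
  qed
qed

text \<open>As \<open>None\<close> is the least index, contracting it causes no sign and returns
  \<open>Z\<close>; and \<open>Some\<close> preserves the order, hence all other signs.\<close>

lemma wedge_lift_component:
  "(ext_vec (lift_vec x) \<and>\<^sub>E ann None (ext_pair Z Y)) $ (Some ` L) = (ext_vec x \<and>\<^sub>E Z) $ L"
proof -
  have diff: "Some ` L - {Some i} = Some ` (L - {i})" for i by auto
  have sgn: "wedge_sign {Some i} (Some ` H) = wedge_sign {i} H" for i and H :: "'a set"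
  proof -
    have "{j \<in> Some ` H. j < Some i} = Some ` {j \<in> H. j < i}" by auto
    thus ?thesis by (simp add: wedge_sign_singleton card_image)
  qed
  have sgn0: "wedge_sign {None} (Some ` H) = 1" for H :: "'a set"
  proof -
    have "{j \<in> Some ` H. j < None} = {}" by auto
    thus ?thesis by (simp only: wedge_sign_singleton card.empty power_0)
  qed
  have nn: "None \<notin> Some ` H" for H :: "'a set" by auto
  have "(ext_vec (lift_vec x) \<and>\<^sub>E ann None (ext_pair Z Y)) $ (Some ` L) =
      (\<Sum>i\<in>Some ` L. lift_vec x $ i * wedge_sign {i} (Some ` L - {i}) * ann None (ext_pair Z Y) $ (Some ` L - {i}))"
    by (rule wedge_ext_vec_component)
  also have "\<dots> = (\<Sum>i\<in>L. lift_vec x $ Some i * wedge_sign {Some i} (Some ` L - {Some i}) *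
      ann None (ext_pair Z Y) $ (Some ` L - {Some i}))"
    by (subst sum.reindex) simp_all
  also have "\<dots> = (\<Sum>i\<in>L. x $ i * wedge_sign {i} (L - {i}) * Z $ (L - {i}))"
    unfolding diff sgn by (simp add: ann_component nn ext_pair_component sgn0 lift_vec_def)
  also have "\<dots> = (ext_vec x \<and>\<^sub>E Z) $ L" by (rule wedge_ext_vec_component[symmetric])
  finally show ?thesis .
qed

lemma flow_map_component:
  fixes x :: "real ^ ('n::{finite,linorder})"
  assumes S: "S > 0"
  defines "t \<equiv> S powr (1 / real CARD('n))"
  shows "unimodular_shear.ext_map (flow S) None (lift_vec x) (ext_pair Z Y) $ insert None (Some ` H) = t ^ card H / S * Z $ H"
    "unimodular_shear.ext_map (flow S) None (lift_vec x) (ext_pair Z Y) $ (Some ` L) =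
      t ^ card L * (ext_vec x \<and>\<^sub>E Z + Y) $ L"
proof -
  note sh = unimodular_shear_flow[OF S, of x]
  have p: "(\<Prod>i\<in>Some ` L. flow S i) = t ^ card L" for L :: "'n set"
    by (subst prod.reindex) (simp_all add: flow_def t_def)
  have "(\<Prod>i\<in>insert None (Some ` H). flow S i) = flow S (None :: 'n option) * (\<Prod>i\<in>Some ` H. flow S i)"
    by (rule prod.insert) auto
  hence p0: "(\<Prod>i\<in>insert None (Some ` H). flow S i) = t ^ card H / S" by (simp add: p) (simp add: flow_def)
  show "unimodular_shear.ext_map (flow S) None (lift_vec x) (ext_pair Z Y) $ insert None (Some ` H) = t ^ card H / S * Z $ H"
    unfolding unimodular_shear.ext_map_component[OF sh] p0 unimodular_shear.wedge_ann_component[OF sh]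
    by (simp add: ext_pair_component)
  show "unimodular_shear.ext_map (flow S) None (lift_vec x) (ext_pair Z Y) $ (Some ` L) =
      t ^ card L * (ext_vec x \<and>\<^sub>E Z + Y) $ L"
    unfolding unimodular_shear.ext_map_component[OF sh] p wedge_lift_component
    by (simp add: ext_pair_component)
qed

lemma wedge_degree:
  assumes "\<And>H. card H \<noteq> d \<Longrightarrow> Z $ H = 0" "card L \<noteq> Suc d"
  shows "(ext_vec x \<and>\<^sub>E Z) $ L = 0"
  unfolding wedge_ext_vec_component
proof (rule sum.neutral, rule ballI)
  fix i assume "i \<in> L"
  hence "card L = Suc (card (L - {i}))" by (intro card.remove) auto
  hence "Z $ (L - {i}) = 0" using assms by auto
  thus "x $ i * wedge_sign {i} (L - {i}) * Z $ (L - {i}) = 0" by simp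
qed

text \<open>This \<open>S\<close> makes the scaling factors \<open>1 / N\<close> on \<open>Z\<close>
  and \<open>N powr omega CARD('n) d\<close> on the error term, so a single norm bound
  \<open>e\<close> splits into the two Diophantine bounds.\<close>

lemma flow_lattice_short_iff:
  fixes x :: "real ^ ('n::{finite,linorder})"
  assumes d: "d < CARD('n)" and N: "N > 0" and S: "S = N powr (real CARD('n) / (real CARD('n) - real d))"
  shows "(\<exists>w\<in>flow_lattice x S (Suc d). w \<noteq> 0 \<and> infnorm w \<le> e) \<longleftrightarrow>
    (\<exists>Z\<in>int_ext_power d. \<exists>Y\<in>int_ext_power (Suc d). (Z \<noteq> 0 \<or> Y \<noteq> 0) \<and> infnorm Z \<le> e * N \<and>
      infnorm (ext_vec x \<and>\<^sub>E Z + Y) \<le> e * N powr (- omega CARD('n) d))"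
proof -
  let ?n = "real CARD('n)"
  have S0: "S > 0" using N S by simp
  note sh = unimodular_shear_flow[OF S0, of x]
  let ?m = "unimodular_shear.ext_map (flow S) None (lift_vec x)"
  define t where "t = S powr (1 / ?n)"
  have nd: "?n - real d > 0" "?n > 0" using d by auto
  have t: "t = N powr (1 / (?n - real d))" using nd by (simp add: t_def S powr_powr)
  have t0: "t > 0" using N by (simp add: t)
  have a: "t ^ d / S = 1 / N"
  proof -
    have "t ^ d = N powr (real d / (?n - real d))" using t0 by (simp add: t powr_powr flip: powr_realpow)
    moreover have "S = N powr (real d / (?n - real d)) * N"
    proof -
      have "?n / (?n - real d) = real d / (?n - real d) + 1" using nd by (simp add: field_simps)
      thus ?thesis using N by (simp add: S powr_add)
    qed
    ultimately show ?thesis using N by simp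
  qed
  have b: "t ^ Suc d = N powr omega CARD('n) d"
  proof -
    have "t ^ Suc d = t powr real (Suc d)" by (rule powr_realpow[OF t0, symmetric])
    also have "\<dots> = N powr (1 / (?n - real d) * real (Suc d))" by (simp only: t powr_powr)
    also have "1 / (?n - real d) * real (Suc d) = omega CARD('n) d" by (simp add: omega_def add.commute)
    finally show ?thesis .
  qed
  have iff: "infnorm (?m (ext_pair Z Y)) \<le> e \<longleftrightarrow> infnorm Z \<le> e * N \<and>
      infnorm (ext_vec x \<and>\<^sub>E Z + Y) \<le> e * N powr (- omega CARD('n) d)"
    and zero: "?m (ext_pair Z Y) = 0 \<longleftrightarrow> Z = 0 \<and> Y = 0"
    if ZY: "Z \<in> int_ext_power d" "Y \<in> int_ext_power (Suc d)" for Z Y e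
  proof -
    have Z0: "Z $ H = 0" if "card H \<noteq> d" for H using ZY(1) that by (simp add: int_ext_power_iff)
    have Y0: "(ext_vec x \<and>\<^sub>E Z + Y) $ L = 0" if "card L \<noteq> Suc d" for L
      using wedge_degree[OF Z0 that] ZY(2) that by (simp add: int_ext_power_iff)
    have mN: "?m (ext_pair Z Y) $ insert None (Some ` H) = Z $ H / N" for H
      unfolding flow_map_component[OF S0] t_def[symmetric] using a Z0[of H] by (cases "card H = d") auto
    have mS: "?m (ext_pair Z Y) $ (Some ` L) = N powr omega CARD('n) d * (ext_vec x \<and>\<^sub>E Z + Y) $ L" for L
      unfolding flow_map_component[OF S0] t_def[symmetric] using b Y0[of L] by (cases "card L = Suc d") auto
    have all: "(\<forall>K. Q (?m (ext_pair Z Y) $ K)) \<longleftrightarrow>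
        (\<forall>H. Q (Z $ H / N)) \<and> (\<forall>L. Q (N powr omega CARD('n) d * (ext_vec x \<and>\<^sub>E Z + Y) $ L))" for Q
    proof
      assume *: "\<forall>K. Q (?m (ext_pair Z Y) $ K)"
      show "(\<forall>H. Q (Z $ H / N)) \<and> (\<forall>L. Q (N powr omega CARD('n) d * (ext_vec x \<and>\<^sub>E Z + Y) $ L))"
        unfolding mN[symmetric] mS[symmetric] using * by blast
    next
      assume *: "(\<forall>H. Q (Z $ H / N)) \<and> (\<forall>L. Q (N powr omega CARD('n) d * (ext_vec x \<and>\<^sub>E Z + Y) $ L))"
      show "\<forall>K. Q (?m (ext_pair Z Y) $ K)"
      proof
        fix K show "Q (?m (ext_pair Z Y) $ K)"
          by (cases K rule: option_set_cases) (use * in \<open>simp_all only: mN mS\<close>)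
      qed
    qed
    have 1: "\<bar>c / N\<bar> \<le> e \<longleftrightarrow> \<bar>c\<bar> \<le> e * N" for c using N by (simp add: abs_divide pos_divide_le_eq)
    have 2: "\<bar>N powr omega CARD('n) d * c\<bar> \<le> e \<longleftrightarrow> \<bar>c\<bar> \<le> e * N powr (- omega CARD('n) d)" for c
      using N by (simp add: abs_mult powr_minus field_simps)
    show "infnorm (?m (ext_pair Z Y)) \<le> e \<longleftrightarrow> infnorm Z \<le> e * N \<and>
      infnorm (ext_vec x \<and>\<^sub>E Z + Y) \<le> e * N powr (- omega CARD('n) d)"
      unfolding infnorm_le_iff_cart all[where Q="\<lambda>t. \<bar>t\<bar> \<le> e"] 1 2 ..
    have "?m (ext_pair Z Y) = 0 \<longleftrightarrow> Z = 0 \<and> ext_vec x \<and>\<^sub>E Z + Y = 0"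
      using all[where Q="\<lambda>t. t = 0"] N by (simp add: vec_eq_iff)
    also have "\<dots> \<longleftrightarrow> Z = 0 \<and> Y = 0" by (auto simp: bilinear_rzero[OF bilinear_wedge])
    finally show "?m (ext_pair Z Y) = 0 \<longleftrightarrow> Z = 0 \<and> Y = 0" .
  qed
  have mem: "(\<exists>w\<in>flow_lattice x S (Suc d). P w) \<longleftrightarrow>
      (\<exists>Z\<in>int_ext_power d. \<exists>Y\<in>int_ext_power (Suc d). P (?m (ext_pair Z Y)))" for P
  proof -
    have "(\<exists>w\<in>flow_lattice x S (Suc d). P w) \<longleftrightarrow> (\<exists>W. W \<in> int_ext_power (Suc d) \<and> P (?m W))"
      unfolding flow_lattice_def unimodular_shear.ext_lattice_def[OF sh] by (simp add: Bex_def)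
    thus ?thesis unfolding int_ext_power_pair by (simp only: Bex_def) metis
  qed
  show ?thesis unfolding mem
  proof (intro bex_cong refl)
    fix Z Y :: "real ^ ('n set)" assume "Z \<in> int_ext_power d" "Y \<in> int_ext_power (Suc d)"
    thus "(?m (ext_pair Z Y) \<noteq> 0 \<and> infnorm (?m (ext_pair Z Y)) \<le> e) \<longleftrightarrow> ((Z \<noteq> 0 \<or> Y \<noteq> 0) \<and> infnorm Z \<le> e * N \<and>
      infnorm (ext_vec x \<and>\<^sub>E Z + Y) \<le> e * N powr (- omega CARD('n) d))" using iff zero by blast
  qed
qed

text \<open>\<open>DI_ext\<close> bounds \<open>Z\<close> by \<open>N\<close>, the lattice condition
  by \<open>e * N\<close>. Applying the former at \<open>c * N\<close> with \<open>c\<close>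
  slightly below 1 trades some of the gain in the error for the bound on \<open>Z\<close>.
  Conversely, \<open>Z = 0\<close> has to be excluded.\<close>

lemma DI_ext_iff_improvable:
  fixes x :: "real ^ ('n::{finite,linorder})"
  assumes d: "d < CARD('n)"
  shows "x \<in> DI_ext d \<longleftrightarrow> improvable (Suc d) x"
proof -
  let ?n = "real CARD('n)"
  let ?w = "omega CARD('n) d"
  let ?a = "?n / (?n - real d)"
  have nd: "?n - real d > 0" "?n > 0" using d by auto
  have a: "?a \<ge> 1" using nd by (simp add: field_simps)
  have w: "?w > 0" using nd by (simp add: omega_def)
  have "improvable (Suc d) x" if "x \<in> DI_ext d"
  proof -
    from that obtain \<epsilon> where \<epsilon>: "0 < \<epsilon>" "\<epsilon> < 1" and "x \<in> DI_ext_eps d \<epsilon>" by (auto simp: DI_ext_def)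
    then obtain N0 where N0: "\<forall>N>N0. \<exists>Z\<in>int_ext_power d - {0}. \<exists>Y\<in>int_ext_power (d + 1).
        infnorm Z \<le> N \<and> infnorm (ext_vec x \<and>\<^sub>E Z + Y) \<le> \<epsilon> * N powr (- ?w)"
      unfolding DI_ext_eps_def mem_Collect_eq by (elim exE)
    \<comment> \<open>With this \<open>c\<close>, the factor \<open>\<epsilon> / c powr ?w\<close>
      is \<open>2 * \<epsilon> / (1 + \<epsilon>)\<close>, which is below 1.\<close>
    define c where "c = ((1 + \<epsilon>) / 2) powr (1 / ?w)"
    have c0: "0 < c" using \<epsilon> by (simp add: c_def)
    have cw: "c powr ?w = (1 + \<epsilon>) / 2" using \<epsilon> w by (simp add: c_def powr_powr)
    have c1: "c < 1" unfolding c_def using powr_less_mono2[of "1 / ?w" "(1 + \<epsilon>) / 2" 1] \<epsilon> w by simp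
    define e where "e = max c (\<epsilon> / c powr ?w)"
    have "\<epsilon> / c powr ?w < 1" unfolding cw using \<epsilon> by (simp add: field_simps)
    hence e1: "e < 1" using c1 by (simp add: e_def)
    define B where "B = max 1 (N0 / c)"
    show ?thesis unfolding improvable_def
    proof (rule exI[of _ e], intro conjI e1, rule exI[of _ "B powr ?a"], intro allI impI)
      fix S assume S: "S > B powr ?a"
      have S0: "S > 0" using S powr_ge_zero[of B ?a] by linarith
      define N where "N = S powr (1 / ?a)"
      have N: "N > 0" using S0 by (simp add: N_def)
      have SN: "S = N powr ?a" using S0 nd by (simp add: N_def powr_powr)
      have "B < N"
      proof (rule ccontr)
        assume "\<not> B < N"
        hence "N powr ?a \<le> B powr ?a" using N a by (intro powr_mono2) auto
        thus False using S SN by simp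
      qed
      hence "c * N > N0" using c0 by (simp add: B_def field_simps)
      then obtain Z Y where ZY: "Z \<in> int_ext_power d - {0}" "Y \<in> int_ext_power (d + 1)"
        "infnorm Z \<le> c * N" "infnorm (ext_vec x \<and>\<^sub>E Z + Y) \<le> \<epsilon> * (c * N) powr (- ?w)" using N0 by blast
      have "c * N \<le> e * N" using N by (simp add: e_def)
      hence 1: "infnorm Z \<le> e * N" using ZY(3) by linarith
      have "\<epsilon> * (c * N) powr (- ?w) = (\<epsilon> / c powr ?w) * N powr (- ?w)"
        using c0 N by (simp add: powr_mult powr_minus divide_simps)
      also have "\<dots> \<le> e * N powr (- ?w)" by (rule mult_right_mono) (simp_all add: e_def)
      finally have 2: "infnorm (ext_vec x \<and>\<^sub>E Z + Y) \<le> e * N powr (- ?w)" using ZY(4) by linarith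
      show "\<exists>w\<in>flow_lattice x S (Suc d). w \<noteq> 0 \<and> infnorm w \<le> e"
        unfolding flow_lattice_short_iff[OF d N SN] using ZY(1,2) 1 2 by auto
    qed
  qed
  moreover have "x \<in> DI_ext d" if "improvable (Suc d) x"
  proof -
    from that obtain e S0 where e1: "e < 1" and S0: "\<And>S. S > S0 \<Longrightarrow> \<exists>w\<in>flow_lattice x S (Suc d). w \<noteq> 0 \<and> infnorm w \<le> e"
      unfolding improvable_def by blast
    \<comment> \<open>\<open>DI_ext\<close> asks for a positive \<epsilon>, which
      \<open>improvable\<close> does not promise for \<open>e\<close>.\<close>
    define \<epsilon> where "\<epsilon> = max e (1/2)"
    have \<epsilon>: "0 < \<epsilon>" "\<epsilon> < 1" "e \<le> \<epsilon>" using e1 by (auto simp: \<epsilon>_def)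
    have "\<exists>Z\<in>int_ext_power d - {0}. \<exists>Y\<in>int_ext_power (d + 1).
        infnorm Z \<le> N \<and> infnorm (ext_vec x \<and>\<^sub>E Z + Y) \<le> \<epsilon> * N powr (- ?w)" if N: "N > max 1 S0" for N
    proof -
      have N0: "N > 0" "N \<ge> 1" using N by auto
      have "N powr 1 \<le> N powr ?a" by (rule powr_mono[OF a N0(2)])
      hence "N powr ?a > S0" using N by simp
      then obtain Z Y where ZY: "Z \<in> int_ext_power d" "Y \<in> int_ext_power (Suc d)" "Z \<noteq> 0 \<or> Y \<noteq> 0"
        "infnorm Z \<le> e * N" "infnorm (ext_vec x \<and>\<^sub>E Z + Y) \<le> e * N powr (- ?w)"
        using S0 flow_lattice_short_iff[OF d N0(1) refl, of x e] by blast
      have Np: "0 \<le> N powr (- ?w)" "N powr (- ?w) \<le> 1"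
        using powr_mono[of "- ?w" 0 N] N0 w by auto
      have 2: "infnorm (ext_vec x \<and>\<^sub>E Z + Y) \<le> \<epsilon> * N powr (- ?w)"
        using ZY(5) mult_right_mono[OF \<epsilon>(3) Np(1)] by linarith
      \<comment> \<open>With \<open>Z = 0\<close> the error is the integral form \<open>Y\<close>
        itself, and its norm would be below 1.\<close>
      have "Z \<noteq> 0"
      proof
        assume Z: "Z = 0"
        have "\<epsilon> * N powr (- ?w) < 1" using mult_left_mono[OF Np(2), of \<epsilon>] \<epsilon> by linarith
        hence "infnorm Y < 1" using 2 by (simp add: Z bilinear_rzero[OF bilinear_wedge])
        hence "\<bar>Y $ K\<bar> < 1" for K by (simp add: infnorm_less_iff_cart)
        moreover have "Y $ K \<in> \<int>" for K using ZY(2) by (simp add: int_ext_power_iff)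
        ultimately have "Y $ K = 0" for K by (metis Ints_cases of_int_abs of_int_less_1_iff zabs_less_one_iff of_int_0)
        hence "Y = 0" by (simp add: vec_eq_iff)
        thus False using ZY(3) Z by simp
      qed
      moreover have "e * N \<le> 1 * N" using e1 N0 by (intro mult_right_mono) auto
      hence "infnorm Z \<le> N" using ZY(4) by linarith
      ultimately show ?thesis using ZY(1,2) 2 by (intro bexI[of _ Z] bexI[of _ Y]) auto
    qed
    hence "x \<in> DI_ext_eps d \<epsilon>" unfolding DI_ext_eps_def by blast
    thus ?thesis unfolding DI_ext_def using \<epsilon>(1,2) by auto
  qed
  ultimately show ?thesis by blast
qed

section \<open>The classical case as degree 0\<close>

lemma wedge_scalar: "ext_vec x \<and>\<^sub>E (q *\<^sub>R axis {} 1) = ext_vec (q *\<^sub>R x)"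
proof (rule vec_eq_iff[THEN iffD2], rule allI)
  fix L
  have "(ext_vec x \<and>\<^sub>E (q *\<^sub>R axis {} 1)) $ L = (\<Sum>i\<in>L. if L = {i} then q * x $ i else 0)"
    unfolding wedge_ext_vec_component
  proof (rule sum.cong[OF refl])
    fix i assume i: "i \<in> L"
    show "x $ i * wedge_sign {i} (L - {i}) * (q *\<^sub>R axis {} 1) $ (L - {i}) = (if L = {i} then q * x $ i else 0)"
    proof (cases "L = {i}")
      case True
      have "wedge_sign {i} {} = 1" by (simp add: wedge_sign_singleton)
      thus ?thesis unfolding True by (simp add: axis_def)
    next
      case False
      hence "L - {i} \<noteq> {}" using i by auto
      thus ?thesis using False by (simp add: axis_def)
    qed
  qed
  also have "\<dots> = (\<Sum>i\<in>UNIV. if L = {i} then q * x $ i else 0)" by (rule sum.mono_neutral_left) auto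
  finally show "(ext_vec x \<and>\<^sub>E (q *\<^sub>R axis {} 1)) $ L = ext_vec (q *\<^sub>R x) $ L"
    by (simp add: ext_vec_component cong: if_cong)
qed

lemma infnorm_ext_vec_le_iff:
  assumes "0 \<le> c"
  shows "infnorm (ext_vec v) \<le> c \<longleftrightarrow> (\<forall>i. \<bar>v $ i\<bar> \<le> c)"
proof -
  have s: "ext_vec v $ {i} = v $ i" for i by (simp add: ext_vec_component)
  have z: "ext_vec v $ L = 0" if "card L \<noteq> 1" for L using that by (auto simp: ext_vec_component intro!: sum.neutral)
  show ?thesis unfolding infnorm_le_iff_cart
  proof
    assume "\<forall>L. \<bar>ext_vec v $ L\<bar> \<le> c"
    thus "\<forall>i. \<bar>v $ i\<bar> \<le> c" using s by metis
  next
    assume *: "\<forall>i. \<bar>v $ i\<bar> \<le> c"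
    show "\<forall>L. \<bar>ext_vec v $ L\<bar> \<le> c"
    proof
      fix L show "\<bar>ext_vec v $ L\<bar> \<le> c"
      proof (cases "card L = 1")
        case True
        then obtain i where "L = {i}" by (auto simp: card_1_singleton_iff)
        thus ?thesis using s * by simp
      next
        case False thus ?thesis using z assms by simp
      qed
    qed
  qed
qed

text \<open>In degree 0, \<open>Z\<close> is the scalar \<open>q\<close>, and \<open>Y\<close> holds
  the negatives of the nearest integers. The strict inequality in \<open>DI\<close> is met by
  enlarging \<epsilon>.\<close>

lemma DI_eq_DI_ext_0: "(DI :: (real ^ ('n::{finite,linorder})) set) = DI_ext 0"
proof -
  have om: "omega CARD('n) 0 = 1 / real CARD('n)" by (simp add: omega_def)
  have "x \<in> DI_ext 0" if "x \<in> DI" for x :: "real ^ ('n::{finite,linorder})"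
  proof -
    from that obtain \<epsilon> N0 where \<epsilon>: "\<epsilon> \<in> {0<..<1}" and N0: "\<And>N. N > N0 \<Longrightarrow> \<exists>q::int.
        (MAX i. infdist (of_int q * x $ i) \<int>) < \<epsilon> * N powr (- (1 / real CARD('n))) \<and> 1 \<le> q \<and> of_int q \<le> N"
      unfolding DI_def by blast
    have "\<exists>Z\<in>int_ext_power 0 - {0}. \<exists>Y\<in>int_ext_power (0 + 1).
        infnorm Z \<le> N \<and> infnorm (ext_vec x \<and>\<^sub>E Z + Y) \<le> \<epsilon> * N powr (- omega CARD('n) 0)" if N: "N > N0" for N
    proof -
      obtain q :: int where q: "(MAX i. infdist (of_int q * x $ i) \<int>) < \<epsilon> * N powr (- (1 / real CARD('n)))"
        "1 \<le> q" "of_int q \<le> N" using N0[OF N] by blast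
      have "\<exists>a\<in>\<int>. infdist (of_int q * x $ i) \<int> = dist (of_int q * x $ i) a" for i
        using infdist_attains_inf[OF closed_Ints, of "of_int q * x $ i"] by (metis Ints_0 empty_iff)
      then obtain a where a: "\<And>i. a i \<in> \<int>" "\<And>i. infdist (of_int q * x $ i) \<int> = dist (of_int q * x $ i) (a i)" by metis
      define Z :: "real ^ ('n set)" where "Z = of_int q *\<^sub>R axis {} 1"
      define Y :: "real ^ ('n set)" where "Y = ext_vec (\<chi> i. - a i)"
      have lt: "\<bar>of_int q * x $ i - a i\<bar> < \<epsilon> * N powr (- (1 / real CARD('n)))" for i
      proof -
        have "infdist (of_int q * x $ i) \<int> \<le> (MAX i. infdist (of_int q * x $ i) \<int>)" by (rule Max_ge) auto
        from le_less_trans[OF this q(1)] show ?thesis using a(2)[of i] by (simp add: dist_real_def)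
      qed
      have sum: "ext_vec x \<and>\<^sub>E Z + Y = ext_vec (\<chi> i. of_int q * x $ i - a i)"
      proof -
        have "(\<chi> i. of_int q * x $ i - a i) = of_int q *\<^sub>R x + (\<chi> i. - a i)" by (simp add: vec_eq_iff)
        thus ?thesis unfolding Z_def Y_def wedge_scalar by (simp only: ext_vec_add)
      qed
      have "0 \<le> \<epsilon> * N powr (- (1 / real CARD('n)))" using \<epsilon> by simp
      hence "infnorm (ext_vec x \<and>\<^sub>E Z + Y) \<le> \<epsilon> * N powr (- omega CARD('n) 0)"
        unfolding sum om using lt by (simp add: infnorm_ext_vec_le_iff less_imp_le)
      moreover have "infnorm Z \<le> N"
        unfolding infnorm_le_iff_cart Z_def using q(2,3) by (auto simp: axis_def)
      moreover have "Z \<in> int_ext_power 0 - {0}"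
        using q(2) by (auto simp: Z_def int_ext_power_iff axis_def vec_eq_iff)
      moreover have "Y \<in> int_ext_power (0 + 1)"
        unfolding int_ext_power_iff Y_def ext_vec_component
        using a(1) by (auto intro!: Ints_sum sum.neutral)
      ultimately show ?thesis by blast
    qed
    hence "x \<in> DI_ext_eps 0 \<epsilon>" unfolding DI_ext_eps_def by blast
    thus ?thesis unfolding DI_ext_def using \<epsilon> by auto
  qed
  moreover have "x \<in> DI" if "x \<in> DI_ext 0" for x :: "real ^ ('n::{finite,linorder})"
  proof -
    from that obtain \<epsilon> where \<epsilon>: "0 < \<epsilon>" "\<epsilon> < 1" and "x \<in> DI_ext_eps 0 \<epsilon>" by (auto simp: DI_ext_def)
    then obtain N0 where N0: "\<forall>N>N0. \<exists>Z\<in>int_ext_power 0 - {0}. \<exists>Y\<in>int_ext_power (0 + 1).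
        infnorm Z \<le> N \<and> infnorm (ext_vec x \<and>\<^sub>E Z + Y) \<le> \<epsilon> * N powr (- omega CARD('n) 0)"
      unfolding DI_ext_eps_def mem_Collect_eq by (elim exE)
    define \<delta> where "\<delta> = (1 + \<epsilon>) / 2"
    have \<delta>: "\<delta> \<in> {0<..<1}" "\<epsilon> < \<delta>" using \<epsilon> by (auto simp: \<delta>_def)
    have "\<exists>q::int. (MAX i. infdist (of_int q * x $ i) \<int>) < \<delta> * N powr (- (1 / real CARD('n))) \<and> 1 \<le> q \<and> of_int q \<le> N"
      if N: "N > max 0 N0" for N
    proof -
      obtain Z Y where ZY: "Z \<in> int_ext_power 0 - {0}" "Y \<in> int_ext_power (0 + 1)"
        "infnorm Z \<le> N" "infnorm (ext_vec x \<and>\<^sub>E Z + Y) \<le> \<epsilon> * N powr (- omega CARD('n) 0)" using N0 N by force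
      obtain m where m: "Z $ {} = of_int m" 
      proof -
        have "Z $ {} \<in> \<int>" using ZY(1) by (simp add: int_ext_power_iff)
        thus ?thesis using that by (auto elim: Ints_cases)
      qed
      have Zq: "Z = of_int m *\<^sub>R axis {} 1"
        using ZY(1) m by (auto simp: int_ext_power_iff axis_def vec_eq_iff)
      have m0: "m \<noteq> 0" using ZY(1) Zq by auto
      have "\<bar>Z $ {}\<bar> \<le> N" using ZY(3) by (simp add: infnorm_le_iff_cart)
      hence qN: "of_int \<bar>m\<bar> \<le> N" unfolding m by simp
      have Np: "N powr (- (1 / real CARD('n))) > 0" using N by simp
      have "infdist (of_int \<bar>m\<bar> * x $ i) \<int> < \<delta> * N powr (- (1 / real CARD('n)))" for i
      proof -
        have "(ext_vec x \<and>\<^sub>E Z + Y) $ {i} = of_int m * x $ i + Y $ {i}"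
          unfolding Zq wedge_scalar by (simp add: ext_vec_component)
        hence le: "\<bar>of_int m * x $ i + Y $ {i}\<bar> \<le> \<epsilon> * N powr (- (1 / real CARD('n)))"
          using ZY(4) unfolding om infnorm_le_iff_cart by metis
        \<comment> \<open>Multiplying by the sign of \<open>m\<close> makes the denominator positive
          and keeps the size of the error.\<close>
        define y where "y = - of_int (sgn m) * Y $ {i}"
        have y: "y \<in> \<int>" unfolding y_def using ZY(2) by (intro Ints_mult) (auto simp: int_ext_power_iff)
        have "of_int \<bar>m\<bar> = (of_int (sgn m) * of_int m :: real)"
          by (metis abs_sgn mult.commute of_int_mult)
        hence "of_int \<bar>m\<bar> * x $ i - y = of_int (sgn m) * (of_int m * x $ i + Y $ {i})"
          by (simp add: y_def algebra_simps)
        hence "\<bar>of_int \<bar>m\<bar> * x $ i - y\<bar> = \<bar>of_int m * x $ i + Y $ {i}\<bar>"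
          using m0 by (simp add: abs_mult sgn_if split: if_splits)
        moreover have "infdist (of_int \<bar>m\<bar> * x $ i) \<int> \<le> dist (of_int \<bar>m\<bar> * x $ i) y" by (rule infdist_le[OF y])
        ultimately have "infdist (of_int \<bar>m\<bar> * x $ i) \<int> \<le> \<epsilon> * N powr (- (1 / real CARD('n)))"
          using le by (simp add: dist_real_def)
        also have "\<dots> < \<delta> * N powr (- (1 / real CARD('n)))" using \<delta>(2) Np by simp
        finally show ?thesis .
      qed
      hence "(MAX i. infdist (of_int \<bar>m\<bar> * x $ i) \<int>) < \<delta> * N powr (- (1 / real CARD('n)))"
        by (subst Max_less_iff) auto
      moreover have "1 \<le> \<bar>m\<bar>" using m0 by simp
      ultimately show ?thesis using qN by blast
    qed
    thus ?thesis unfolding DI_def using \<delta>(1) by blast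
  qed
  ultimately show ?thesis by blast
qed

theorem proposition4p2:
  fixes d :: nat
  assumes "d \<le> CARD('n::{finite,linorder}) - 1"
  shows "DI_ext d = (DI :: (real ^ ('n::{finite,linorder})) set)"
proof -
  have d: "d < CARD('n)" "0 < CARD('n)" using assms zero_less_card_finite[where 'a='n] by linarith+
  have "x \<in> DI_ext d \<longleftrightarrow> x \<in> DI_ext 0" for x :: "real ^ ('n::{finite,linorder})"
    unfolding DI_ext_iff_improvable[OF d(1)] DI_ext_iff_improvable[OF d(2)]
    using improvable_iff[of "Suc d" x] d(1) by simp
  thus ?thesis unfolding DI_eq_DI_ext_0 by blast
qed

end
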